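(* Assume $\mu\le0$, $q\in(2,\frac83)$ and $p\in(\frac{10}3,6)$. Then there exists some $\widetilde a_0>0$ such that for any $a\in(0,\widetilde a_0)$ the problem $$-\Delta u+\lambda u+(|x|^{-1}\ast|u|^2)u=|u|^{p-2}u+\mu|u|^{q-2}u\ \text{ in }\mathbb R^3,\qquad \int_{\mathbb R^3}|u|^2dx=a^2,$$ has a normalized solution $(\widetilde\lambda,\widetilde u)\in\mathbb R^+\times\mathcal H_r$.
   Context: $\mathbb R^+=(0,\infty)$; $\mathcal H_r$ is the subspace of radial functions in $H^1(\mathbb R^3,\mathbb C)$; $\ast$ is convolution. A normalized solution is a pair $(\lambda,u)$ with $\int|u|^2=a^2$ such that $u$ solves the equation with this $\lambda$ ($\lambda$ is an unknown, appearing as a Lagrange multiplier). *)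

theory Defs
  imports "HOL-Analysis.Analysis"
begin

text \<open>
  Elements of function spaces are represented by Borel functions on \<open>\<real>\<^sup>3\<close>; every Lebesgue class has
  such a representative.
\<close>

primrec Ck :: "nat \<Rightarrow> ('a::real_normed_vector \<Rightarrow> 'b::real_normed_vector) \<Rightarrow> bool" where
  "Ck 0 f \<longleftrightarrow> continuous_on UNIV f"
| "Ck (Suc k) f \<longleftrightarrow>
     (\<forall>x. f differentiable (at x)) \<and> (\<forall>v. Ck k (\<lambda>x. frechet_derivative f (at x) v))"

definition test_functions :: "(real^3 \<Rightarrow> complex) set" where
  "test_functions = {\<phi>. (\<forall>k. Ck k \<phi>) \<and> compact (closure {x. \<phi> x \<noteq> 0})}"

definition partial_deriv :: "3 \<Rightarrow> (real^3 \<Rightarrow> complex) \<Rightarrow> real^3 \<Rightarrow> complex" where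
  "partial_deriv i \<phi> x = frechet_derivative \<phi> (at x) (axis i 1)"

definition L2 :: "(real^3 \<Rightarrow> 'b::euclidean_space) set" where
  "L2 = {u. u \<in> borel_measurable lborel \<and> integrable lborel (\<lambda>x. (norm (u x))\<^sup>2)}"

text \<open>
  The weak gradient is a relation, since it is determined only up to null sets. The integrals below
  converge by Cauchy--Schwarz.
\<close>

definition weak_gradient :: "(real^3 \<Rightarrow> complex) \<Rightarrow> (real^3 \<Rightarrow> complex^3) \<Rightarrow> bool" where
  "weak_gradient u g \<longleftrightarrow> u \<in> L2 \<and> g \<in> L2 \<and>
     (\<forall>\<phi>\<in>test_functions. \<forall>i.
        (LINT x|lborel. u x * partial_deriv i \<phi> x) = - (LINT x|lborel. g x $ i * \<phi> x))"

definition H1 :: "(real^3 \<Rightarrow> complex) set" where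
  "H1 = {u \<in> L2. \<exists>g. weak_gradient u g}"

definition H1_rad :: "(real^3 \<Rightarrow> complex) set" where
  "H1_rad = {u \<in> H1. \<exists>f. AE x in lborel. u x = f (norm x)}"

definition conv :: "(real^3 \<Rightarrow> real) \<Rightarrow> (real^3 \<Rightarrow> real) \<Rightarrow> real^3 \<Rightarrow> real" where
  "conv f g x = (LINT y|lborel. f (x - y) * g y)"

definition coulomb_potential :: "(real^3 \<Rightarrow> complex) \<Rightarrow> real^3 \<Rightarrow> real" where
  "coulomb_potential u = conv (\<lambda>x. 1 / norm x) (\<lambda>x. (norm (u x))\<^sup>2)"

text \<open>
  Weak solutions of
  \<open>- \<Delta>u + \<Lambda> u + (|x|\<^sup>-\<^sup>1 * |u|\<^sup>2) u = |u|\<^sup>p\<^sup>-\<^sup>2 u + \<mu> |u|\<^sup>q\<^sup>-\<^sup>2 u\<close> in \<open>\<real>\<^sup>3\<close>.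
  Integrability is demanded explicitly because the Lebesgue integral of a non-integrable function
  is \<open>0\<close> by convention; for \<open>u \<in> H1\<close> and \<open>2 < p, q < 6\<close> it holds automatically.
\<close>

definition weak_solution ::
    "real \<Rightarrow> real \<Rightarrow> real \<Rightarrow> real \<Rightarrow> (real^3 \<Rightarrow> complex) \<Rightarrow> bool" where
  "weak_solution p q \<mu> \<Lambda> u \<longleftrightarrow>
     (AE x in lborel. integrable lborel (\<lambda>y. 1 / norm (x - y) * (norm (u y))\<^sup>2)) \<and>
     (\<exists>g. weak_gradient u g \<and>
       (\<forall>\<phi>\<in>test_functions.
          let lhs = (\<lambda>x. (\<Sum>i\<in>UNIV. g x $ i * cnj (partial_deriv i \<phi> x))
                       + of_real \<Lambda> * u x * cnj (\<phi> x)
                       + of_real (coulomb_potential u x) * u x * cnj (\<phi> x));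
              rhs = (\<lambda>x. of_real (norm (u x) powr (p - 2)) * u x * cnj (\<phi> x)
                       + of_real \<mu> * of_real (norm (u x) powr (q - 2)) * u x * cnj (\<phi> x))
          in integrable lborel lhs \<and> integrable lborel rhs \<and>
             integral\<^sup>L lborel lhs = integral\<^sup>L lborel rhs))"

definition normalized_solution ::
    "real \<Rightarrow> real \<Rightarrow> real \<Rightarrow> real \<Rightarrow> real \<Rightarrow> (real^3 \<Rightarrow> complex) \<Rightarrow> bool" where
  "normalized_solution p q \<mu> a \<Lambda> u \<longleftrightarrow>
     weak_solution p q \<mu> \<Lambda> u \<and> (LINT x|lborel. (norm (u x))\<^sup>2) = a\<^sup>2"

end

theory Submission
  imports Defs "HOL-Complex_Analysis.Great_Picard"
begin

text \<open>
  A radial function \<open>u(x) = v(|x|) / |x|\<close> solves the equation as soon as \<open>v\<close> solves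
  \<open>v'' = \<Lambda> v + \<Phi> v - \<mu> |v|\<^sup>q\<^sup>-\<^sup>2 v r\<^sup>2\<^sup>-\<^sup>q - |v|\<^sup>p\<^sup>-\<^sup>2 v r\<^sup>2\<^sup>-\<^sup>p\<close> on the half-line with \<open>v(0) = 0\<close>, where by Newton's theorem
  \<open>\<Phi>(r) = 4\<pi> \<integral> v(s)\<^sup>2 / max r s ds\<close>. The dilations \<open>v\<^sub>t(r) = \<surd>t v(t r)\<close> preserve the mass, and along each of
  them the energy has a single critical point, its maximum, because \<open>q < 8/3\<close> and \<open>p > 10/3\<close>. We minimise
  the energy over functions of mass at most \<open>m\<close> sitting at this maximum (the Pohozaev set). Minimising
  sequences are bounded and equi-Hoelder; along a pointwise convergent subsequence the \<open>p\<close>-term converges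
  by dominated convergence, and all other terms are lower semicontinuous, so a minimiser exists.
  Smallness of \<open>m\<close> forces a large gradient term, whence the would-be multiplier is positive; this
  excludes mass loss and gives \<open>\<Lambda> > 0\<close>. Testing with hat functions yields \<open>v \<in> C\<^sup>2(0,\<infinity>)\<close>, and crude
  estimates at the origin suffice to integrate by parts in \<open>\<real>\<^sup>3\<close> along almost all lines.
\<close>

text \<open>One balance produces the threshold on the mass. Let \<open>A\<close>, \<open>B\<close>,
  \<open>C\<close>, \<open>D\<close> be the gradient, Coulomb, \<open>p\<close>- and
  \<open>q\<close>-terms. Testing the equation with its solution gives
  \<open>m * \<Lambda> = C - A - B - \<nu> * D\<close>. On the Pohozaev set \<open>C\<close> is at
  least \<open>p / tau * A\<close>, and \<open>tau < p\<close> because \<open>p < 6\<close>, so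
  \<open>C - A\<close> dominates a positive multiple of \<open>A\<close>. For
  \<open>m \<le> 1 \<le> A\<close>, \<open>B\<close> is of order \<open>sqrt A\<close>, and so is
  \<open>D\<close> because \<open>q < 8 / 3\<close>. Inserting Gagliardo-Nirenberg into the Pohozaev
  identity gives \<open>gap \<le> A\<close>, where \<open>gap\<close> blows up as \<open>m\<close>
  tends to 0 since \<open>tau > 2\<close>. The obstacle is that mass, \<open>B\<close> and
  \<open>D\<close> may drop in the limit. A drop of the mass respects the constraint "at most
  \<open>m\<close>"; a drop of \<open>B\<close> or \<open>D\<close> lowers the energy but leaves the
  Pohozaev set, and a dilation leads back to it. The mass becomes exact only afterwards, from the
  sign of the multiplier. The gradient term is a number \<open>A\<close> carried along with
  \<open>v\<close>, not a functional of \<open>v\<close>. The limit of the numbers is then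
  admissible for the limit function, and no weak derivative occurs before the Euler-Lagrange
  equation has made \<open>v\<close> smooth.\<close>

section \<open>Functions of finite energy on the half-line\<close>

text \<open>
  Encodes \<open>v(0) = 0\<close> and \<open>\<integral> v'\<^sup>2 \<le> A\<close> without derivatives: think of \<open>G(t) = \<integral>\<^sub>0\<^sup>t v'\<^sup>2\<close>, for which the
  inequality is Cauchy--Schwarz. In this form the condition is stable under pointwise limits: take
  the lower limit of the \<open>G\<close>.
\<close>

definition energy_le :: "(real \<Rightarrow> real) \<Rightarrow> real \<Rightarrow> bool" where
  "energy_le v A \<longleftrightarrow> (\<forall>r\<le>0. v r = 0) \<and>
     (\<exists>G. (\<forall>s t. s < t \<longrightarrow> G s + (v t - v s)\<^sup>2 / (t - s) \<le> G t) \<and> (\<forall>t. 0 \<le> G t \<and> G t \<le> A))"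

lemma energy_leE:
  assumes "energy_le v A"
  obtains G where "\<And>s t. s < t \<Longrightarrow> G s + (v t - v s)\<^sup>2 / (t - s) \<le> G t"
    and "\<And>t. 0 \<le> G t" and "\<And>t. G t \<le> A"
  using assms unfolding energy_le_def by blast

lemma energy_le_zero: "energy_le v A \<Longrightarrow> r \<le> 0 \<Longrightarrow> v r = 0"
  by (simp add: energy_le_def)

lemma energy_le_nonneg: "energy_le v A \<Longrightarrow> 0 \<le> A"
  by (meson energy_le_def order_trans)

lemma energy_le_holder:
  assumes "energy_le v A"
  shows "(v t - v s)\<^sup>2 \<le> A * \<bar>t - s\<bar>"
proof -
  obtain G where G: "\<And>s t. s < t \<Longrightarrow> G s + (v t - v s)\<^sup>2 / (t - s) \<le> G t"
      "\<And>t. 0 \<le> G t" "\<And>t. G t \<le> A"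
    using assms by (rule energy_leE) blast
  have *: "(v t - v s)\<^sup>2 \<le> A * (t - s)" if "s < t" for s t
  proof -
    have "(v t - v s)\<^sup>2 / (t - s) \<le> A" using G(1)[OF that] G(2)[of s] G(3)[of t] by linarith
    then show ?thesis using that by (simp add: divide_le_eq)
  qed
  show ?thesis
    using *[of s t] *[of t s] by (cases s t rule: linorder_cases) (auto simp: power2_commute)
qed

lemma energy_le_point: "energy_le v A \<Longrightarrow> 0 \<le> r \<Longrightarrow> (v r)\<^sup>2 \<le> A * r"
  using energy_le_holder[of v A r 0] by (simp add: energy_le_zero)

lemma energy_le_continuous:
  assumes "energy_le v A"
  shows "continuous_on UNIV v"
proof -
  have "isCont v s" for s
  proof -
    have "((\<lambda>t. sqrt (A * \<bar>t - s\<bar>)) \<longlongrightarrow> sqrt (A * \<bar>s - s\<bar>)) (at s)"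
      by (intro tendsto_intros)
    then have "((\<lambda>t. sqrt (A * \<bar>t - s\<bar>)) \<longlongrightarrow> 0) (at s)" by simp
    moreover have "\<forall>\<^sub>F t in at s. norm (v t - v s) \<le> sqrt (A * \<bar>t - s\<bar>)"
      using energy_le_holder[OF assms] by (auto intro!: always_eventually real_le_rsqrt)
    ultimately have "((\<lambda>t. v t - v s) \<longlongrightarrow> 0) (at s)" by (rule Lim_null_comparison[rotated])
    then show ?thesis by (simp add: isCont_def LIM_zero_iff)
  qed
  then show ?thesis by (simp add: continuous_on_eq_continuous_at)
qed

lemma energy_le_measurable [measurable_dest]: "energy_le v A \<Longrightarrow> v \<in> borel_measurable borel"
  using energy_le_continuous borel_measurable_continuous_onI by blast

lemma energy_le_scale:
  assumes "energy_le v A" "0 < t"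
  shows "energy_le (\<lambda>r. c * v (t * r)) (c\<^sup>2 * t * A)"
proof -
  obtain G where G: "\<And>s t. s < t \<Longrightarrow> G s + (v t - v s)\<^sup>2 / (t - s) \<le> G t"
      "\<And>t. 0 \<le> G t" "\<And>t. G t \<le> A"
    using assms(1) by (rule energy_leE) blast
  have "c\<^sup>2 * t * G (t * a) + (c * v (t * b) - c * v (t * a))\<^sup>2 / (b - a) \<le> c\<^sup>2 * t * G (t * b)"
    if "a < b" for a b
  proof -
    have "c\<^sup>2 * t * (G (t * a) + (v (t * b) - v (t * a))\<^sup>2 / (t * b - t * a)) \<le> c\<^sup>2 * t * G (t * b)"
      using G(1)[of "t * a" "t * b"] that assms(2) by (intro mult_left_mono) auto
    moreover have "(c * v (t * b) - c * v (t * a))\<^sup>2 / (b - a)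
        = c\<^sup>2 * t * ((v (t * b) - v (t * a))\<^sup>2 / (t * b - t * a))"
    proof -
      have "(c * v (t * b) - c * v (t * a))\<^sup>2 = c\<^sup>2 * (v (t * b) - v (t * a))\<^sup>2"
        by (simp add: power_mult_distrib[symmetric] algebra_simps)
      then show ?thesis using that assms(2) by (simp add: right_diff_distrib[symmetric])
    qed
    ultimately show ?thesis by (simp add: distrib_left)
  qed
  moreover have "0 \<le> c\<^sup>2 * t * G (t * r) \<and> c\<^sup>2 * t * G (t * r) \<le> c\<^sup>2 * t * A" for r
    using G(2,3)[of "t * r"] assms(2) by (auto intro!: mult_left_mono)
  moreover have "c * v (t * r) = 0" if "r \<le> 0" for r
    using that assms by (simp add: energy_le_zero mult_le_0_iff)
  ultimately show ?thesis unfolding energy_le_def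
    by (intro conjI exI[of _ "\<lambda>r. c\<^sup>2 * t * G (t * r)"]) auto
qed

lemma mult_le_half_sum_square: "x * y \<le> ((x + y) / 2)\<^sup>2" for x y :: real
  using zero_le_power2[of "x - y"] by (simp add: power_divide power2_sum power2_diff)

text \<open>Glues Cauchy-Schwarz bounds on adjacent intervals: \<open>d\<close>, \<open>e\<close>
  are lengths, \<open>g\<close>, \<open>h\<close> increments of the energy function. The cross term
  obeys \<open>2 * x * y \<le> d * h + e * g\<close> by the inequality of the means.\<close>

lemma square_le_mult_add:
  fixes x y d e g h :: real
  assumes "x\<^sup>2 \<le> d * g" "y\<^sup>2 \<le> e * h" "0 \<le> d" "0 \<le> e" "0 \<le> g" "0 \<le> h"
  shows "(x + y)\<^sup>2 \<le> (d + e) * (g + h)"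
proof -
  have "(x * y)\<^sup>2 \<le> (d * g) * (e * h)"
    unfolding power_mult_distrib using assms by (intro mult_mono) auto
  also have "\<dots> = (d * h) * (e * g)" by simp
  also have "\<dots> \<le> ((d * h + e * g) / 2)\<^sup>2"
    by (rule mult_le_half_sum_square)
  finally have "x * y \<le> (d * h + e * g) / 2"
    by (rule power2_le_imp_le) (use assms(3-6) in auto)
  then have "2 * (x * y) \<le> d * h + e * g" by simp
  with assms(1,2) have "x\<^sup>2 + y\<^sup>2 + 2 * (x * y) \<le> d * g + e * h + (d * h + e * g)"
    by (intro add_mono)
  also have "\<dots> = (d + e) * (g + h)" by (simp add: algebra_simps)
  finally show ?thesis by (simp add: power2_sum)
qed

text \<open>Adding a ramp of slope \<open>k\<close> on \<open>[a, b]\<close> turns the integral of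
  \<open>v'\<^sup>2\<close> into that of \<open>(v' + k)\<^sup>2\<close> there; the new bound is
  this square expanded, with the integral of \<open>v'\<close> over \<open>[a, b]\<close> written as
  \<open>v b - v a\<close>. The bound is exact in \<open>k\<close>, so it can be differentiated
  later.\<close>

lemma energy_le_ramp:
  assumes "energy_le v A" "0 \<le> a" "a < b"
  shows "energy_le (\<lambda>r. v r + k * (max a (min r b) - a)) (A + 2 * k * (v b - v a) + k\<^sup>2 * (b - a))"
proof -
  obtain G where G: "\<And>s t. s < t \<Longrightarrow> G s + (v t - v s)\<^sup>2 / (t - s) \<le> G t"
      "\<And>t. 0 \<le> G t" "\<And>t. G t \<le> A"
    using assms(1) by (rule energy_leE) blast
  define c where "c r = max a (min r b)" for r
  define w where "w r = v r + k * (c r - a)" for r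
  \<comment> \<open>The energy function of the sum: the expanded square integrated up to
    \<open>r\<close>, where clamping by \<open>c\<close> confines the new terms to
    \<open>[a, b]\<close>.\<close>
  define H where "H r = G r + 2 * k * (v (c r) - v a) + k\<^sup>2 * (c r - a)" for r
  define good where "good s t \<longleftrightarrow> s \<le> t \<and> H s \<le> H t \<and> (w t - w s)\<^sup>2 \<le> (t - s) * (H t - H s)" for s t
  have G': "(v t - v s)\<^sup>2 \<le> (t - s) * (G t - G s) \<and> G s \<le> G t" if "s \<le> t" for s t
  proof (cases "s = t")
    case False
    then have "(v t - v s)\<^sup>2 / (t - s) \<le> G t - G s" using G(1)[of s t] that by auto
    moreover have "0 \<le> (v t - v s)\<^sup>2 / (t - s)" using that by auto
    ultimately have le: "G s \<le> G t" by linarith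
    have "(v t - v s)\<^sup>2 \<le> (G t - G s) * (t - s)"
      using that False \<open>(v t - v s)\<^sup>2 / (t - s) \<le> G t - G s\<close> by (subst (asm) pos_divide_le_eq) auto
    then show ?thesis using le by (simp add: mult.commute[of "t - s"])
  qed auto
  \<comment> \<open>\<open>good\<close> is transitive, so only intervals that do not cross
    \<open>a\<close> or \<open>b\<close> have to be examined.\<close>
  have glue: "good s t" if "good s m" "good m t" for s m t
  proof -
    have "((w m - w s) + (w t - w m))\<^sup>2 \<le> ((m - s) + (t - m)) * ((H m - H s) + (H t - H m))"
      using that by (intro square_le_mult_add) (auto simp: good_def)
    then show ?thesis using that by (simp add: good_def)
  qed
  have low: "good s t" if "s \<le> t" "t \<le> a" for s t
  proof -
    have "c s = a" "c t = a" using that assms(3) by (auto simp: c_def)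
    then show ?thesis using that G'[of s t] by (simp add: good_def H_def w_def)
  qed
  have high: "good s t" if "s \<le> t" "b \<le> s" for s t
  proof -
    have "c s = b" "c t = b" using that assms(3) by (auto simp: c_def)
    then show ?thesis using that G'[of s t] by (simp add: good_def H_def w_def)
  qed
  have mid: "good s t" if "s \<le> t" "a \<le> s" "t \<le> b" for s t
  proof -
    have c: "c s = s" "c t = t" using that by (auto simp: c_def)
    have e: "H t - H s = (G t - G s) + 2 * k * (v t - v s) + k\<^sup>2 * (t - s)"
      unfolding H_def c by (simp add: algebra_simps)
    have d: "(w t - w s)\<^sup>2 = (v t - v s)\<^sup>2 + 2 * k * (v t - v s) * (t - s) + k\<^sup>2 * (t - s)\<^sup>2"
      unfolding w_def c by (simp add: power2_eq_square algebra_simps)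
    \<comment> \<open>The terms in \<open>k\<close> cancel: the two sides differ by exactly
      \<open>(t - s) * (G t - G s) - (v t - v s)\<^sup>2\<close>.\<close>
    have sq: "(w t - w s)\<^sup>2 \<le> (t - s) * (H t - H s)"
      unfolding d e using G'[OF that(1)] by (simp add: algebra_simps power2_eq_square)
    have "H s \<le> H t"
    proof (cases "s = t")
      case False
      then have "0 \<le> (H t - H s)" using sq that zero_le_mult_iff[of "t - s" "H t - H s"]
        by (smt (verit) zero_le_power2)
      then show ?thesis by simp
    qed simp
    then show ?thesis using sq that by (simp add: good_def)
  qed
  have all: "good s t" if "s \<le> t" for s t
  proof -
    consider "t \<le> a" | "s \<le> a" "a \<le> t" "t \<le> b" | "s \<le> a" "b \<le> t" | "a \<le> s" "t \<le> b"
      | "a \<le> s" "s \<le> b" "b \<le> t" | "b \<le> s" using that assms(3) by linarith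
    then show ?thesis
    proof cases
      case 1 then show ?thesis using low that by auto
    next
      case 2 then show ?thesis using glue[OF low[of s a] mid[of a t]] assms(3) by auto
    next
      case 3 then show ?thesis using glue[OF glue[OF low[of s a] mid[of a b]] high[of b t]] assms(3) by auto
    next
      case 4 then show ?thesis using mid that by auto
    next
      case 5 then show ?thesis using glue[OF mid[of s b] high[of b t]] by auto
    next
      case 6 then show ?thesis using high that by auto
    qed
  qed
  have 1: "H s + (w t - w s)\<^sup>2 / (t - s) \<le> H t" if "s < t" for s t
    using all[of s t] that by (simp add: good_def field_simps)
  have 2: "0 \<le> H t" for t
  proof -
    have "H (min t a) \<le> H t" using all[of "min t a" t] by (simp add: good_def)
    moreover have "H (min t a) = G (min t a)" using assms(3) by (simp add: H_def c_def max_def min_def)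
    ultimately show ?thesis using G(2)[of "min t a"] by simp
  qed
  have 3: "H t \<le> A + 2 * k * (v b - v a) + k\<^sup>2 * (b - a)" for t
  proof -
    have "H t \<le> H (max t b)" using all[of t "max t b"] by (simp add: good_def)
    moreover have "c (max t b) = b" using assms(3) by (simp add: c_def max_def min_def)
    ultimately show ?thesis using G(3)[of "max t b"] by (simp add: H_def)
  qed
  have 4: "w r = 0" if "r \<le> 0" for r
    using that assms energy_le_zero[OF assms(1) that] by (simp add: w_def c_def max_def min_def)
  show ?thesis
    unfolding energy_le_def using 1 2 3 4 unfolding w_def c_def by (intro conjI exI[of _ H]) auto
qed

lemma energy_le_tendsto:
  assumes "\<And>n. energy_le (v n) (A n)" "\<And>r. (\<lambda>n. v n r) \<longlonglongrightarrow> w r" "A \<longlonglongrightarrow> a"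
  shows "energy_le w a"
proof -
  have "\<exists>G. (\<forall>s t. s < t \<longrightarrow> G s + (v n t - v n s)\<^sup>2 / (t - s) \<le> G t) \<and> (\<forall>t. 0 \<le> G t \<and> G t \<le> A n)" for n
    using assms(1)[of n] unfolding energy_le_def by blast
  then obtain G where G: "\<And>n s t. s < t \<Longrightarrow> G n s + (v n t - v n s)\<^sup>2 / (t - s) \<le> G n t"
      "\<And>n t. 0 \<le> G n t" "\<And>n t. G n t \<le> A n" by metis
  obtain K where K: "\<And>n. A n \<le> K"
    using convergent_imp_Bseq[of A] assms(3) unfolding convergent_def Bseq_def by (metis abs_le_D1 real_norm_def)
  define L where "L t = liminf (\<lambda>n. ereal (G n t))" for t
  have L0: "0 \<le> L t" for t unfolding L_def by (rule Liminf_bounded) (simp add: G)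
  have La: "L t \<le> ereal a" for t
  proof -
    have "L t \<le> liminf (\<lambda>n. ereal (A n))" unfolding L_def by (rule Liminf_mono) (simp add: G)
    also have "\<dots> = ereal a" using assms(3) by (intro lim_imp_Liminf) auto
    finally show ?thesis .
  qed
  have fin: "ereal (real_of_ereal (L t)) = L t" for t
    using L0[of t] La[of t] by (cases "L t") auto
  have step: "L s + ereal ((w t - w s)\<^sup>2 / (t - s)) \<le> L t" if "s < t" for s t
  proof -
    have "(\<lambda>n. ereal ((v n t - v n s)\<^sup>2 / (t - s))) \<longlonglongrightarrow> ereal ((w t - w s)\<^sup>2 / (t - s))"
      using that by (intro tendsto_intros assms(2)) auto
    then have "L s + ereal ((w t - w s)\<^sup>2 / (t - s))
        = liminf (\<lambda>n. ereal ((v n t - v n s)\<^sup>2 / (t - s)) + ereal (G n s))"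
      unfolding L_def by (subst ereal_liminf_lim_add) (auto simp: add.commute)
    also have "\<dots> \<le> L t" unfolding L_def
      using G(1)[OF that] by (intro Liminf_mono) (auto simp: add.commute)
    finally show ?thesis .
  qed
  have 1: "real_of_ereal (L s) + (w t - w s)\<^sup>2 / (t - s) \<le> real_of_ereal (L t)" if "s < t" for s t
    using step[OF that] fin[of s] fin[of t] by (metis ereal_less_eq(3) plus_ereal.simps(1))
  have 2: "0 \<le> real_of_ereal (L t) \<and> real_of_ereal (L t) \<le> a" for t
    using L0[of t] La[of t] fin[of t] by (metis ereal_less_eq(3) zero_ereal_def)
  have 3: "w r = 0" if "r \<le> 0" for r
    using assms(2)[of r] energy_le_zero[OF assms(1) that] by (simp add: LIMSEQ_const_iff)
  show ?thesis unfolding energy_le_def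
    using 1 2 3 by (intro conjI exI[of _ "\<lambda>t. real_of_ereal (L t)"]) auto
qed

text \<open>By the Hoelder bound \<open>v\<close> cannot fall below half of its value at
  \<open>r\<close> within a distance \<open>d\<close> proportional to
  \<open>(v r)\<^sup>2 / A\<close>, so a large value costs mass.\<close>

lemma energy_le_sup:
  assumes "energy_le v A" "integrable lborel (\<lambda>r. (v r)\<^sup>2)"
  shows "(v r) ^ 4 \<le> 16 * A * (\<integral>r. (v r)\<^sup>2 \<partial>lborel)"
proof (cases "v r = 0")
  case True
  have "0 \<le> (\<integral>r. (v r)\<^sup>2 \<partial>lborel)" by simp
  then show ?thesis using True energy_le_nonneg[OF assms(1)] by simp
next
  case False
  then have "0 < r" using energy_le_zero[OF assms(1), of r] by linarith
  have "0 < (v r)\<^sup>2" using False by simp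
  then have A: "0 < A" using energy_le_point[OF assms(1), of r] \<open>0 < r\<close>
    by (metis less_le_trans less_eq_real_def zero_less_mult_pos2)
  \<comment> \<open>Chosen so that the Hoelder modulus \<open>A * d\<close> equals
    \<open>(\<bar>v r\<bar> / 2)\<^sup>2\<close>.\<close>
  define d where "d = (v r)\<^sup>2 / (4 * A)"
  have d: "0 < d" using A False by (simp add: d_def)
  have ge: "(v r)\<^sup>2 / 4 \<le> (v s)\<^sup>2" if "s \<in> {r..r+d}" for s
  proof -
    have "(v s - v r)\<^sup>2 \<le> A * \<bar>s - r\<bar>" by (rule energy_le_holder[OF assms(1)])
    also have "\<dots> \<le> A * d" using that A by simp
    also have "\<dots> = (\<bar>v r\<bar> / 2)\<^sup>2" using A by (simp add: d_def power_divide)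
    finally have "\<bar>v s - v r\<bar> \<le> \<bar>v r\<bar> / 2" by (metis abs_ge_zero abs_le_square_iff abs_of_nonneg half_gt_zero_iff less_eq_real_def power2_abs divide_nonneg_nonneg zero_le_numeral)
    then have "\<bar>v r\<bar> / 2 \<le> \<bar>v s\<bar>" by linarith
    then have "(\<bar>v r\<bar> / 2)\<^sup>2 \<le> \<bar>v s\<bar>\<^sup>2" by (intro power_mono) auto
    then show ?thesis by (simp add: power_divide)
  qed
  have "(v r)\<^sup>2 / 4 * d = (\<integral>s. (v r)\<^sup>2 / 4 * indicator {r..r+d} s \<partial>lborel)" using d by simp
  also have "\<dots> \<le> (\<integral>s. (v s)\<^sup>2 \<partial>lborel)"
  proof (rule integral_mono)
    show "integrable lborel (\<lambda>s. (v r)\<^sup>2 / 4 * indicator {r..r+d} s)"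
      by (intro integrable_mult_right) (auto simp: integrable_indicator_iff emeasure_lborel_Icc_eq)
  qed (use assms(2) ge in \<open>auto simp: indicator_def\<close>)
  finally show ?thesis using A by (simp add: d_def field_simps power2_eq_square power4_eq_xxxx)
qed

section \<open>Mass and power terms\<close>

lemma has_bochner_integral_powr_from_0:
  fixes a R :: real
  assumes "-1 < a" "0 \<le> R"
  shows "has_bochner_integral lborel (\<lambda>r. indicator {0..R} r * r powr a) (R powr (a + 1) / (a + 1))"
proof (rule has_bochner_integral_nn_integral)
  have "((\<lambda>r. indicator {0..R} r * r powr a) has_integral R powr (a + 1) / (a + 1)) UNIV"
    using has_integral_powr_from_0[OF assms]
    by (subst (asm) has_integral_restrict_UNIV[symmetric])
      (erule back_subst[of "\<lambda>f. (f has_integral _) _"], auto)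
  then show "(\<integral>\<^sup>+r. ennreal (indicator {0..R} r * r powr a) \<partial>lborel) = ennreal (R powr (a + 1) / (a + 1))"
    by (intro nn_integral_has_integral_lborel) auto
qed (use assms in auto)

lemma integrable_powr_to_inf:
  fixes a R :: real
  assumes "a < -1" "0 < R"
  shows "integrable lborel (\<lambda>r. indicator {R..} r * r powr a)"
proof (rule integrableI_nn_integral_finite)
  have "((\<lambda>r. indicator {R..} r * r powr a) has_integral -(R powr (a + 1)) / (a + 1)) UNIV"
    using has_integral_powr_to_inf[OF assms]
    by (subst (asm) has_integral_restrict_UNIV[symmetric])
      (erule back_subst[of "\<lambda>f. (f has_integral _) _"], auto)
  then show "(\<integral>\<^sup>+r. ennreal (indicator {R..} r * r powr a) \<partial>lborel) = ennreal (-(R powr (a + 1)) / (a + 1))"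
    by (intro nn_integral_has_integral_lborel) auto
qed (use assms in auto)

lemma integral_Fatou:
  fixes f :: "nat \<Rightarrow> 'a \<Rightarrow> real"
  assumes "\<And>n. integrable M (f n)" "\<And>n x. 0 \<le> f n x" "\<And>x. (\<lambda>n. f n x) \<longlonglongrightarrow> g x"
    and "(\<lambda>n. \<integral>x. f n x \<partial>M) \<longlonglongrightarrow> L"
  shows "integrable M g" "(\<integral>x. g x \<partial>M) \<le> L"
proof -
  have [measurable]: "f n \<in> borel_measurable M" for n using assms(1) by auto
  have [measurable]: "g \<in> borel_measurable M"
    by (rule borel_measurable_LIMSEQ_real[of _ f]) (auto simp: assms)
  have g0: "0 \<le> g x" for x using assms(2,3) by (meson LIMSEQ_le_const)
  have L0: "0 \<le> L" using assms(2,4) by (intro LIMSEQ_le_const[OF assms(4)]) (auto intro!: integral_nonneg_AE)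
  have "(\<integral>\<^sup>+x. ennreal (g x) \<partial>M) = (\<integral>\<^sup>+x. liminf (\<lambda>n. ennreal (f n x)) \<partial>M)"
    using assms(3) by (intro nn_integral_cong) (auto intro!: lim_imp_Liminf[symmetric] tendsto_ennrealI)
  also have "\<dots> \<le> liminf (\<lambda>n. \<integral>\<^sup>+x. ennreal (f n x) \<partial>M)"
    by (rule nn_integral_liminf) auto
  also have "\<dots> = liminf (\<lambda>n. ennreal (\<integral>x. f n x \<partial>M))"
    using assms(1,2) by (simp add: nn_integral_eq_integral)
  also have "\<dots> = ennreal L"
    using assms(4) by (intro lim_imp_Liminf) (auto intro!: tendsto_ennrealI)
  finally have le: "(\<integral>\<^sup>+x. ennreal (g x) \<partial>M) \<le> ennreal L" .
  show "integrable M g" 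
    by (rule integrableI_nonneg) (auto simp: g0 intro: le_less_trans[OF le])
  then have "ennreal (\<integral>x. g x \<partial>M) \<le> ennreal L" using le g0 by (simp add: nn_integral_eq_integral)
  then show "(\<integral>x. g x \<partial>M) \<le> L" using L0 by simp
qed

definition mass :: "(real \<Rightarrow> real) \<Rightarrow> real" where
  "mass v = (\<integral>r. (v r)\<^sup>2 \<partial>lborel)"

text \<open>For \<open>u(x) = v(|x|) / |x|\<close> this is the integral of \<open>|u| powr e\<close>
  over three-space divided by \<open>4 * pi\<close>: the weight combines the surface factor
  \<open>r\<^sup>2\<close> with \<open>r powr (- e)\<close>. The factor \<open>1 / (4 * pi)\<close>
  is common to all radial functionals here.\<close>

definition power_term :: "real \<Rightarrow> (real \<Rightarrow> real) \<Rightarrow> real" where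
  "power_term e v = (\<integral>r. \<bar>v r\<bar> powr e * r powr (2 - e) \<partial>lborel)"

text \<open>The kernel is the integral of \<open>1 / |x - y|\<close> over the directions of
  \<open>y\<close>, with \<open>|x| = r\<close> and \<open>|y| = s\<close>; the surface factor
  \<open>s\<^sup>2\<close> is absorbed in \<open>f = v\<^sup>2\<close>.\<close>

definition pot :: "(real \<Rightarrow> real) \<Rightarrow> real \<Rightarrow> real" where
  "pot f r = (\<integral>s. 4 * pi / max r s * f s \<partial>lborel)"

definition coul :: "(real \<Rightarrow> real) \<Rightarrow> (real \<Rightarrow> real) \<Rightarrow> real" where
  "coul f g = (\<integral>r. f r * pot g r \<partial>lborel)"

lemma mass_nonneg: "0 \<le> mass v" by (simp add: mass_def)

lemma power_term_nonneg: "0 \<le> power_term e v" by (simp add: power_term_def)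

lemma abs_power_powr: "x \<noteq> 0 \<Longrightarrow> (\<bar>x\<bar> ^ n) powr y = \<bar>x\<bar> powr (real n * y)" for x y :: real
  by (simp add: powr_realpow[symmetric] powr_powr)

lemma energy_le_sup_powr:
  assumes "energy_le v A" "integrable lborel (\<lambda>r. (v r)\<^sup>2)" "0 < k"
  shows "\<bar>v r\<bar> powr k \<le> (16 * A * mass v) powr (k / 4)"
proof -
  have "\<bar>v r\<bar> ^ 4 \<le> 16 * A * mass v" using energy_le_sup[OF assms(1,2)] by (simp add: mass_def)
  then have "(\<bar>v r\<bar> ^ 4) powr (k / 4) \<le> (16 * A * mass v) powr (k / 4)"
    using assms(3) by (intro powr_mono2) auto
  moreover have "(\<bar>v r\<bar> ^ 4) powr (k / 4) = \<bar>v r\<bar> powr k"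
    by (cases "v r = 0") (use assms(3) in \<open>auto simp: abs_power_powr simp del: power_even_abs_numeral\<close>)
  ultimately show ?thesis by simp
qed

lemma energy_le_point_powr:
  assumes "energy_le v A" "0 \<le> r" "0 < e"
  shows "\<bar>v r\<bar> powr e \<le> A powr (e / 2) * r powr (e / 2)"
proof -
  have "(\<bar>v r\<bar> ^ 2) powr (e / 2) \<le> (A * r) powr (e / 2)"
    using energy_le_point[OF assms(1,2)] assms(3) by (intro powr_mono2) auto
  moreover have "(\<bar>v r\<bar> ^ 2) powr (e / 2) = \<bar>v r\<bar> powr e"
    by (cases "v r = 0") (use assms(3) in \<open>auto simp: abs_power_powr simp del: power2_abs power_even_abs_numeral\<close>)
  ultimately show ?thesis using assms(2) energy_le_nonneg[OF assms(1)] by (simp add: powr_mult)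
qed

text \<open>Two regimes split at \<open>R\<close>: near the origin
  \<open>v\<^sup>2 \<le> A * r\<close>, which leaves a power of \<open>r\<close> integrable because
  \<open>e < 6\<close>; beyond \<open>R\<close> all but two powers of \<open>v\<close> are estimated
  by the supremum and the remaining square is paid by the mass.\<close>

lemma power_integrand_le:
  assumes "energy_le v A" "integrable lborel (\<lambda>r. (v r)\<^sup>2)" "2 < e" "e < 6" "0 < R"
  shows "\<bar>v r\<bar> powr e * r powr (2 - e) \<le>
    A powr (e / 2) * (indicator {0..R} r * r powr (2 - e / 2))
      + (16 * A * mass v) powr ((e - 2) / 4) * R powr (2 - e) * (v r)\<^sup>2"
proof -
  consider "r \<le> 0" | "0 < r" "r \<le> R" | "R < r" by linarith
  then show ?thesis
  proof cases
    case 1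
    then have "v r = 0" using energy_le_zero[OF assms(1)] by blast
    then show ?thesis by simp
  next
    case 2
    have "\<bar>v r\<bar> powr e * r powr (2 - e) \<le> A powr (e / 2) * r powr (e / 2) * r powr (2 - e)"
      using 2 assms by (intro mult_right_mono energy_le_point_powr) auto
    also have "\<dots> = A powr (e / 2) * r powr (2 - e / 2)"
      by (simp add: mult.assoc powr_add[symmetric])
    also have "\<dots> \<le> A powr (e / 2) * (indicator {0..R} r * r powr (2 - e / 2))
      + (16 * A * mass v) powr ((e - 2) / 4) * R powr (2 - e) * (v r)\<^sup>2" using 2 by simp
    finally show ?thesis .
  next
    case 3
    have "\<bar>v r\<bar> powr e = \<bar>v r\<bar> powr (e - 2) * (v r)\<^sup>2"
      using powr_add[of "\<bar>v r\<bar>" "e - 2" 2] by (cases "v r = 0") auto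
    then have "\<bar>v r\<bar> powr e * r powr (2 - e) = \<bar>v r\<bar> powr (e - 2) * (v r)\<^sup>2 * r powr (2 - e)" by simp
    also have "\<dots> \<le> (16 * A * mass v) powr ((e - 2) / 4) * (v r)\<^sup>2 * R powr (2 - e)"
      using energy_le_sup_powr[OF assms(1,2), of "e - 2" r] assms 3
      by (intro mult_mono mult_right_mono powr_mono2') auto
    finally show ?thesis using 3 by (simp add: mult_ac)
  qed
qed


lemma power_term_integrable_le:
  assumes "energy_le v A" "integrable lborel (\<lambda>r. (v r)\<^sup>2)" "2 < e" "e < 6" "0 < R"
  shows "integrable lborel (\<lambda>r. \<bar>v r\<bar> powr e * r powr (2 - e))"
    and "power_term e v \<le> A powr (e / 2) * (R powr (3 - e / 2) / (3 - e / 2))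
      + (16 * A * mass v) powr ((e - 2) / 4) * R powr (2 - e) * mass v"
proof -
  note [measurable] = energy_le_measurable[OF assms(1)]
  let ?h = "\<lambda>r. A powr (e / 2) * (indicator {0..R} r * r powr (2 - e / 2))
      + (16 * A * mass v) powr ((e - 2) / 4) * R powr (2 - e) * (v r)\<^sup>2"
  have p: "has_bochner_integral lborel (\<lambda>r. indicator {0..R} r * r powr (2 - e / 2)) (R powr (3 - e / 2) / (3 - e / 2))"
    using has_bochner_integral_powr_from_0[of "2 - e / 2" R] assms by simp
  have h: "has_bochner_integral lborel ?h (A powr (e / 2) * (R powr (3 - e / 2) / (3 - e / 2))
      + (16 * A * mass v) powr ((e - 2) / 4) * R powr (2 - e) * mass v)"
    unfolding mass_def
    by (intro has_bochner_integral_add has_bochner_integral_mult_right p has_bochner_integral_integrable assms)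
  show int: "integrable lborel (\<lambda>r. \<bar>v r\<bar> powr e * r powr (2 - e))"
    by (rule Bochner_Integration.integrable_bound[OF integrable.intros[OF h]])
      (use power_integrand_le[OF assms] in \<open>auto simp: abs_mult intro!: AE_I2 order_trans[OF _ abs_ge_self]\<close>)
  show "power_term e v \<le> A powr (e / 2) * (R powr (3 - e / 2) / (3 - e / 2))
      + (16 * A * mass v) powr ((e - 2) / 4) * R powr (2 - e) * mass v"
    unfolding power_term_def has_bochner_integral_integral_eq[OF h, symmetric]
    by (intro integral_mono int integrable.intros[OF h] power_integrand_le assms)
qed

lemma energy_mass_zero:
  assumes "energy_le v A" "integrable lborel (\<lambda>r. (v r)\<^sup>2)" "A = 0 \<or> mass v = 0"
  shows "v = (\<lambda>_. 0)"
proof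
  fix r
  have "(v r) ^ 4 \<le> 16 * A * mass v" using energy_le_sup[OF assms(1,2)] by (simp add: mass_def)
  then show "v r = 0" using assms(3) by auto
qed

text \<open>The exponent of \<open>A\<close> equals 1 exactly at the mass-critical power
  \<open>e = 10 / 3\<close>; above it the \<open>p\<close>-term is superlinear in \<open>A\<close>,
  which is what yields a lower bound for \<open>A\<close> on the Pohozaev set.\<close>

lemma gagliardo_nirenberg:
  assumes "energy_le v A" "integrable lborel (\<lambda>r. (v r)\<^sup>2)" "2 < e" "e < 6"
  shows "power_term e v \<le> (1 / (3 - e / 2) + 16 powr ((e - 2) / 4))
    * mass v powr ((6 - e) / 4) * A powr (3 * (e - 2) / 4)"
proof (cases "A = 0 \<or> mass v = 0")
  case True
  then have "v = (\<lambda>_. 0)" using energy_mass_zero[OF assms(1,2)] by simp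
  then show ?thesis using assms by (simp add: power_term_def)
next
  case False
  then have pos: "0 < A" "0 < mass v"
    using energy_le_nonneg[OF assms(1)] mass_nonneg[of v] by auto
  \<comment> \<open>The intrinsic length scale of \<open>v\<close>. At this splitting radius the
    inner and outer contributions carry the same powers of mass and \<open>A\<close>.\<close>
  define R where "R = sqrt (mass v / A)"
  define M where "M = mass v"
  have R: "0 < R" using pos by (simp add: R_def)
  have Rp: "R powr x = M powr (x / 2) * A powr (- x / 2)" for x
  proof -
    have "R = (M / A) powr (1 / 2)" using pos by (simp add: R_def M_def powr_half_sqrt)
    then have "R powr x = (M / A) powr (x / 2)" by (simp only: powr_powr) simp
    also have "\<dots> = M powr (x / 2) / A powr (x / 2)" using pos by (simp add: M_def powr_divide)
    also have "\<dots> = M powr (x / 2) * A powr (- x / 2)" by (simp add: powr_minus_divide)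
    finally show ?thesis .
  qed
  have M: "0 < M" using pos by (simp add: M_def)
  have "power_term e v \<le> A powr (e / 2) * (R powr (3 - e / 2) / (3 - e / 2))
      + (16 * A * M) powr ((e - 2) / 4) * R powr (2 - e) * M"
    unfolding M_def using assms R by (intro power_term_integrable_le)
  also have "A powr (e / 2) * (R powr (3 - e / 2) / (3 - e / 2))
      = (1 / (3 - e / 2)) * (M powr ((6 - e) / 4) * A powr (3 * (e - 2) / 4))"
  proof -
    have "A powr (e / 2) * R powr (3 - e / 2) = M powr ((3 - e / 2) / 2) * A powr (e / 2 + - (3 - e / 2) / 2)"
      unfolding Rp powr_add by simp
    also have "\<dots> = M powr ((6 - e) / 4) * A powr (3 * (e - 2) / 4)"
      by (intro arg_cong2[where f="\<lambda>x y. M powr x * A powr y"]) (simp_all add: field_simps)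
    finally show ?thesis by simp
  qed
  also have "(16 * A * M) powr ((e - 2) / 4) * R powr (2 - e) * M
      = 16 powr ((e - 2) / 4) * (M powr ((6 - e) / 4) * A powr (3 * (e - 2) / 4))"
  proof -
    have "(16 * A * M) powr ((e - 2) / 4) * R powr (2 - e) * M
      = 16 powr ((e - 2) / 4) * (M powr ((e - 2) / 4 + (2 - e) / 2 + 1) * A powr ((e - 2) / 4 + - (2 - e) / 2))"
      unfolding Rp powr_add using pos M by (simp add: powr_mult)
    also have "\<dots> = 16 powr ((e - 2) / 4) * (M powr ((6 - e) / 4) * A powr (3 * (e - 2) / 4))"
      by (intro arg_cong2[where f="\<lambda>x y. 16 powr ((e - 2) / 4) * (M powr x * A powr y)"]) (simp_all add: field_simps)
    finally show ?thesis .
  qed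
  finally show ?thesis unfolding M_def by (simp add: algebra_simps)
qed

text \<open>
  For \<open>e > 3\<close> the weight \<open>r\<^sup>2\<^sup>-\<^sup>e\<close> is integrable at infinity, so dominated convergence needs no decay of \<open>v\<close>.
\<close>

lemma power_term_tendsto:
  assumes "\<And>n. energy_le (v n) (A n)" "\<And>n. integrable lborel (\<lambda>r. (v n r)\<^sup>2)"
    and "\<And>n. A n \<le> K" "\<And>n. mass (v n) \<le> m" "\<And>r. (\<lambda>n. v n r) \<longlonglongrightarrow> w r" "3 < e" "e < 6"
  shows "(\<lambda>n. power_term e (v n)) \<longlonglongrightarrow> power_term e w"
proof -
  have [measurable]: "v n \<in> borel_measurable borel" for n using energy_le_measurable assms(1) by blast
  have [measurable]: "w \<in> borel_measurable borel" by (rule borel_measurable_LIMSEQ_real[of _ v]) (auto simp: assms)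
  \<comment> \<open>A majorant independent of \<open>n\<close>: the point bound inside the unit
    interval, the supremum bound outside.\<close>
  let ?h = "\<lambda>r::real. K powr (e / 2) * (indicator {0..1} r * r powr (2 - e / 2))
     + (16 * K * m) powr (e / 4) * (indicator {1..} r * r powr (2 - e))"
  have h: "integrable lborel ?h"
    using assms(6,7) integrable.intros[OF has_bochner_integral_powr_from_0[of "2 - e / 2" 1]]
      integrable_powr_to_inf[of "2 - e" 1]
    by (intro Bochner_Integration.integrable_add integrable_mult_right) auto
  have le: "norm (\<bar>v n r\<bar> powr e * r powr (2 - e)) \<le> ?h r" for n r
  proof -
    have A0: "0 \<le> A n" using energy_le_nonneg assms(1) by blast
    consider "r \<le> 0" | "0 < r" "r < 1" | "1 \<le> r" by linarith
    then show ?thesis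
    proof cases
      case 1
      then have "v n r = 0" using energy_le_zero[OF assms(1)] by blast
      then show ?thesis by simp
    next
      case 2
      have "\<bar>v n r\<bar> powr e * r powr (2 - e) \<le> A n powr (e / 2) * r powr (e / 2) * r powr (2 - e)"
        using 2 assms by (intro mult_right_mono energy_le_point_powr) auto
      also have "\<dots> = A n powr (e / 2) * r powr (2 - e / 2)"
        by (simp add: mult.assoc powr_add[symmetric])
      also have "\<dots> \<le> K powr (e / 2) * r powr (2 - e / 2)"
        using A0 assms(3,6) by (intro mult_right_mono powr_mono2) auto
      finally show ?thesis using 2 by simp
    next
      case 3
      have "\<bar>v n r\<bar> powr e \<le> (16 * A n * mass (v n)) powr (e / 4)"
        using energy_le_sup_powr[OF assms(1,2)] assms(6) by simp
      also have "\<dots> \<le> (16 * K * m) powr (e / 4)"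
        using A0 assms(3,4)[of n] assms(6) mass_nonneg[of "v n"]
        by (intro powr_mono2 mult_mono) auto
      finally have "\<bar>v n r\<bar> powr e * r powr (2 - e) \<le> (16 * K * m) powr (e / 4) * r powr (2 - e)"
        by (intro mult_right_mono) auto
      moreover have "0 \<le> K powr (e / 2) * (indicator {0..1} r * r powr (2 - e / 2))" by simp
      ultimately have "\<bar>v n r\<bar> powr e * r powr (2 - e)
        \<le> K powr (e / 2) * (indicator {0..1} r * r powr (2 - e / 2)) + (16 * K * m) powr (e / 4) * r powr (2 - e)"
        by linarith
      moreover have "norm (\<bar>v n r\<bar> powr e * r powr (2 - e)) = \<bar>v n r\<bar> powr e * r powr (2 - e)"
        by (simp add: abs_mult)
      moreover have "indicator {1..} r = (1::real)" using 3 by simp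
      ultimately show ?thesis by (simp only: mult_1)
    qed
  qed
  show ?thesis unfolding power_term_def
  proof (rule integral_dominated_convergence[OF _ _ h])
    show "AE r in lborel. (\<lambda>n. \<bar>v n r\<bar> powr e * r powr (2 - e)) \<longlonglongrightarrow> \<bar>w r\<bar> powr e * r powr (2 - e)"
      using assms(6) by (intro AE_I2 tendsto_mult_right tendsto_powr2 tendsto_rabs assms) auto
  qed (use le in auto)
qed

lemma mass_scale: "0 < t \<Longrightarrow> mass (\<lambda>r. c * v (t * r)) = c\<^sup>2 / t * mass v"
  unfolding mass_def using lborel_integral_real_affine[of t "\<lambda>r. (v r)\<^sup>2" 0]
  by (simp add: power_mult_distrib)

lemma square_integrable_scale:
  fixes v :: "real \<Rightarrow> real"
  shows "0 < t \<Longrightarrow> integrable lborel (\<lambda>r. (v r)\<^sup>2) \<Longrightarrow> integrable lborel (\<lambda>r. (c * v (t * r))\<^sup>2)"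
  using lborel_integrable_real_affine[of "\<lambda>r. (v r)\<^sup>2" t 0] by (simp add: power_mult_distrib)

lemma power_term_scale:
  assumes "0 < t" "\<And>r. r \<le> 0 \<Longrightarrow> v r = 0"
  shows "power_term e (\<lambda>r. c * v (t * r)) = \<bar>c\<bar> powr e * t powr (e - 3) * power_term e v"
proof -
  have eq: "\<bar>c * v (t * r)\<bar> powr e * r powr (2 - e)
      = \<bar>c\<bar> powr e * t powr (e - 2) * (\<bar>v (t * r)\<bar> powr e * (t * r) powr (2 - e))" for r
  proof (cases "r \<le> 0")
    case True
    then have "v (t * r) = 0" using assms by (simp add: mult_le_0_iff)
    then show ?thesis by simp
  next
    case False
    then have "(t * r) powr (2 - e) = t powr (2 - e) * r powr (2 - e)" using assms by (simp add: powr_mult)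
    moreover have "t powr (e - 2) * t powr (2 - e) = 1" using assms by (simp add: powr_add[symmetric])
    ultimately show ?thesis by (simp add: abs_mult powr_mult)
  qed
  have t: "t powr (e - 2) = t powr (e - 3) * t" using assms powr_add[of t "e - 3" 1] by simp
  have "power_term e v = t * (\<integral>r. \<bar>v (t * r)\<bar> powr e * (t * r) powr (2 - e) \<partial>lborel)"
    unfolding power_term_def using assms lborel_integral_real_affine[of t "\<lambda>r. \<bar>v r\<bar> powr e * r powr (2 - e)" 0]
    by simp
  then show ?thesis unfolding power_term_def[of e "\<lambda>r. c * v (t * r)"] eq using t by simp
qed

section \<open>The radial Coulomb energy\<close>

text \<open>Since \<open>1 / max r s \<le> 1 / s\<close> for \<open>s > 0\<close>, integrability of
  \<open>f r / r\<close> bounds the potential uniformly in \<open>r\<close>. Vanishing on the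
  nonpositive axis removes the region where the kernel may be negative or divide by zero.\<close>

definition pot_class :: "(real \<Rightarrow> real) \<Rightarrow> bool" where
  "pot_class f \<longleftrightarrow> (\<forall>r\<le>0. f r = 0) \<and> integrable lborel f \<and> integrable lborel (\<lambda>r. f r / r)"

lemma pot_classD:
  assumes "pot_class f"
  shows "integrable lborel f" "integrable lborel (\<lambda>r. f r / r)" "\<And>r. r \<le> 0 \<Longrightarrow> f r = 0"
    and "f \<in> borel_measurable borel"
  using assms by (auto simp: pot_class_def dest: borel_measurable_integrable)

lemma pot_class_add: "pot_class f \<Longrightarrow> pot_class g \<Longrightarrow> pot_class (\<lambda>r. f r + g r)"
  by (auto simp: pot_class_def add_divide_distrib)

lemma pot_class_mult: "pot_class f \<Longrightarrow> pot_class (\<lambda>r. c * f r)"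
  by (auto simp: pot_class_def simp flip: times_divide_eq_right)

lemma pot_class_abs:
  assumes "pot_class f"
  shows "pot_class (\<lambda>r. \<bar>f r\<bar>)"
proof -
  have "(\<lambda>r. \<bar>f r\<bar> / r) = (\<lambda>r. \<bar>f r / r\<bar>)"
  proof
    fix r show "\<bar>f r\<bar> / r = \<bar>f r / r\<bar>"
      using pot_classD(3)[OF assms, of r] by (cases "r \<le> 0") auto
  qed
  then show ?thesis using pot_classD(1-3)[OF assms] by (simp add: pot_class_def del: abs_divide)
qed

lemma pot_class_square:
  assumes "energy_le v A" "integrable lborel (\<lambda>r. (v r)\<^sup>2)"
  shows "pot_class (\<lambda>r. (v r)\<^sup>2)"
    and "0 < R \<Longrightarrow> (\<integral>r. (v r)\<^sup>2 / r \<partial>lborel) \<le> A * R + mass v / R"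
proof -
  note [measurable] = energy_le_measurable[OF assms(1)]
  have ind: "has_bochner_integral lborel (indicator {0..R}) R" if "0 < R" for R :: real
    using has_bochner_integral_real_indicator[of "{0..R}" lborel] that by simp
  have h: "has_bochner_integral lborel (\<lambda>r. A * indicator {0..R} r + 1 / R * (v r)\<^sup>2) (A * R + 1 / R * mass v)"
    if "0 < R" for R
    unfolding mass_def
    by (intro has_bochner_integral_add has_bochner_integral_mult_right ind that
        has_bochner_integral_integrable assms)
  have le: "(v r)\<^sup>2 / r \<le> A * indicator {0..R} r + 1 / R * (v r)\<^sup>2" if "0 < R" for r R
  proof -
    have A: "0 \<le> A" using energy_le_nonneg[OF assms(1)] .
    consider "r \<le> 0" | "0 < r" "r \<le> R" | "R < r" by linarith
    then show ?thesis
    proof cases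
      case 1 then show ?thesis using A energy_le_zero[OF assms(1)] by auto
    next
      case 2
      then have "(v r)\<^sup>2 / r \<le> A" using energy_le_point[OF assms(1), of r] by (simp add: divide_le_eq)
      also have "\<dots> \<le> A + 1 / R * (v r)\<^sup>2" using that by simp
      finally show ?thesis using 2 by simp
    next
      case 3
      then have "(v r)\<^sup>2 / r \<le> (v r)\<^sup>2 / R" using that by (intro divide_left_mono) auto
      then show ?thesis using 3 by simp
    qed
  qed
  have ge: "0 \<le> (v r)\<^sup>2 / r" for r
    using energy_le_zero[OF assms(1), of r] by (cases "r \<le> 0") auto
  have int: "integrable lborel (\<lambda>r. (v r)\<^sup>2 / r)"
  proof (rule Bochner_Integration.integrable_bound[OF integrable.intros[OF h[of 1]]])
    show "AE r in lborel. norm ((v r)\<^sup>2 / r) \<le> norm (A * indicator {0..1} r + 1 / 1 * (v r)\<^sup>2)"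
      using le[of 1] ge by (intro AE_I2) (auto simp: abs_of_nonneg[OF ge] simp del: abs_divide intro: order_trans[OF _ abs_ge_self])
  qed auto
  show "pot_class (\<lambda>r. (v r)\<^sup>2)"
    unfolding pot_class_def using int assms(2) energy_le_zero[OF assms(1)] by auto
  show "(\<integral>r. (v r)\<^sup>2 / r \<partial>lborel) \<le> A * R + mass v / R" if "0 < R"
    using integral_mono[OF int integrable.intros[OF h[OF that]] le[OF that]]
    unfolding has_bochner_integral_integral_eq[OF h[OF that]] by simp
qed

lemma kernel_le:
  fixes r s g :: real
  assumes "s \<le> 0 \<Longrightarrow> g = 0"
  shows "\<bar>4 * pi / max r s * g\<bar> \<le> 4 * pi * \<bar>g / s\<bar>"
proof (cases "s \<le> 0")
  case False
  have "4 * pi * \<bar>g\<bar> / max r s \<le> 4 * pi * \<bar>g\<bar> / s"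
    using False by (intro divide_left_mono) auto
  then show ?thesis using False by (simp add: abs_mult)
qed (use assms in auto)

lemma pot_integrand_integrable:
  assumes "pot_class g"
  shows "integrable lborel (\<lambda>s. 4 * pi / max r s * g s)"
proof -
  note [measurable] = pot_classD(4)[OF assms]
  show ?thesis
  proof (rule Bochner_Integration.integrable_bound)
    show "integrable lborel (\<lambda>s. 4 * pi * \<bar>g s / s\<bar>)"
      by (intro integrable_mult_right integrable_abs pot_classD(2)[OF assms])
    show "AE s in lborel. norm (4 * pi / max r s * g s) \<le> norm (4 * pi * \<bar>g s / s\<bar>)"
      using kernel_le[OF pot_classD(3)[OF assms]] by (intro AE_I2) (simp del: abs_divide)
  qed measurable
qed

lemma pot_le:
  assumes "pot_class g"
  shows "\<bar>pot g r\<bar> \<le> 4 * pi * (\<integral>s. \<bar>g s / s\<bar> \<partial>lborel)"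
proof -
  have "\<bar>pot g r\<bar> \<le> (\<integral>s. \<bar>4 * pi / max r s * g s\<bar> \<partial>lborel)"
    unfolding pot_def by (rule integral_abs_bound)
  also have "\<dots> \<le> (\<integral>s. 4 * pi * \<bar>g s / s\<bar> \<partial>lborel)"
    using pot_classD[OF assms]
    by (intro integral_mono integrable_abs pot_integrand_integrable assms integrable_mult_right kernel_le) auto
  also have "\<dots> = 4 * pi * (\<integral>s. \<bar>g s / s\<bar> \<partial>lborel)" by (rule integral_mult_right_zero)
  finally show ?thesis .
qed

lemma pot_measurable [measurable]:
  assumes [measurable]: "g \<in> borel_measurable borel"
  shows "pot g \<in> borel_measurable borel"
  unfolding pot_def by measurable

lemma coul_integrand_integrable:
  assumes "pot_class f" "pot_class g"
  shows "integrable lborel (\<lambda>r. f r * pot g r)"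
proof -
  note [measurable] = pot_classD(4)[OF assms(1)] pot_classD(4)[OF assms(2)]
  define C where "C = 4 * pi * (\<integral>s. \<bar>g s / s\<bar> \<partial>lborel)"
  show ?thesis
  proof (rule Bochner_Integration.integrable_bound[of _ "\<lambda>r. C * \<bar>f r\<bar>"])
    show "integrable lborel (\<lambda>r. C * \<bar>f r\<bar>)" using pot_classD[OF assms(1)] by auto
    have "\<bar>f r * pot g r\<bar> \<le> \<bar>C * \<bar>f r\<bar>\<bar>" for r
    proof -
      have "\<bar>pot g r\<bar> \<le> \<bar>C\<bar>" using pot_le[OF assms(2), of r] unfolding C_def[symmetric] by linarith
      then show ?thesis by (simp add: abs_mult mult.commute[of "\<bar>C\<bar>"] mult_left_mono)
    qed
    then show "AE r in lborel. norm (f r * pot g r) \<le> norm (C * \<bar>f r\<bar>)" by auto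
  qed simp
qed

text \<open>The integral of the modulus in \<open>s\<close> is \<open>\<bar>f r\<bar>\<close> times
  the potential of \<open>\<bar>g\<bar>\<close>, so Fubini applies. The double integral makes the
  symmetry of the form visible and allows Fatou on the product space.\<close>

lemma coul_product:
  assumes "pot_class f" "pot_class g"
  shows "integrable (lborel \<Otimes>\<^sub>M lborel) (\<lambda>(r, s). f r * (4 * pi / max r s * g s))"
    and "coul f g = integral\<^sup>L (lborel \<Otimes>\<^sub>M lborel) (\<lambda>(r, s). f r * (4 * pi / max r s * g s))"
proof -
  note [measurable] = pot_classD(4)[OF assms(1)] pot_classD(4)[OF assms(2)]
  show int: "integrable (lborel \<Otimes>\<^sub>M lborel) (\<lambda>(r, s). f r * (4 * pi / max r s * g s))"
  proof (rule lborel_pair.Fubini_integrable)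
    have "(\<integral>s. norm (case (r, s) of (r, s) \<Rightarrow> f r * (4 * pi / max r s * g s)) \<partial>lborel)
        = \<bar>f r\<bar> * pot (\<lambda>s. \<bar>g s\<bar>) r" for r
    proof (cases "r \<le> 0")
      case False
      have "(\<integral>s. norm (case (r, s) of (r, s) \<Rightarrow> f r * (4 * pi / max r s * g s)) \<partial>lborel)
        = (\<integral>s. \<bar>f r\<bar> * (4 * pi / max r s * \<bar>g s\<bar>) \<partial>lborel)"
        using False by (intro Bochner_Integration.integral_cong) (auto simp: abs_mult)
      also have "\<dots> = \<bar>f r\<bar> * pot (\<lambda>s. \<bar>g s\<bar>) r" unfolding pot_def by (rule integral_mult_right_zero)
      finally show ?thesis .
    qed (simp add: pot_classD(3)[OF assms(1)])
    moreover have "pot_class (\<lambda>s. \<bar>g s\<bar>)" "pot_class (\<lambda>s. \<bar>f s\<bar>)"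
      using assms by (auto intro: pot_class_abs)
    ultimately show "integrable lborel (\<lambda>r. \<integral>s. norm (case (r, s) of (r, s) \<Rightarrow> f r * (4 * pi / max r s * g s)) \<partial>lborel)"
      using coul_integrand_integrable by simp
  next
    show "AE r in lborel. integrable lborel (\<lambda>s. case (r, s) of (r, s) \<Rightarrow> f r * (4 * pi / max r s * g s))"
      unfolding prod.case by (intro AE_I2 integrable_mult_right pot_integrand_integrable assms)
  qed measurable
  show "coul f g = integral\<^sup>L (lborel \<Otimes>\<^sub>M lborel) (\<lambda>(r, s). f r * (4 * pi / max r s * g s))"
    unfolding lborel_pair.integral_fst'[OF int, symmetric] coul_def pot_def prod.case
      integral_mult_right_zero ..
qed

lemma coul_commute:
  assumes "pot_class f" "pot_class g"
  shows "coul f g = coul g f"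
proof -
  have "coul f g = integral\<^sup>L (lborel \<Otimes>\<^sub>M lborel) (\<lambda>(r, s). f r * (4 * pi / max r s * g s))"
    by (rule coul_product[OF assms])
  also have "\<dots> = integral\<^sup>L (lborel \<Otimes>\<^sub>M lborel) (\<lambda>(s, r). f r * (4 * pi / max r s * g s))"
    using lborel_pair.integral_product_swap[of "\<lambda>(r, s). f r * (4 * pi / max r s * g s)"]
      borel_measurable_integrable[OF coul_product(1)[OF assms]]
    by (simp add: case_prod_unfold)
  also have "(\<lambda>(s, r). f r * (4 * pi / max r s * g s)) = (\<lambda>(r, s). g r * (4 * pi / max r s * f s))"
    by (auto simp: max.commute)
  also have "integral\<^sup>L (lborel \<Otimes>\<^sub>M lborel) \<dots> = coul g f" by (rule coul_product(2)[OF assms(2,1), symmetric])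
  finally show ?thesis .
qed

lemma coul_add_left:
  assumes "pot_class f" "pot_class f'" "pot_class g"
  shows "coul (\<lambda>r. f r + c * f' r) g = coul f g + c * coul f' g"
  using coul_integrand_integrable[OF assms(1,3)] coul_integrand_integrable[OF assms(2,3)]
  unfolding coul_def by (simp add: distrib_right mult.assoc)

lemma coul_add_right:
  assumes "pot_class f" "pot_class g" "pot_class g'"
  shows "coul f (\<lambda>r. g r + c * g' r) = coul f g + c * coul f g'"
  using assms coul_add_left[OF assms(2,3,1)] coul_commute pot_class_add pot_class_mult
  by metis

text \<open>Shaped for \<open>(v + h * \<phi>)\<^sup>2 = v\<^sup>2 + h * (2 * v * \<phi> + h *
  \<phi>\<^sup>2)\<close>: the Coulomb energy along a variation is a polynomial in \<open>h\<close>,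
  so its derivative needs no limit argument.\<close>

lemma coul_quadratic:
  assumes "pot_class f" "pot_class g" "pot_class k"
  shows "coul (\<lambda>r. f r + h * (g r + h * k r)) (\<lambda>r. f r + h * (g r + h * k r))
    = coul f f + 2 * h * coul g f + h\<^sup>2 * (coul g g + 2 * coul f k)
      + h ^ 3 * (2 * coul g k) + h ^ 4 * coul k k"
proof -
  have gk: "pot_class (\<lambda>r. g r + h * k r)" using assms by (intro pot_class_add pot_class_mult)
  have all: "pot_class (\<lambda>r. f r + h * (g r + h * k r))" using assms gk by (intro pot_class_add pot_class_mult)
  let ?gk = "\<lambda>r. g r + h * k r"
  have "coul (\<lambda>r. f r + h * ?gk r) (\<lambda>r. f r + h * ?gk r)
      = coul f f + h * coul f ?gk + h * (coul ?gk f + h * coul ?gk ?gk)"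
    unfolding coul_add_left[OF assms(1) gk all] coul_add_right[OF assms(1) assms(1) gk]
      coul_add_right[OF gk assms(1) gk] by simp
  moreover have "coul f ?gk = coul f g + h * coul f k" by (rule coul_add_right[OF assms])
  moreover have "coul f g = coul g f" "coul k g = coul g k" by (intro coul_commute assms)+
  moreover have "coul ?gk f = coul f ?gk" by (intro coul_commute assms gk)
  moreover have "coul ?gk ?gk = coul g g + h * coul g k + h * (coul k g + h * coul k k)"
    unfolding coul_add_left[OF assms(2,3) gk] coul_add_right[OF assms(2,2,3)]
      coul_add_right[OF assms(3,2,3)] by simp
  ultimately show ?thesis
    by (simp add: algebra_simps power2_eq_square power3_eq_cube power4_eq_xxxx)
qed

lemma coul_nonneg:
  assumes "pot_class f" "\<And>r. 0 \<le> f r"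
  shows "0 \<le> coul f f"
proof -
  have "0 \<le> f r * pot f r" for r
  proof (cases "r \<le> 0")
    case False
    then have "0 \<le> pot f r" unfolding pot_def using assms(2)
      by (intro Bochner_Integration.integral_nonneg) auto
    then show ?thesis using assms(2) by simp
  qed (use pot_classD(3)[OF assms(1)] in auto)
  then show ?thesis unfolding coul_def by (intro Bochner_Integration.integral_nonneg)
qed

definition coulomb :: "(real \<Rightarrow> real) \<Rightarrow> real" where
  "coulomb v = coul (\<lambda>r. (v r)\<^sup>2) (\<lambda>r. (v r)\<^sup>2)"

lemma coulomb_nonneg:
  assumes "energy_le v A" "integrable lborel (\<lambda>r. (v r)\<^sup>2)"
  shows "0 \<le> coulomb v"
  unfolding coulomb_def using pot_class_square(1)[OF assms] by (intro coul_nonneg) auto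

text \<open>The potential is at most \<open>4 * pi\<close> times the integral of
  \<open>v\<^sup>2 / s\<close>, which is estimated by \<open>A * R\<close> inside \<open>R\<close>
  and by \<open>mass v / R\<close> outside.\<close>

lemma coulomb_le:
  assumes "energy_le v A" "integrable lborel (\<lambda>r. (v r)\<^sup>2)"
  shows "coulomb v \<le> 8 * pi * mass v * sqrt (mass v * A)"
proof (cases "A = 0 \<or> mass v = 0")
  case True
  then have "v = (\<lambda>_. 0)" using energy_mass_zero[OF assms] by simp
  then show ?thesis using energy_le_nonneg[OF assms(1)] mass_nonneg by (simp add: coulomb_def coul_def)
next
  case False
  then have pos: "0 < A" "0 < mass v"
    using energy_le_nonneg[OF assms(1)] mass_nonneg[of v] by auto
  \<comment> \<open>Minimises \<open>A * R + mass v / R\<close>.\<close>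
  define R where "R = sqrt (mass v / A)"
  have R: "0 < R" "R * R = mass v / A" using pos by (auto simp: R_def)
  note pc = pot_class_square(1)[OF assms]
  define C where "C = 4 * pi * (\<integral>s. \<bar>(v s)\<^sup>2 / s\<bar> \<partial>lborel)"
  have "coulomb v \<le> (\<integral>r. C * (v r)\<^sup>2 \<partial>lborel)"
    unfolding coulomb_def coul_def
  proof (rule integral_mono)
    show "integrable lborel (\<lambda>r. (v r)\<^sup>2 * pot (\<lambda>r. (v r)\<^sup>2) r)" by (rule coul_integrand_integrable[OF pc pc])
    show "(v r)\<^sup>2 * pot (\<lambda>r. (v r)\<^sup>2) r \<le> C * (v r)\<^sup>2" for r
      unfolding mult.commute[of C] using abs_le_D1[OF pot_le[OF pc, of r]]
      by (intro mult_left_mono) (simp_all add: C_def)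
  qed (use assms(2) in simp)
  also have "\<dots> = C * mass v" by (simp add: mass_def)
  also have "(\<lambda>s. \<bar>(v s)\<^sup>2 / s\<bar>) = (\<lambda>s. (v s)\<^sup>2 / s)"
  proof
    fix s show "\<bar>(v s)\<^sup>2 / s\<bar> = (v s)\<^sup>2 / s"
      using energy_le_zero[OF assms(1), of s] by (cases "s \<le> 0") auto
  qed
  then have "C * mass v \<le> 4 * pi * (A * R + mass v / R) * mass v"
    using pot_class_square(2)[OF assms R(1)] pos unfolding C_def
    by (intro mult_right_mono mult_left_mono) auto
  also have "A * R + mass v / R = 2 * sqrt (mass v * A)"
  proof -
    have "A * R = sqrt (mass v * A)" "mass v / R = sqrt (mass v * A)"
      using pos by (auto simp: R_def real_sqrt_divide real_sqrt_mult field_simps)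
    then show ?thesis by simp
  qed
  finally show ?thesis by (simp add: mult_ac)
qed

lemma coulomb_Fatou:
  assumes "\<And>n. energy_le (v n) (A n)" "\<And>n. integrable lborel (\<lambda>r. (v n r)\<^sup>2)"
    and "energy_le w A'" "integrable lborel (\<lambda>r. (w r)\<^sup>2)"
    and "\<And>r. (\<lambda>n. v n r) \<longlonglongrightarrow> w r" "(\<lambda>n. coulomb (v n)) \<longlonglongrightarrow> L"
  shows "coulomb w \<le> L"
proof -
  let ?F = "\<lambda>v (r, s). (v r)\<^sup>2 * (4 * pi / max r s * (v s)\<^sup>2)"
  have F: "integrable (lborel \<Otimes>\<^sub>M lborel) (?F (v n))" "coulomb (v n) = integral\<^sup>L (lborel \<Otimes>\<^sub>M lborel) (?F (v n))" for n
    unfolding coulomb_def using coul_product[OF pot_class_square(1)[OF assms(1,2)] pot_class_square(1)[OF assms(1,2)]]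
    by auto
  have "0 \<le> ?F (v n) z" for n z
  proof -
    have "0 \<le> (v n (fst z))\<^sup>2 * (4 * pi / max (fst z) (snd z) * (v n (snd z))\<^sup>2)"
      using energy_le_zero[OF assms(1), of "fst z" n] by (cases "fst z \<le> 0") auto
    then show ?thesis by (simp add: case_prod_unfold)
  qed
  moreover have "(\<lambda>n. ?F (v n) z) \<longlonglongrightarrow> ?F w z" for z
    unfolding case_prod_unfold by (intro tendsto_intros assms)
  ultimately have "integral\<^sup>L (lborel \<Otimes>\<^sub>M lborel) (?F w) \<le> L"
    using F assms(6) by (intro integral_Fatou(2)[where f="\<lambda>n. ?F (v n)"]) auto
  then show ?thesis
    unfolding coulomb_def using coul_product(2)[OF pot_class_square(1)[OF assms(3,4)] pot_class_square(1)[OF assms(3,4)]]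
    by simp
qed

lemma coulomb_scale:
  assumes "0 < t" "\<And>r. r \<le> 0 \<Longrightarrow> v r = 0"
  shows "coulomb (\<lambda>r. c * v (t * r)) = c ^ 4 / t * coulomb v"
proof -
  have pot: "pot (\<lambda>s. (c * v (t * s))\<^sup>2) r = c\<^sup>2 * pot (\<lambda>s. (v s)\<^sup>2) (t * r)" for r
  proof -
    have "pot (\<lambda>s. (v s)\<^sup>2) (t * r) = t * (\<integral>s. 4 * pi / max (t * r) (t * s) * (v (t * s))\<^sup>2 \<partial>lborel)"
      unfolding pot_def using assms lborel_integral_real_affine[of t "\<lambda>s. 4 * pi / max (t * r) s * (v s)\<^sup>2" 0] by simp
    also have "(\<lambda>s. 4 * pi / max (t * r) (t * s) * (v (t * s))\<^sup>2) = (\<lambda>s. 1 / t * (4 * pi / max r s * (v (t * s))\<^sup>2))"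
      using assms max_mult_distrib_left[of t r] by (auto simp: mult_ac)
    also have "t * (\<integral>s. 1 / t * (4 * pi / max r s * (v (t * s))\<^sup>2) \<partial>lborel) = t * (1 / t * (\<integral>s. 4 * pi / max r s * (v (t * s))\<^sup>2 \<partial>lborel))"
      unfolding integral_mult_right_zero ..
    finally have eq: "pot (\<lambda>s. (v s)\<^sup>2) (t * r) = (\<integral>s. 4 * pi / max r s * (v (t * s))\<^sup>2 \<partial>lborel)"
      using assms by simp
    have "pot (\<lambda>s. (c * v (t * s))\<^sup>2) r = (\<integral>s. c\<^sup>2 * (4 * pi / max r s * (v (t * s))\<^sup>2) \<partial>lborel)"
      unfolding pot_def by (intro Bochner_Integration.integral_cong) (simp_all add: power_mult_distrib)
    then show ?thesis unfolding integral_mult_right_zero eq .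
  qed
  have "coulomb v = t * (\<integral>r. (v (t * r))\<^sup>2 * pot (\<lambda>s. (v s)\<^sup>2) (t * r) \<partial>lborel)"
    unfolding coulomb_def coul_def
    using assms lborel_integral_real_affine[of t "\<lambda>r. (v r)\<^sup>2 * pot (\<lambda>s. (v s)\<^sup>2) r" 0] by simp
  moreover have "coulomb (\<lambda>r. c * v (t * r)) = (\<integral>r. c ^ 4 * ((v (t * r))\<^sup>2 * pot (\<lambda>s. (v s)\<^sup>2) (t * r)) \<partial>lborel)"
    unfolding coulomb_def coul_def pot
    by (intro Bochner_Integration.integral_cong) (auto simp: power_mult_distrib power2_eq_square power4_eq_xxxx)
  ultimately show ?thesis using assms by simp
qed

text \<open>The kernel is Lipschitz in \<open>1 / r\<close> uniformly in \<open>s\<close>: its two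
  values differ by at most \<open>4 * pi * \<bar>x - r\<bar> / (x * r)\<close>.\<close>

lemma pot_continuous:
  assumes "pot_class g"
  shows "continuous_on {0<..} (pot g)"
proof -
  define C where "C = (\<integral>s. \<bar>g s\<bar> \<partial>lborel)"
  have le: "\<bar>pot g x - pot g r\<bar> \<le> 4 * pi * \<bar>x - r\<bar> / (x * r) * C" if "0 < r" "0 < x" for x r
  proof -
    have eq: "pot g x - pot g r = (\<integral>s. 4 * pi / max x s * g s - 4 * pi / max r s * g s \<partial>lborel)"
      unfolding pot_def using assms by (simp only: Bochner_Integration.integral_diff pot_integrand_integrable)
    have "\<bar>pot g x - pot g r\<bar> \<le> (\<integral>s. \<bar>4 * pi / max x s * g s - 4 * pi / max r s * g s\<bar> \<partial>lborel)"
      unfolding eq by (rule integral_abs_bound)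
    also have "\<dots> \<le> (\<integral>s. 4 * pi * \<bar>x - r\<bar> / (x * r) * \<bar>g s\<bar> \<partial>lborel)"
    proof (rule integral_mono)
      fix s
      have m: "x \<le> max x s" "r \<le> max r s" by auto
      have "\<bar>1 / max x s - 1 / max r s\<bar> = \<bar>max r s - max x s\<bar> / (max x s * max r s)"
      proof -
        have "1 / max x s - 1 / max r s = (max r s - max x s) / (max x s * max r s)"
          using that by (intro trans[OF diff_frac_eq]) auto
        then show ?thesis using that m by (simp add: abs_divide abs_mult)
      qed
      also have "\<dots> \<le> \<bar>x - r\<bar> / (x * r)"
        using that m by (intro frac_le mult_mono) auto
      finally have "4 * pi * \<bar>1 / max x s - 1 / max r s\<bar> * \<bar>g s\<bar> \<le> 4 * pi * (\<bar>x - r\<bar> / (x * r)) * \<bar>g s\<bar>"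
        by (intro mult_right_mono mult_left_mono) auto
      moreover have "\<bar>4 * pi / max x s * g s - 4 * pi / max r s * g s\<bar> = 4 * pi * \<bar>1 / max x s - 1 / max r s\<bar> * \<bar>g s\<bar>"
      proof -
        have "4 * pi / max x s * g s - 4 * pi / max r s * g s = 4 * pi * (1 / max x s - 1 / max r s) * g s"
          by (simp add: algebra_simps)
        then show ?thesis by (simp add: abs_mult)
      qed
      ultimately show "\<bar>4 * pi / max x s * g s - 4 * pi / max r s * g s\<bar> \<le> 4 * pi * \<bar>x - r\<bar> / (x * r) * \<bar>g s\<bar>"
        by simp
    next
      show "integrable lborel (\<lambda>s. \<bar>4 * pi / max x s * g s - 4 * pi / max r s * g s\<bar>)"
        by (intro integrable_abs Bochner_Integration.integrable_diff pot_integrand_integrable assms)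
      show "integrable lborel (\<lambda>s. 4 * pi * \<bar>x - r\<bar> / (x * r) * \<bar>g s\<bar>)"
        by (intro integrable_mult_right integrable_abs pot_classD(1)[OF assms])
    qed
    finally show ?thesis by (simp add: C_def)
  qed
  have "(pot g \<longlongrightarrow> pot g r) (at r within {0<..})" if "0 < r" for r
  proof -
    have "((\<lambda>x. 4 * pi * \<bar>x - r\<bar> / (x * r) * C) \<longlongrightarrow> 4 * pi * \<bar>r - r\<bar> / (r * r) * C) (at r within {0<..})"
      using that by (intro tendsto_intros) auto
    then have "((\<lambda>x. 4 * pi * \<bar>x - r\<bar> / (x * r) * C) \<longlongrightarrow> 0) (at r within {0<..})" by simp
    moreover have "\<forall>\<^sub>F x in at r within {0<..}. norm (pot g x - pot g r) \<le> 4 * pi * \<bar>x - r\<bar> / (x * r) * C"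
      unfolding eventually_at_filter using le[OF that] by (intro always_eventually) auto
    ultimately have "((\<lambda>x. pot g x - pot g r) \<longlongrightarrow> 0) (at r within {0<..})"
      by (rule Lim_null_comparison[rotated])
    then show ?thesis by (subst Lim_null)
  qed
  then show ?thesis unfolding continuous_on_def by blast
qed

section \<open>Minimisation on the Pohozaev set\<close>

text \<open>The diagonal argument gives convergence at the rationals, and the common Hoelder bound
  carries the Cauchy property to every other point.\<close>

lemma pointwise_convergent_subsequence:
  fixes v :: "nat \<Rightarrow> real \<Rightarrow> real"
  assumes "\<And>n. energy_le (v n) (A n)" "\<And>n. A n \<le> K"
  obtains k :: "nat \<Rightarrow> nat" and w where "strict_mono k" "\<And>r. (\<lambda>n. v (k n) r) \<longlonglongrightarrow> w r"
proof -
  have K0: "0 \<le> K" using energy_le_nonneg[OF assms(1)] assms(2) by (meson order_trans)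
  have H: "\<bar>v n t - v n s\<bar> \<le> sqrt (K * \<bar>t - s\<bar>)" for n s t
  proof (rule real_le_rsqrt)
    have "\<bar>v n t - v n s\<bar>\<^sup>2 \<le> A n * \<bar>t - s\<bar>" using energy_le_holder[OF assms(1)] by simp
    also have "\<dots> \<le> K * \<bar>t - s\<bar>" using assms(2) by (intro mult_right_mono) auto
    finally show "\<bar>v n t - v n s\<bar>\<^sup>2 \<le> K * \<bar>t - s\<bar>" .
  qed
  \<comment> \<open>The diagonal argument is applied to functions bounded by 1, hence the division
    by the growth rate of the Hoelder bound from the origin.\<close>
  define c where "c r = sqrt (K * \<bar>r\<bar>) + 1" for r
  have c: "0 < c r" for r using K0 by (auto simp: c_def intro: add_nonneg_pos)
  have bd: "norm (v n r / c r) \<le> 1" for n r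
    using H[of n r 0] energy_le_zero[OF assms(1), of 0 n] c[of r] by (simp add: c_def)
  obtain k :: "nat \<Rightarrow> nat" where k: "strict_mono k" and kc: "\<And>r. r \<in> \<rat> \<Longrightarrow> \<exists>l. (\<lambda>n. v (k n) r / c r) \<longlonglongrightarrow> l"
    using function_convergent_subsequence[of "\<rat> :: real set" "\<lambda>n r. v n r / c r" 1, OF countable_rat bd] by blast
  have k2: "\<exists>l. (\<lambda>n. v (k n) r) \<longlonglongrightarrow> l" if "r \<in> \<rat>" for r
  proof -
    obtain l where "(\<lambda>n. v (k n) r / c r) \<longlonglongrightarrow> l" using kc[OF \<open>r \<in> \<rat>\<close>] by blast
    then have "(\<lambda>n. v (k n) r / c r * c r) \<longlonglongrightarrow> l * c r" by (rule tendsto_mult_right)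
    then show ?thesis using c[of r] by auto
  qed
  have "Cauchy (\<lambda>n. v (k n) r)" for r
  proof (rule metric_CauchyI)
    fix e :: real assume e: "0 < e"
    \<comment> \<open>Within this distance of a rational point the Hoelder bound is at most
      \<open>e / 3\<close>, leaving \<open>e / 3\<close> for the rational point itself.\<close>
    define d where "d = (e / 3)\<^sup>2 / (K + 1)"
    have d: "0 < d" using e K0 by (auto simp: d_def)
    obtain s where s: "s \<in> \<rat>" "r < s" "s < r + d" using Rats_dense_in_real[of r "r + d"] d by auto
    have sm: "sqrt (K * \<bar>s - r\<bar>) \<le> e / 3"
    proof (rule real_le_lsqrt)
      have "K * \<bar>s - r\<bar> \<le> (K + 1) * d" using s K0 by (intro mult_mono) auto
      then show "K * \<bar>s - r\<bar> \<le> (e / 3)\<^sup>2" using K0 by (simp add: d_def)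
    qed (use e in auto)
    have "Cauchy (\<lambda>n. v (k n) s)" using k2[OF s(1)] LIMSEQ_imp_Cauchy by blast
    then obtain N where N: "\<And>i j. N \<le> i \<Longrightarrow> N \<le> j \<Longrightarrow> dist (v (k i) s) (v (k j) s) < e / 3"
      using e unfolding Cauchy_def by (metis zero_less_divide_iff zero_less_numeral)
    have "dist (v (k i) r) (v (k j) r) < e" if "N \<le> i" "N \<le> j" for i j
      using N[OF that] order_trans[OF H[of "k i" s r] sm] order_trans[OF H[of "k j" s r] sm]
      unfolding dist_real_def by linarith
    then show "\<exists>N. \<forall>i\<ge>N. \<forall>j\<ge>N. dist (v (k i) r) (v (k j) r) < e" by blast
  qed
  then have "\<exists>l. (\<lambda>n. v (k n) r) \<longlonglongrightarrow> l" for r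
    using Cauchy_convergent_iff convergent_def by blast
  then obtain w where "\<And>r. (\<lambda>n. v (k n) r) \<longlonglongrightarrow> w r" by metis
  then show thesis using k that by blast
qed

text \<open>The left side is stationary at \<open>t = 1\<close>; that this is its maximum is Young's
  inequality for \<open>t powr b\<close> and 1 with weights \<open>a / b\<close> and
  \<open>1 - a / b\<close>.\<close>

lemma powr_divide_diff_le:
  fixes a b t :: real
  assumes "0 < a" "a < b" "0 < t"
  shows "t powr a / a - t powr b / b \<le> 1 / a - 1 / b"
proof -
  have "(t powr b) powr (a / b) \<le> 1 + a / b * (t powr b - 1)"
  proof -

    have "(t powr b) powr (a / b) * 1 powr (1 - a / b) \<le> a / b * t powr b + (1 - a / b) * 1"
      using assms by (intro Youngs_inequality_0) auto
    then show ?thesis by (simp add: algebra_simps)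
  qed
  then have "t powr a \<le> 1 + a / b * (t powr b - 1)" using assms by (simp add: powr_powr)
  then have "t powr a / a \<le> (1 + a / b * (t powr b - 1)) / a" using assms by (intro divide_right_mono) auto
  also have "\<dots> = 1 / a - 1 / b + t powr b / b" using assms by (simp add: field_simps)
  finally show ?thesis by simp
qed

text \<open>An upward ramp followed by a downward one. The coefficient of \<open>2 * h\<close> is
  the jump of the difference quotients of \<open>v\<close> at \<open>b\<close>, a discrete
  \<open>- v''\<close>, and becomes the second-order term of the Euler-Lagrange equation.\<close>

lemma hat_energy_le:
  fixes v :: "real \<Rightarrow> real"
  assumes "energy_le v A" "0 \<le> a" "a < b" "b < c"
  shows "energy_le (\<lambda>r. v r + h * ((max a (min r b) - a) / (b - a) - (max b (min r c) - b) / (c - b)))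
    (A + 2 * h * ((v b - v a) / (b - a) - (v c - v b) / (c - b)) + h\<^sup>2 * (1 / (b - a) + 1 / (c - b)))"
proof -
  define k l where "k = h / (b - a)" and "l = - h / (c - b)"
  define w where "w r = v r + k * (max a (min r b) - a)" for r
  have w: "energy_le w (A + 2 * k * (v b - v a) + k\<^sup>2 * (b - a))"
    unfolding w_def by (rule energy_le_ramp[OF assms(1-3)])
  have "energy_le (\<lambda>r. w r + l * (max b (min r c) - b))
      (A + 2 * k * (v b - v a) + k\<^sup>2 * (b - a) + 2 * l * (w c - w b) + l\<^sup>2 * (c - b))"
    using energy_le_ramp[OF w, of b c l] assms by simp
  moreover have "w c - w b = v c - v b" using assms by (simp add: w_def)
  moreover have "A + 2 * k * (v b - v a) + k\<^sup>2 * (b - a) + 2 * l * (v c - v b) + l\<^sup>2 * (c - b)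
      = A + 2 * h * ((v b - v a) / (b - a) - (v c - v b) / (c - b)) + h\<^sup>2 * (1 / (b - a) + 1 / (c - b))"
  proof -
    have "k\<^sup>2 * (b - a) = h\<^sup>2 * (1 / (b - a))" "l\<^sup>2 * (c - b) = h\<^sup>2 * (1 / (c - b))"
      using assms by (simp_all add: k_def l_def power_divide) (simp_all add: power2_eq_square)
    moreover have "2 * k * (v b - v a) = 2 * h * ((v b - v a) / (b - a))"
      "2 * l * (v c - v b) = - (2 * h * ((v c - v b) / (c - b)))" by (simp_all add: k_def l_def)
    ultimately show ?thesis by (simp only: right_diff_distrib distrib_left)
  qed
  moreover have "(\<lambda>r. w r + l * (max b (min r c) - b))
      = (\<lambda>r. v r + h * ((max a (min r b) - a) / (b - a) - (max b (min r c) - b) / (c - b)))"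
    by (rule ext) (simp add: w_def k_def l_def right_diff_distrib diff_divide_distrib)
  ultimately show ?thesis by simp
qed

text \<open>
  \<open>\<nu> = -\<mu>\<close>; \<open>m\<close> is the prescribed mass divided by \<open>4\<pi>\<close>.
\<close>

locale radial_problem =
  fixes p q \<nu> m :: real
  assumes p: "10 / 3 < p" "p < 6" and q: "2 < q" "q < 8 / 3" and nu: "0 \<le> \<nu>" and m: "0 < m"
begin

section \<open>Dilation fibres and their critical points\<close>

definition tau :: real where "tau = 3 * (p - 2) / 2"
definition sig :: real where "sig = 3 * (q - 2) / 2"

text \<open>\<open>tau\<close> and \<open>sig\<close> are the exponents
  \<open>3 * (e - 2) / 2\<close> by which the \<open>p\<close>- and \<open>q\<close>-terms scale
  along the mass-preserving dilations. In these terms \<open>tau > 2\<close> is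
  \<open>p > 10 / 3\<close>, \<open>tau < p\<close> is \<open>p < 6\<close>, and
  \<open>sig < 1\<close> is \<open>q < 8 / 3\<close>.\<close>

lemma tau: "2 < tau" "tau < p" and sig: "0 < sig" "sig < 1"
  using p q by (auto simp: tau_def sig_def)

text \<open>
  The energy of \<open>\<surd>t v(t r)\<close> in terms of the gradient, Coulomb, \<open>p\<close>- and \<open>q\<close>-terms of \<open>v\<close>, and \<open>t\<close> times its
  derivative in \<open>t\<close>.
\<close>

definition fiber :: "real \<Rightarrow> real \<Rightarrow> real \<Rightarrow> real \<Rightarrow> real \<Rightarrow> real" where
  "fiber A B C D t = t\<^sup>2 / 2 * A + t / 4 * B + \<nu> / q * t powr sig * D - t powr tau / p * C"

definition fiber_deriv :: "real \<Rightarrow> real \<Rightarrow> real \<Rightarrow> real \<Rightarrow> real \<Rightarrow> real" where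
  "fiber_deriv A B C D t = t\<^sup>2 * A + t / 4 * B + \<nu> * sig / q * t powr sig * D - tau / p * t powr tau * C"

text \<open>Criticality at 1 expresses \<open>C\<close> by the other coefficients. The fibre becomes
  a nonnegative combination of the functions \<open>t powr a / a - t powr tau / tau\<close> with
  \<open>a\<close> equal to 2, 1 and \<open>sig\<close>, each maximal at 1.\<close>

lemma fiber_le_fiber_1:
  assumes "fiber_deriv A B C D 1 = 0" "0 \<le> A" "0 \<le> B" "0 \<le> D" "0 < t"
  shows "fiber A B C D t \<le> fiber A B C D 1"
proof -
  have C: "C = p / tau * (A + B / 4 + \<nu> * sig / q * D)"
    using assms(1) tau p by (simp add: fiber_deriv_def field_simps)
  have e: "fiber A B C D s = A * (s powr 2 / 2 - s powr tau / tau) + B / 4 * (s powr 1 / 1 - s powr tau / tau)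
      + \<nu> * sig / q * D * (s powr sig / sig - s powr tau / tau)" if "0 < s" for s
  proof -
    have "s powr tau / p * C = s powr tau / tau * (A + B / 4 + \<nu> * sig / q * D)" using p unfolding C by simp
    moreover have "s\<^sup>2 = s powr 2" "s powr 1 = s" using that by auto
    moreover have "\<nu> / q * s powr sig * D = \<nu> * sig / q * D * (s powr sig / sig)" using sig by simp
    ultimately show ?thesis unfolding fiber_def by (simp only:) (simp add: algebra_simps)
  qed
  have "A * (t powr 2 / 2 - t powr tau / tau) \<le> A * (1 powr 2 / 2 - 1 powr tau / tau)"
    using powr_divide_diff_le[of 2 tau t] assms tau by (intro mult_left_mono) auto
  moreover have "B / 4 * (t powr 1 / 1 - t powr tau / tau) \<le> B / 4 * (1 powr 1 / 1 - 1 powr tau / tau)"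
    using powr_divide_diff_le[of 1 tau t] assms tau by (intro mult_left_mono) auto
  moreover have "\<nu> * sig / q * D * (t powr sig / sig - t powr tau / tau)
      \<le> \<nu> * sig / q * D * (1 powr sig / sig - 1 powr tau / tau)"
    using powr_divide_diff_le[of sig tau t] assms tau sig q nu by (intro mult_left_mono) auto
  ultimately show ?thesis unfolding e[OF assms(5)] e[OF zero_less_one] by linarith
qed

lemma fiber_deriv_root_between:
  assumes "0 < a" "a \<le> b" "0 \<le> fiber_deriv A B C D a" "fiber_deriv A B C D b \<le> 0"
  obtains t where "a \<le> t" "t \<le> b" "fiber_deriv A B C D t = 0"
proof -
  have "continuous_on {a..b} (fiber_deriv A B C D)"
    unfolding fiber_deriv_def using assms by (intro continuous_intros) auto
  then show thesis using IVT2'[of "fiber_deriv A B C D" b 0 a] assms that by auto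
qed

text \<open>After the same elimination of \<open>C\<close>, the signs are those of
  \<open>t powr a - t powr tau\<close>. A strict change of sign survives small perturbations of the
  coefficients, so perturbed fibres keep a critical point near 1.\<close>

lemma fiber_deriv_strict:
  assumes "fiber_deriv A B C D 1 = 0" "0 < A" "0 \<le> B" "0 \<le> D"
  shows "0 < t \<Longrightarrow> t < 1 \<Longrightarrow> 0 < fiber_deriv A B C D t" "1 < t \<Longrightarrow> fiber_deriv A B C D t < 0"
proof -
  have C: "C = p / tau * (A + B / 4 + \<nu> * sig / q * D)"
    using assms(1) tau p by (simp add: fiber_deriv_def field_simps)
  have e: "fiber_deriv A B C D t = A * (t powr 2 - t powr tau) + B / 4 * (t powr 1 - t powr tau)
      + \<nu> * sig / q * D * (t powr sig - t powr tau)" if "0 < t" for t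
  proof -
    have "tau / p * t powr tau * C = t powr tau * (A + B / 4 + \<nu> * sig / q * D)" using p tau unfolding C by simp
    moreover have "t\<^sup>2 = t powr 2" "t powr 1 = t" using that by auto
    ultimately show ?thesis unfolding fiber_deriv_def by (simp only:) (simp add: algebra_simps diff_divide_distrib)
  qed
  have c: "0 \<le> \<nu> * sig / q * D" using assms nu sig q by simp
  show "0 < fiber_deriv A B C D t" if t: "0 < t" "t < 1"
  proof -
    have "t powr tau < t powr 2" "t powr tau \<le> t powr 1" "t powr tau \<le> t powr sig"
      by (rule powr_less_mono' powr_mono'; use t tau sig in simp)+
    then show ?thesis unfolding e[OF t(1)] using assms c
      by (intro add_pos_nonneg mult_pos_pos mult_nonneg_nonneg[OF c] mult_nonneg_nonneg) auto
  qed
  show "fiber_deriv A B C D t < 0" if t: "1 < t"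
  proof -
    have "t powr 2 < t powr tau" "t powr 1 \<le> t powr tau" "t powr sig \<le> t powr tau"
      by (rule powr_less_mono powr_mono; use t tau sig in simp)+
    then have d: "t powr 2 - t powr tau < 0" "t powr 1 - t powr tau \<le> 0" "t powr sig - t powr tau \<le> 0"
      by linarith+
    have "A * (t powr 2 - t powr tau) < 0" "B / 4 * (t powr 1 - t powr tau) \<le> 0"
        "\<nu> * sig / q * D * (t powr sig - t powr tau) \<le> 0"
      by (rule mult_pos_neg mult_nonneg_nonpos; use assms c d in simp)+
    moreover have "0 < t" using t by simp
    ultimately show ?thesis using e[of t] by linarith
  qed
qed

lemma fiber_deriv_root:
  assumes "0 < A" "0 \<le> B" "0 < C" "0 \<le> D"
  obtains t where "0 < t" "fiber_deriv A B C D t = 0"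
proof -
  define c where "c = tau / p * C"
  have c: "0 < c" using assms tau p by (simp add: c_def)
  define e where "e = \<nu> * sig / q * D"
  have e: "0 \<le> e" using assms nu sig q by (simp add: e_def)
  have po: "fiber_deriv A B C D t = t powr 2 * A + t * (B / 4) + e * t powr sig - c * t powr tau" if "0 < t" for t
    using that by (simp add: fiber_deriv_def c_def e_def mult_ac)
  \<comment> \<open>Small enough that the quadratic gradient term beats the power \<open>tau\<close>
    of the \<open>p\<close>-term.\<close>
  define a where "a = min 1 ((A / c) powr (1 / (tau - 2)))"
  have a: "0 < a" "a \<le> 1" using assms c by (auto simp: a_def)
  have "a powr (tau - 2) \<le> ((A / c) powr (1 / (tau - 2))) powr (tau - 2)"
    using a tau by (intro powr_mono2) (auto simp: a_def)
  also have "\<dots> = A / c" using tau assms c by (simp add: powr_powr)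
  finally have "c * a powr (tau - 2) \<le> A" using c by (simp add: field_simps)
  then have "a powr 2 * (c * a powr (tau - 2)) \<le> a powr 2 * A" by (intro mult_left_mono) auto
  moreover have "a powr 2 * (c * a powr (tau - 2)) = c * a powr tau"
    by (simp add: mult.left_commute powr_add[symmetric] del: powr_numeral)
  moreover have "0 \<le> a * (B / 4)" "0 \<le> e * a powr sig" using a assms e by auto
  ultimately have pa: "0 \<le> fiber_deriv A B C D a" unfolding po[OF a(1)] by linarith
  \<comment> \<open>Beyond 1 all lower powers are at most \<open>t\<^sup>2\<close>; this threshold
    lets the \<open>p\<close>-term beat \<open>t\<^sup>2\<close> times the sum of their
    coefficients.\<close>
  define b where "b = max 1 (((A + B / 4 + e) / c) powr (1 / (tau - 2)))"
  have b: "1 \<le> b" by (simp add: b_def)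
  have "(A + B / 4 + e) / c = (((A + B / 4 + e) / c) powr (1 / (tau - 2))) powr (tau - 2)"
    using tau assms c e by (simp add: powr_powr)
  also have "\<dots> \<le> b powr (tau - 2)" using tau by (intro powr_mono2) (auto simp: b_def)
  finally have "A + B / 4 + e \<le> c * b powr (tau - 2)" using c by (simp add: field_simps)
  then have "b powr 2 * (A + B / 4 + e) \<le> b powr 2 * (c * b powr (tau - 2))" by (intro mult_left_mono) auto
  moreover have "b powr 2 * (c * b powr (tau - 2)) = c * b powr tau"
    by (simp add: mult.left_commute powr_add[symmetric] del: powr_numeral)
  moreover have "b powr 1 * (B / 4) \<le> b powr 2 * (B / 4)" "e * b powr sig \<le> e * b powr 2"
  proof -
    have "b powr 1 \<le> b powr 2" "b powr sig \<le> b powr 2" by (rule powr_mono; use b sig in simp)+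
    then show "b powr 1 * (B / 4) \<le> b powr 2 * (B / 4)" "e * b powr sig \<le> e * b powr 2"
      using assms e by (intro mult_right_mono mult_left_mono; simp)+
  qed
  moreover have "fiber_deriv A B C D b = b powr 2 * A + b powr 1 * (B / 4) + e * b powr sig - c * b powr tau"
    using po[of b] b by simp
  moreover have "b powr 2 * (A + B / 4 + e) = b powr 2 * A + b powr 2 * (B / 4) + e * b powr 2"
    by (simp add: algebra_simps)
  ultimately have pb: "fiber_deriv A B C D b \<le> 0" by linarith
  show thesis using fiber_deriv_root_between[OF a(1) _ pa pb] a b that by (metis dual_order.trans less_le_trans)
qed

text \<open>\<open>A\<close> is any admissible bound for the gradient term, not determined by
  \<open>v\<close>, and the mass may lie below \<open>m\<close>: both conditions pass to pointwise
  limits. A positive \<open>p\<close>-term excludes the zero function.\<close>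

definition state :: "(real \<Rightarrow> real) \<Rightarrow> real \<Rightarrow> bool" where
  "state v A \<longleftrightarrow> energy_le v A \<and> integrable lborel (\<lambda>r. (v r)\<^sup>2) \<and> mass v \<le> m \<and> 0 < power_term p v"

definition state_energy :: "(real \<Rightarrow> real) \<Rightarrow> real \<Rightarrow> real \<Rightarrow> real" where
  "state_energy v A = fiber A (coulomb v) (power_term p v) (power_term q v)"

definition state_deriv :: "(real \<Rightarrow> real) \<Rightarrow> real \<Rightarrow> real \<Rightarrow> real" where
  "state_deriv v A = fiber_deriv A (coulomb v) (power_term p v) (power_term q v)"

definition pohozaev :: "(real \<Rightarrow> real) \<Rightarrow> real \<Rightarrow> bool" where
  "pohozaev v A \<longleftrightarrow> state v A \<and> state_deriv v A 1 = 0"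

lemma stateD:
  assumes "state v A"
  shows "energy_le v A" "integrable lborel (\<lambda>r. (v r)\<^sup>2)" "mass v \<le> m" "0 < power_term p v"
    and "0 < A" "0 \<le> coulomb v"
proof -
  show 1: "energy_le v A" "integrable lborel (\<lambda>r. (v r)\<^sup>2)" "mass v \<le> m" "0 < power_term p v"
    using assms by (auto simp: state_def)
  have "A \<noteq> 0" using 1 energy_mass_zero[OF 1(1,2)] by (auto simp: power_term_def)
  then show "0 < A" using energy_le_nonneg[OF 1(1)] by simp
  show "0 \<le> coulomb v" using coulomb_nonneg[OF 1(1,2)] .
qed

lemma state_scale:
  assumes "state v A" "0 < t"
  defines "w \<equiv> \<lambda>r. sqrt t * v (t * r)"
  shows "state w (t\<^sup>2 * A)" "state_energy w (t\<^sup>2 * A) 1 = state_energy v A t" "state_deriv w (t\<^sup>2 * A) 1 = state_deriv v A t"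
proof -
  note v = stateD[OF assms(1)]
  have z: "\<And>r. r \<le> 0 \<Longrightarrow> v r = 0" using energy_le_zero[OF v(1)] .
  have e: "energy_le w (t\<^sup>2 * A)" using energy_le_scale[OF v(1) assms(2), of "sqrt t"] assms(2)
    by (simp add: w_def power2_eq_square)
  have i: "integrable lborel (\<lambda>r. (w r)\<^sup>2)" unfolding w_def by (rule square_integrable_scale[OF assms(2) v(2)])
  have ma: "mass w = mass v" unfolding w_def using mass_scale[OF assms(2), of "sqrt t" v] assms(2) by simp
  have pt: "power_term e w = t powr (3 * (e - 2) / 2) * power_term e v" for e
  proof -
    have "\<bar>sqrt t\<bar> powr e * t powr (e - 3) = t powr (3 * (e - 2) / 2)"
      using assms(2) by (simp add: powr_half_sqrt[symmetric] powr_powr powr_add[symmetric] field_simps)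
    then show ?thesis unfolding w_def using power_term_scale[of t v e "sqrt t", OF assms(2) z] by simp
  qed
  have co: "coulomb w = t * coulomb v"
  proof -
    have "sqrt t ^ 4 / t = t" using assms(2) by (simp add: power4_eq_xxxx)
    then show ?thesis unfolding w_def using coulomb_scale[of t v "sqrt t", OF assms(2) z] by simp
  qed
  show "state w (t\<^sup>2 * A)" unfolding state_def using e i ma pt[of p] v assms(2) by simp
  show "state_energy w (t\<^sup>2 * A) 1 = state_energy v A t" "state_deriv w (t\<^sup>2 * A) 1 = state_deriv v A t"
    unfolding state_energy_def state_deriv_def fiber_def fiber_deriv_def pt co tau_def[symmetric] sig_def[symmetric] by simp_all
qed

lemma state_to_pohozaev:
  assumes "state v A"
  obtains t where "0 < t" "pohozaev (\<lambda>r. sqrt t * v (t * r)) (t\<^sup>2 * A)"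
    "state_energy (\<lambda>r. sqrt t * v (t * r)) (t\<^sup>2 * A) 1 = state_energy v A t"
proof -
  note v = stateD[OF assms]
  obtain t where "0 < t" "state_deriv v A t = 0"
    unfolding state_deriv_def using fiber_deriv_root[OF v(5,6,4) power_term_nonneg] by metis
  then show thesis using that state_scale[OF assms \<open>0 < t\<close>] unfolding pohozaev_def by simp
qed

lemma pohozaev_state_energy_le:
  assumes "pohozaev v A" "0 < t"
  shows "state_energy v A t \<le> state_energy v A 1"
  unfolding state_energy_def using assms stateD[of v A] power_term_nonneg
  by (intro fiber_le_fiber_1) (auto simp: pohozaev_def state_deriv_def)

text \<open>Eliminating the \<open>p\<close>-term by the Pohozaev identity leaves an energy with the
  coefficients \<open>1 / 2 - 1 / tau\<close>, \<open>(1 - 1 / tau) / 4\<close> and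
  \<open>(1 - sig / tau) * \<nu> / q\<close>, all nonnegative. Hence the energy is coercive on the
  Pohozaev set although the \<open>p\<close>-term enters it negatively.\<close>

lemma pohozaev_energy:
  assumes "pohozaev v A"
  shows "(1 / 2 - 1 / tau) * A \<le> state_energy v A 1" "A \<le> tau / p * power_term p v"
proof -
  note v = stateD[of v A]
  have st: "state v A" using assms by (simp add: pohozaev_def)
  have e: "A + coulomb v / 4 + \<nu> * sig / q * power_term q v = tau / p * power_term p v"
    using assms by (simp add: pohozaev_def state_deriv_def fiber_deriv_def)
  have c: "0 \<le> \<nu> * sig / q * power_term q v" "0 \<le> \<nu> / q * power_term q v"
    using nu sig q power_term_nonneg by auto
  show "A \<le> tau / p * power_term p v" using e c v[OF st] by linarith
  have "power_term p v / p = (A + coulomb v / 4 + \<nu> * sig / q * power_term q v) / tau"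
    unfolding e using tau by simp
  then have "state_energy v A 1 = (1 / 2 - 1 / tau) * A + (1 - 1 / tau) / 4 * coulomb v
      + (1 - sig / tau) * (\<nu> / q * power_term q v)"
  proof -
    assume C: "power_term p v / p = (A + coulomb v / 4 + \<nu> * sig / q * power_term q v) / tau"
    have "state_energy v A 1 = A / 2 + coulomb v / 4 + \<nu> / q * power_term q v - power_term p v / p"
      by (simp add: state_energy_def fiber_def)
    then show ?thesis unfolding C
      by (simp add: algebra_simps add_divide_distrib diff_divide_distrib)
  qed
  moreover have "0 \<le> (1 - 1 / tau) / 4 * coulomb v" using tau v(6)[OF st] by simp
  moreover have "0 \<le> (1 - sig / tau) * (\<nu> / q * power_term q v)"
    using tau sig c(2) by (intro mult_nonneg_nonneg[OF _ c(2)]) auto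
  ultimately show "(1 / 2 - 1 / tau) * A \<le> state_energy v A 1" by linarith
qed

lemma power_term_le:
  assumes "state v A" "2 < e" "e < 6"
  shows "power_term e v \<le> (1 / (3 - e / 2) + 16 powr ((e - 2) / 4)) * m powr ((6 - e) / 4) * A powr (3 * (e - 2) / 4)"
proof -
  note v = stateD[OF assms(1)]
  have "power_term e v \<le> (1 / (3 - e / 2) + 16 powr ((e - 2) / 4)) * mass v powr ((6 - e) / 4) * A powr (3 * (e - 2) / 4)"
    by (rule gagliardo_nirenberg[OF v(1,2) assms(2,3)])
  also have "\<dots> \<le> (1 / (3 - e / 2) + 16 powr ((e - 2) / 4)) * m powr ((6 - e) / 4) * A powr (3 * (e - 2) / 4)"
    using assms v(3) mass_nonneg by (intro mult_right_mono mult_left_mono powr_mono2) auto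
  finally show ?thesis .
qed

text \<open>The positive solution of \<open>A = K * A powr (tau / 2)\<close>, with \<open>K\<close>
  the constant that Gagliardo-Nirenberg gives for \<open>tau / p\<close> times the
  \<open>p\<close>-term. It grows without bound as \<open>m\<close> decreases to 0.\<close>

definition gap :: real where
  "gap = (1 / (tau / p * (1 / (3 - p / 2) + 16 powr ((p - 2) / 4)) * m powr ((6 - p) / 4))) powr (1 / (tau / 2 - 1))"

lemma gap_pos: "0 < gap"
proof -
  have "0 < 1 / (3 - p / 2) + 16 powr ((p - 2) / 4)" using p by (intro add_pos_pos) auto
  then show ?thesis using p tau m by (simp add: gap_def)
qed

text \<open>On the Pohozaev set \<open>A \<le> K * A powr (tau / 2)\<close>. As
  \<open>tau / 2 > 1\<close> and \<open>A > 0\<close>, dividing by \<open>A\<close> bounds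
  \<open>A\<close> from below.\<close>

lemma pohozaev_gap:
  assumes "pohozaev v A"
  shows "gap \<le> A"
proof -
  have st: "state v A" using assms by (simp add: pohozaev_def)
  have A: "0 < A" using stateD(5)[OF st] .
  define K where "K = tau / p * (1 / (3 - p / 2) + 16 powr ((p - 2) / 4)) * m powr ((6 - p) / 4)"
  have "0 < 1 / (3 - p / 2) + 16 powr ((p - 2) / 4)" using p by (intro add_pos_pos) auto
  then have K: "0 < K" using p tau m by (simp add: K_def)
  have "A \<le> tau / p * power_term p v" by (rule pohozaev_energy(2)[OF assms])
  also have "\<dots> \<le> tau / p * ((1 / (3 - p / 2) + 16 powr ((p - 2) / 4)) * m powr ((6 - p) / 4) * A powr (3 * (p - 2) / 4))"
    using power_term_le[OF st, of p] p tau by (intro mult_left_mono) auto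
  also have "\<dots> = K * A powr (tau / 2)" by (simp add: K_def tau_def)
  also have "A powr (tau / 2) = A powr (tau / 2 - 1) * A" using A powr_add[of A "tau / 2 - 1" 1] by simp
  finally have "1 / K \<le> A powr (tau / 2 - 1)" using A K by (simp add: field_simps)
  then have "(1 / K) powr (1 / (tau / 2 - 1)) \<le> (A powr (tau / 2 - 1)) powr (1 / (tau / 2 - 1))"
    using tau K by (intro powr_mono2) auto
  also have "\<dots> = A" using tau A by (simp add: powr_powr)
  finally show ?thesis by (simp add: gap_def K_def)
qed

lemma pohozaev_nonempty: "\<exists>v A. pohozaev v A"
proof -
  \<comment> \<open>The hat on \<open>[1, 3]\<close> with peak 1 at 2; its two unit slopes give
    energy 2.\<close>
  define f :: "real \<Rightarrow> real" where "f r = (max 1 (min r 2) - 1) - (max 2 (min r 3) - 2)" for r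
  have "energy_le (\<lambda>_. 0) 0" unfolding energy_le_def by (auto intro!: exI[of _ "\<lambda>_. 0"])
  from hat_energy_le[OF this, of 1 2 3 1] have f: "energy_le f 2" by (simp add: f_def[abs_def])
  note [measurable] = energy_le_measurable[OF f]
  have int: "integrable lborel (\<lambda>r. (f r)\<^sup>2)"
  proof (rule Bochner_Integration.integrable_bound)
    show "integrable lborel (indicator {1..3} :: real \<Rightarrow> real)" by (auto simp: integrable_indicator_iff)
    have "(f r)\<^sup>2 \<le> indicator {1..3} r" for r
    proof (cases "1 \<le> r \<and> r \<le> 3")
      case True
      then have "\<bar>f r\<bar> \<le> 1" by (auto simp: f_def max_def min_def)
      then show ?thesis using True by (simp add: abs_square_le_1)
    qed (auto simp: f_def max_def min_def)
    then show "AE r in lborel. norm ((f r)\<^sup>2) \<le> norm (indicator {1..3} r :: real)" by simp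
  qed measurable
  have pos: "0 < power_term p f"
  proof -
    have i: "integrable lborel (\<lambda>r. \<bar>f r\<bar> powr p * r powr (2 - p))"
      using power_term_integrable_le(1)[OF f int, of p 1] p by simp
    have "(\<integral>r. (1 / 2) powr p * 3 powr (2 - p) * indicator {3/2..5/2::real} r \<partial>lborel) \<le> power_term p f"
      unfolding power_term_def
    proof (rule integral_mono)
      show "integrable lborel (\<lambda>r::real. (1 / 2) powr p * 3 powr (2 - p) * indicator {3/2..5/2} r)"
        by (intro integrable_mult_right) (auto simp: integrable_indicator_iff)
      show "(1 / 2) powr p * 3 powr (2 - p) * indicator {3/2..5/2} r \<le> \<bar>f r\<bar> powr p * r powr (2 - p)" for r :: real
      proof (cases "r \<in> {3/2..5/2}")
        case True
        then have "1 / 2 \<le> \<bar>f r\<bar>" by (auto simp: f_def max_def min_def)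
        then have "(1 / 2) powr p \<le> \<bar>f r\<bar> powr p" using p by (intro powr_mono2) auto
        moreover have "3 powr (2 - p) \<le> r powr (2 - p)" using p True by (intro powr_mono2') auto
        ultimately show ?thesis using True by (auto intro!: mult_mono)
      qed simp
    qed (rule i)
    moreover have "(\<integral>r. (1 / 2) powr p * 3 powr (2 - p) * indicator {3/2..5/2::real} r \<partial>lborel) = (1 / 2) powr p * 3 powr (2 - p)"
      by simp
    moreover have "0 < (1 / 2) powr p * (3::real) powr (2 - p)" by simp
    ultimately show ?thesis by linarith
  qed
  have mf: "0 < mass f"
  proof (rule ccontr)
    assume "\<not> 0 < mass f"
    then have "f = (\<lambda>_. 0)" using energy_mass_zero[OF f int] mass_nonneg[of f] by simp
    then show False using pos by (simp add: power_term_def)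
  qed
  \<comment> \<open>Amplitude that brings the mass to exactly \<open>m\<close>.\<close>
  define c where "c = sqrt (m / mass f)"
  have c: "0 < c" "c\<^sup>2 * mass f = m" using m mf by (auto simp: c_def)
  have "state (\<lambda>r. c * f (1 * r)) (c\<^sup>2 * 1 * 2)"
    unfolding state_def
  proof (intro conjI)
    show "energy_le (\<lambda>r. c * f (1 * r)) (c\<^sup>2 * 1 * 2)" by (rule energy_le_scale[OF f]) simp
    show "integrable lborel (\<lambda>r. (c * f (1 * r))\<^sup>2)" by (rule square_integrable_scale[OF _ int]) simp
    show "mass (\<lambda>r. c * f (1 * r)) \<le> m" using mass_scale[of 1 c f] c by simp
    show "0 < power_term p (\<lambda>r. c * f (1 * r))"
      using power_term_scale[of 1 f p c] energy_le_zero[OF f] c pos by simp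
  qed
  then show ?thesis using state_to_pohozaev by metis
qed

text \<open>The pointwise limit of a minimising sequence need not satisfy the Pohozaev identity, but
  it is a state, and its dilation onto the Pohozaev set has energy at most the infimum.\<close>

lemma minimiser_exists:
  obtains v A where "pohozaev v A" "\<And>v' A'. pohozaev v' A' \<Longrightarrow> state_energy v A 1 \<le> state_energy v' A' 1"
proof -
  define S where "S = {state_energy v A 1 |v A. pohozaev v A}"
  have S0: "S \<noteq> {}" using pohozaev_nonempty by (auto simp: S_def)
  have bdd: "bdd_below S"
  proof (rule bdd_belowI[of _ 0])
    fix x assume "x \<in> S"
    then obtain v A where vA: "x = state_energy v A 1" "pohozaev v A" by (auto simp: S_def)
    have "0 \<le> (1 / 2 - 1 / tau) * A"
      using stateD(5)[of v A] vA tau by (intro mult_nonneg_nonneg) (auto simp: pohozaev_def field_simps)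
    then show "0 \<le> x" using pohozaev_energy(1)[OF vA(2)] vA(1) by simp
  qed
  define I where "I = Inf S"
  have I_le: "I \<le> state_energy v A 1" if "pohozaev v A" for v A
    unfolding I_def using that bdd by (intro cInf_lower) (auto simp: S_def)
  have "\<exists>v A. pohozaev v A \<and> state_energy v A 1 < I + 1 / real (Suc n)" for n
  proof -
    have "\<exists>x\<in>S. x < I + 1 / real (Suc n)"
      using cInf_lessD[OF S0, of "I + 1 / real (Suc n)"] by (auto simp: I_def)
    then show ?thesis by (auto simp: S_def)
  qed
  then obtain v A where v: "\<And>n. pohozaev (v n) (A n)" "\<And>n. state_energy (v n) (A n) 1 < I + 1 / real (Suc n)" by metis
  have st: "state (v n) (A n)" for n using v(1) by (simp add: pohozaev_def)
  note vs = stateD[OF st]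
  define K where "K = (I + 1) / (1 / 2 - 1 / tau)"
  have c0: "0 < 1 / 2 - 1 / tau" using tau by (simp add: field_simps)
  have AK: "A n \<le> K" for n
  proof -
    have "(1 / 2 - 1 / tau) * A n \<le> state_energy (v n) (A n) 1" by (rule pohozaev_energy(1)[OF v(1)])
    also have "\<dots> \<le> I + 1 / real (Suc n)" using v(2)[of n] by simp
    also have "\<dots> \<le> I + 1" by simp
    finally show ?thesis using c0 by (simp add: K_def pos_le_divide_eq mult.commute)
  qed
  define Bb where "Bb = 8 * pi * m * sqrt (m * K)"
  have Bb: "coulomb (v n) \<le> Bb" for n
  proof -
    have "coulomb (v n) \<le> 8 * pi * mass (v n) * sqrt (mass (v n) * A n)" by (rule coulomb_le[OF vs(1,2)])
    also have "\<dots> \<le> Bb" unfolding Bb_def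
      using vs(3,5)[of n] AK[of n] mass_nonneg[of "v n"] m
      by (intro mult_mono real_sqrt_le_mono mult_nonneg_nonneg) auto
    finally show ?thesis .
  qed
  define Db where "Db = (1 / (3 - q / 2) + 16 powr ((q - 2) / 4)) * m powr ((6 - q) / 4) * K powr (3 * (q - 2) / 4)"
  have Db: "power_term q (v n) \<le> Db" for n
  proof -
    have "power_term q (v n) \<le> (1 / (3 - q / 2) + 16 powr ((q - 2) / 4)) * m powr ((6 - q) / 4) * A n powr (3 * (q - 2) / 4)"
      using power_term_le[OF st, of q] q by simp
    also have "\<dots> \<le> Db" unfolding Db_def
      using q AK vs(5)[of n] by (intro mult_left_mono powr_mono2) auto
    finally show ?thesis .
  qed
  obtain k w where k: "strict_mono k" and w0: "\<And>r. (\<lambda>n. v (k n) r) \<longlonglongrightarrow> w r"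
    using pointwise_convergent_subsequence[of v A K, OF vs(1) AK] by blast
  \<comment> \<open>All scalars that need a limit are collected in one bounded vector, so a single
    further extraction handles them together.\<close>
  define X where "X n = (A (k n), coulomb (v (k n)), power_term q (v (k n)), mass (v (k n)))" for n
  have "range X \<subseteq> {0..K} \<times> {0..Bb} \<times> {0..Db} \<times> {0..m}"
    using AK Bb Db vs(3,5,6) power_term_nonneg mass_nonneg by (auto simp: X_def less_imp_le)
  moreover have "compact ({0..K} \<times> {0..Bb} \<times> {0..Db} \<times> {0..m})" by (intro compact_Times compact_Icc)
  ultimately obtain l j where "strict_mono (j :: nat \<Rightarrow> nat)" "(X \<circ> j) \<longlonglongrightarrow> l"
    unfolding compact_def by (meson range_subsetD)
  then obtain a B D M where lim: "(X \<circ> j) \<longlonglongrightarrow> (a, B, D, M)" and j: "strict_mono j" by (metis prod_cases4)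
  define i where "i = k \<circ> j"
  have i: "strict_mono i" unfolding i_def using k j by (simp add: strict_mono_o)
  have Al: "(\<lambda>n. A (i n)) \<longlonglongrightarrow> a" using tendsto_fst[OF lim] by (simp add: X_def i_def o_def)
  have Bl: "(\<lambda>n. coulomb (v (i n))) \<longlonglongrightarrow> B"
    using tendsto_fst[OF tendsto_snd[OF lim]] by (simp add: X_def i_def o_def)
  have Dl: "(\<lambda>n. power_term q (v (i n))) \<longlonglongrightarrow> D"
    using tendsto_fst[OF tendsto_snd[OF tendsto_snd[OF lim]]] by (simp add: X_def i_def o_def)
  have Ml: "(\<lambda>n. mass (v (i n))) \<longlonglongrightarrow> M"
    using tendsto_snd[OF tendsto_snd[OF tendsto_snd[OF lim]]] by (simp add: X_def i_def o_def)
  have wl: "(\<lambda>n. v (i n) r) \<longlonglongrightarrow> w r" for r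
    using LIMSEQ_subseq_LIMSEQ[OF w0 j] by (simp add: i_def o_def)
  have we: "energy_le w a" by (rule energy_le_tendsto[OF vs(1) wl Al])
  have "integrable lborel (\<lambda>r. (w r)\<^sup>2) \<and> mass w \<le> M"
    unfolding mass_def
    using integral_Fatou[where f="\<lambda>n r. (v (i n) r)\<^sup>2" and M = lborel and g="\<lambda>r. (w r)\<^sup>2" and L=M,
      OF vs(2) zero_le_power2 tendsto_power[OF wl] Ml[unfolded mass_def]] by blast
  moreover have "M \<le> m" using Ml vs(3) by (intro LIMSEQ_le_const2[OF Ml]) auto
  ultimately have wi: "integrable lborel (\<lambda>r. (w r)\<^sup>2)" and wm: "mass w \<le> m" by auto
  have wB: "coulomb w \<le> B" by (rule coulomb_Fatou[OF vs(1,2) we wi wl Bl])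
  have wD: "power_term q w \<le> D"
    unfolding power_term_def
  proof (rule integral_Fatou(2)[where f="\<lambda>n r. \<bar>v (i n) r\<bar> powr q * r powr (2 - q)"])
    show "integrable lborel (\<lambda>r. \<bar>v (i n) r\<bar> powr q * r powr (2 - q))" for n
      using power_term_integrable_le(1)[OF vs(1,2), of q 1] q by simp
    show "(\<lambda>n. \<bar>v (i n) r\<bar> powr q * r powr (2 - q)) \<longlonglongrightarrow> \<bar>w r\<bar> powr q * r powr (2 - q)" for r
      using q by (intro tendsto_mult_right tendsto_powr2 tendsto_rabs wl) auto
    show "(\<lambda>n. \<integral>r. \<bar>v (i n) r\<bar> powr q * r powr (2 - q) \<partial>lborel) \<longlonglongrightarrow> D"
      using Dl by (simp add: power_term_def)
  qed simp
  have Cl: "(\<lambda>n. power_term p (v (i n))) \<longlonglongrightarrow> power_term p w"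
    using p by (intro power_term_tendsto[OF vs(1,2) AK vs(3) wl]) auto
  \<comment> \<open>The gap keeps the \<open>p\<close>-terms away from zero. As they converge to the
    \<open>p\<close>-term of the limit, vanishing is excluded.\<close>
  have "p / tau * gap \<le> power_term p (v (i n))" for n
  proof -
    have "gap \<le> tau / p * power_term p (v (i n))" using pohozaev_gap[OF v(1)] pohozaev_energy(2)[OF v(1)] by (meson order_trans)
    then show ?thesis using tau p by (simp add: field_simps)
  qed
  then have "p / tau * gap \<le> power_term p w" by (intro LIMSEQ_le_const[OF Cl]) auto
  moreover have "0 < p / tau * gap" using gap_pos p tau by simp
  ultimately have "state w a" using we wi wm by (simp add: state_def)
  then obtain t where t: "0 < t" "pohozaev (\<lambda>r. sqrt t * w (t * r)) (t\<^sup>2 * a)"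
    "state_energy (\<lambda>r. sqrt t * w (t * r)) (t\<^sup>2 * a) 1 = state_energy w a t" using state_to_pohozaev by metis
  \<comment> \<open>At the fixed dilation \<open>t\<close>, losses in Coulomb and
    \<open>q\<close>-term only lower the energy of the limit, and each member of the sequence has at
    \<open>t\<close> at most its energy at 1, where its fibre is maximal.\<close>
  have "state_energy w a t \<le> I"
  proof -
    have "state_energy w a t \<le> fiber a B (power_term p w) D t"
      unfolding state_energy_def fiber_def using wB wD nu q t p
      by (intro diff_mono add_mono mult_left_mono) auto
    moreover have "fiber a B (power_term p w) D t \<le> I"
    proof (rule LIMSEQ_le)
      show "(\<lambda>n. state_energy (v (i n)) (A (i n)) t) \<longlonglongrightarrow> fiber a B (power_term p w) D t"
        unfolding state_energy_def fiber_def by (intro tendsto_intros Al Bl Cl Dl)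
      have "(\<lambda>n. I + 1 / real (Suc n)) \<longlonglongrightarrow> I + 0"
        by (intro tendsto_add tendsto_const LIMSEQ_Suc[OF lim_1_over_n])
      then have "((\<lambda>n. I + 1 / real (Suc n)) \<circ> i) \<longlonglongrightarrow> I + 0" using i by (rule LIMSEQ_subseq_LIMSEQ)
      then show "(\<lambda>n. I + 1 / real (Suc (i n))) \<longlonglongrightarrow> I" by (simp add: o_def)
      show "\<exists>N. \<forall>n\<ge>N. state_energy (v (i n)) (A (i n)) t \<le> I + 1 / real (Suc (i n))"
        using pohozaev_state_energy_le[OF v(1) t(1)] v(2) by (meson less_imp_le order_trans)
    qed
    ultimately show ?thesis by simp
  qed
  then show thesis using that[OF t(2)] t(3) I_le by (metis order_trans)
qed

end

section \<open>The Euler--Lagrange equation\<close>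

lemma abs_powr_has_derivative:
  fixes x e :: real
  assumes "2 < e"
  shows "((\<lambda>x. \<bar>x\<bar> powr e) has_real_derivative e * (\<bar>x\<bar> powr (e - 2) * x)) (at x)"
proof -
  consider "x > 0" | "x < 0" | "x = 0" by linarith
  then show ?thesis
  proof cases
    case 1
    have d: "((\<lambda>x. x powr e) has_real_derivative e * x powr (e - 1)) (at x)"
      using 1 by (auto intro!: derivative_eq_intros)
    have e: "e * (\<bar>x\<bar> powr (e - 2) * x) = e * x powr (e - 1)" using 1 powr_add[of x "e - 2" 1] by simp
    have ev: "\<forall>\<^sub>F y in nhds x. \<bar>y\<bar> powr e = y powr e"
      using eventually_nhds_in_open[of "{0<..}" x] 1 by (auto elim!: eventually_mono)
    show ?thesis using d unfolding DERIV_cong_ev[OF refl ev e] .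
  next
    case 2
    have d: "((\<lambda>x. (- x) powr e) has_real_derivative - e * (- x) powr (e - 1)) (at x)"
      using 2 by (auto intro!: derivative_eq_intros)
    have e: "e * (\<bar>x\<bar> powr (e - 2) * x) = - e * (- x) powr (e - 1)" using 2 powr_add[of "- x" "e - 2" 1] by simp
    have ev: "\<forall>\<^sub>F y in nhds x. \<bar>y\<bar> powr e = (- y) powr e"
      using eventually_nhds_in_open[of "{..<0}" x] 2 by (auto elim!: eventually_mono)
    show ?thesis using d unfolding DERIV_cong_ev[OF refl ev e] .
  next
    case 3
    have "((\<lambda>h. \<bar>h\<bar> powr (e - 1)) \<longlongrightarrow> \<bar>0\<bar> powr (e - 1)) (at 0)"
      using assms by (intro tendsto_powr2 tendsto_intros) auto
    then have "((\<lambda>h. \<bar>h\<bar> powr (e - 1)) \<longlongrightarrow> 0) (at 0)" using assms by simp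
    moreover have "\<forall>\<^sub>F h in at 0. norm (\<bar>h\<bar> powr e / h) \<le> \<bar>h\<bar> powr (e - 1)"
      by (intro always_eventually allI) (auto simp: powr_diff)
    ultimately have "((\<lambda>h. \<bar>h\<bar> powr e / h) \<longlongrightarrow> 0) (at 0)" by (rule Lim_null_comparison[rotated])
    then show ?thesis using 3 assms by (simp add: DERIV_def)
  qed
qed

lemma integrable_compact_support:
  fixes f :: "real \<Rightarrow> real"
  assumes "continuous_on {a..b} f" "\<And>x. x \<notin> {a..b} \<Longrightarrow> f x = 0"
  shows "integrable lborel f" "integral {a..b} f = (\<integral>x. f x \<partial>lborel)"
proof -
  have s: "set_integrable lborel {a..b} f" by (rule borel_integrable_atLeastAtMost'[OF assms(1)])
  have e: "(\<lambda>x. indicator {a..b} x *\<^sub>R f x) = f"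
  proof
    show "indicator {a..b} x *\<^sub>R f x = f x" for x using assms(2)[of x] by (cases "x \<in> {a..b}") auto
  qed
  show "integrable lborel f" using s unfolding set_integrable_def e .
  show "integral {a..b} f = (\<integral>x. f x \<partial>lborel)"
    using set_borel_integral_eq_integral(2)[OF s] unfolding set_lebesgue_integral_def e by simp
qed

text \<open>The tent with peak 1 at \<open>b\<close>, as a difference of ramps so that
  \<open>hat_energy_le\<close> applies to \<open>v + h * hat\<close>.\<close>

definition hat :: "real \<Rightarrow> real \<Rightarrow> real \<Rightarrow> real \<Rightarrow> real" where
  "hat a b c r = (max a (min r b) - a) / (b - a) - (max b (min r c) - b) / (c - b)"

lemma hat_continuous [continuous_intros]:
  "a < b \<Longrightarrow> b < c \<Longrightarrow> continuous_on S (hat a b c)"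
  unfolding hat_def by (intro continuous_intros) auto

lemma hat_support: "a < b \<Longrightarrow> b < c \<Longrightarrow> r \<notin> {a..c} \<Longrightarrow> hat a b c r = 0"
  by (auto simp: hat_def max_def min_def)

lemma pot_class_compact_support:
  fixes f :: "real \<Rightarrow> real"
  assumes "continuous_on {a..b} f" "\<And>x. x \<notin> {a..b} \<Longrightarrow> f x = 0" "0 < a"
  shows "pot_class f"
  unfolding pot_class_def
proof (intro conjI allI impI)
  show "f r = 0" if "r \<le> 0" for r using assms that by auto
  show "integrable lborel f" by (rule integrable_compact_support[OF assms(1,2)])
  show "integrable lborel (\<lambda>r. f r / r)"
    by (rule integrable_compact_support[of a b]) (use assms in \<open>auto intro!: continuous_intros\<close>)
qed

text \<open>The perturbation lives on \<open>[a, c]\<close>, away from the singular weight at the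
  origin. There the integrand and its derivative in \<open>h\<close> are continuous and the Leibniz
  rule applies; the rest of the integral does not depend on \<open>h\<close>.\<close>

lemma power_term_perturb:
  assumes "energy_le v A" "integrable lborel (\<lambda>r. (v r)\<^sup>2)" "2 < e" "e < 6" "0 < a" "a < b" "b < c"
    and "\<And>h. integrable lborel (\<lambda>r. (v r + h * hat a b c r)\<^sup>2)"
  shows "((\<lambda>h. power_term e (\<lambda>r. v r + h * hat a b c r)) has_real_derivative
    e * (\<integral>r. \<bar>v r\<bar> powr (e - 2) * v r * r powr (2 - e) * hat a b c r \<partial>lborel)) (at 0)"
proof -
  let ?f = "\<lambda>h r. \<bar>v r + h * hat a b c r\<bar> powr e * r powr (2 - e)"
  let ?g = "\<lambda>h r. e * (\<bar>v r + h * hat a b c r\<bar> powr (e - 2) * (v r + h * hat a b c r)) * hat a b c r * r powr (2 - e)"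
  note vc = energy_le_continuous[OF assms(1)]
  have vc': "continuous_on S v" for S using vc continuous_on_subset by blast
  note [continuous_intros] = hat_continuous[OF assms(6,7)]
  have cf: "continuous_on {a..c} (?f h)" for h
    using assms by (intro continuous_intros vc' continuous_on_powr') auto
  have "((\<lambda>h. integral (cbox a c) (?f h)) has_field_derivative integral (cbox a c) (?g 0)) (at 0 within UNIV)"
  proof (rule leibniz_rule_field_derivative)
    fix h r assume "r \<in> cbox a c"
    have "((\<lambda>x. \<bar>v r + x * hat a b c r\<bar> powr e) has_real_derivative
        e * (\<bar>v r + h * hat a b c r\<bar> powr (e - 2) * (v r + h * hat a b c r)) * hat a b c r) (at h within UNIV)"
      by (rule DERIV_chain2[OF abs_powr_has_derivative[OF assms(3)]]) (auto intro!: derivative_eq_intros)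
    then show "((\<lambda>h. ?f h r) has_real_derivative ?g h r) (at h within UNIV)"
      by (rule DERIV_cmult_right)
  next
    show "?f h integrable_on cbox a c" for h using cf[of h] by (intro integrable_continuous) simp
    have 1: "continuous_on (UNIV \<times> cbox a c) (\<lambda>x. v (snd x))" "continuous_on (UNIV \<times> cbox a c) (\<lambda>x. hat a b c (snd x))"
      by (rule continuous_on_compose2[OF vc continuous_on_snd[OF continuous_on_id]], simp)
        (rule continuous_on_compose2[OF hat_continuous[OF assms(6,7), of UNIV] continuous_on_snd[OF continuous_on_id]], simp)
    show "continuous_on (UNIV \<times> cbox a c) (\<lambda>(h, r). ?g h r)"
      unfolding case_prod_unfold
      using assms by (intro continuous_intros 1 continuous_on_powr') auto
  qed auto
  moreover have "integral (cbox a c) (?g 0) = e * (\<integral>r. \<bar>v r\<bar> powr (e - 2) * v r * r powr (2 - e) * hat a b c r \<partial>lborel)"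
  proof -
    have "integral (cbox a c) (?g 0) = (\<integral>r. ?g 0 r \<partial>lborel)"
      unfolding cbox_interval using assms hat_support[OF assms(6,7)]
      by (intro integrable_compact_support continuous_intros vc' continuous_on_powr') auto
    also have "\<dots> = (\<integral>r. e * (\<bar>v r\<bar> powr (e - 2) * v r * r powr (2 - e) * hat a b c r) \<partial>lborel)"
      by (intro Bochner_Integration.integral_cong) auto
    finally show ?thesis by simp
  qed
  moreover have "power_term e (\<lambda>r. v r + h * hat a b c r)
      = integral (cbox a c) (?f h) + (power_term e v - integral (cbox a c) (?f 0))" for h
  proof -
    have i: "integrable lborel (?f h)" for h
      by (rule power_term_integrable_le(1)[of _ _ _ 1, OF _ assms(8,3,4)])
        (use hat_energy_le[OF assms(1) _ assms(6,7), of h] assms(5) in \<open>auto simp: hat_def\<close>)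
    have "power_term e (\<lambda>r. v r + h * hat a b c r) - power_term e v = (\<integral>r. ?f h r - ?f 0 r \<partial>lborel)"
      unfolding power_term_def using i[of h] i[of 0] by simp
    also have "\<dots> = integral {a..c} (\<lambda>r. ?f h r - ?f 0 r)"
      using hat_support[OF assms(6,7)]
      by (intro integrable_compact_support(2)[symmetric] continuous_on_diff cf) auto
    also have "\<dots> = integral {a..c} (?f h) - integral {a..c} (?f 0)"
      by (intro Henstock_Kurzweil_Integration.integral_diff integrable_continuous_interval cf)
    finally show ?thesis by simp
  qed
  ultimately show ?thesis by (auto intro!: derivative_eq_intros)
qed

lemma square_perturb:
  assumes "energy_le v A" "integrable lborel (\<lambda>r. (v r)\<^sup>2)" "0 < a" "a < b" "b < c"
  shows "integrable lborel (\<lambda>r. (v r + h * hat a b c r)\<^sup>2)"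
    and "mass (\<lambda>r. v r + h * hat a b c r) = mass v + 2 * h * (\<integral>r. v r * hat a b c r \<partial>lborel) + h\<^sup>2 * mass (hat a b c)"
    and "coulomb (\<lambda>r. v r + h * hat a b c r) = coulomb v + 2 * h * (2 * (\<integral>r. v r * hat a b c r * pot (\<lambda>r. (v r)\<^sup>2) r \<partial>lborel))
      + h\<^sup>2 * (coul (\<lambda>r. 2 * (v r * hat a b c r)) (\<lambda>r. 2 * (v r * hat a b c r)) + 2 * coul (\<lambda>r. (v r)\<^sup>2) (\<lambda>r. (hat a b c r)\<^sup>2))
      + h ^ 3 * (2 * coul (\<lambda>r. 2 * (v r * hat a b c r)) (\<lambda>r. (hat a b c r)\<^sup>2))
      + h ^ 4 * coul (\<lambda>r. (hat a b c r)\<^sup>2) (\<lambda>r. (hat a b c r)\<^sup>2)"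
proof -
  have vc: "continuous_on S v" for S using energy_le_continuous[OF assms(1)] continuous_on_subset by blast
  note [continuous_intros] = hat_continuous[OF assms(4,5)]
  have c: "pot_class (\<lambda>r. v r * hat a b c r)" "pot_class (\<lambda>r. (hat a b c r)\<^sup>2)"
    using hat_support[OF assms(4,5)] assms
    by (auto intro!: pot_class_compact_support[of a c] continuous_intros vc)
  note i = pot_classD(1)[OF c(1)] pot_classD(1)[OF c(2)]
  have e: "(v r + h * hat a b c r)\<^sup>2 = (v r)\<^sup>2 + h * (2 * (v r * hat a b c r) + h * (hat a b c r)\<^sup>2)" for r
    by (simp add: power2_eq_square algebra_simps)
  show "integrable lborel (\<lambda>r. (v r + h * hat a b c r)\<^sup>2)"
    unfolding e by (intro Bochner_Integration.integrable_add integrable_mult_right i assms)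
  have "mass (\<lambda>r. v r + h * hat a b c r) = (\<integral>r. (v r)\<^sup>2 + h * (2 * (v r * hat a b c r) + h * (hat a b c r)\<^sup>2) \<partial>lborel)"
    unfolding mass_def e ..
  also have "\<dots> = mass v + h * (2 * (\<integral>r. v r * hat a b c r \<partial>lborel) + h * mass (hat a b c))"
    unfolding mass_def using i assms(2) by (simp add: Bochner_Integration.integral_add)
  finally show "mass (\<lambda>r. v r + h * hat a b c r) = mass v + 2 * h * (\<integral>r. v r * hat a b c r \<partial>lborel) + h\<^sup>2 * mass (hat a b c)"
    by (simp add: power2_eq_square algebra_simps)
  have "coul (\<lambda>r. 2 * (v r * hat a b c r)) (\<lambda>r. (v r)\<^sup>2) = (\<integral>r. 2 * (v r * hat a b c r * pot (\<lambda>r. (v r)\<^sup>2) r) \<partial>lborel)"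
    unfolding coul_def by (simp add: mult.assoc)
  also have "\<dots> = 2 * (\<integral>r. v r * hat a b c r * pot (\<lambda>r. (v r)\<^sup>2) r \<partial>lborel)"
    by (rule integral_mult_right_zero)
  finally show "coulomb (\<lambda>r. v r + h * hat a b c r) = coulomb v + 2 * h * (2 * (\<integral>r. v r * hat a b c r * pot (\<lambda>r. (v r)\<^sup>2) r \<partial>lborel))
      + h\<^sup>2 * (coul (\<lambda>r. 2 * (v r * hat a b c r)) (\<lambda>r. 2 * (v r * hat a b c r)) + 2 * coul (\<lambda>r. (v r)\<^sup>2) (\<lambda>r. (hat a b c r)\<^sup>2))
      + h ^ 3 * (2 * coul (\<lambda>r. 2 * (v r * hat a b c r)) (\<lambda>r. (hat a b c r)\<^sup>2))
      + h ^ 4 * coul (\<lambda>r. (hat a b c r)\<^sup>2) (\<lambda>r. (hat a b c r)\<^sup>2)"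
    unfolding coulomb_def e coul_quadratic[OF pot_class_square(1)[OF assms(1,2)] pot_class_mult[OF c(1)] c(2)] by simp
qed

section \<open>First variation at a minimiser\<close>

context radial_problem
begin

definition minimiser :: "(real \<Rightarrow> real) \<Rightarrow> real \<Rightarrow> bool" where
  "minimiser v A \<longleftrightarrow> pohozaev v A \<and> (\<forall>v' A'. pohozaev v' A' \<longrightarrow> state_energy v A 1 \<le> state_energy v' A' 1)"

text \<open>
  Since the perturbed fibre has its critical point at some \<open>t\<close> near \<open>1\<close>, minimality compares its energy
  there with that of \<open>v\<close> at \<open>t = 1\<close>, which dominates that of \<open>v\<close> at \<open>t\<close>; so \<open>t\<close> need not be differentiated.
\<close>

lemma minimiser_variation:
  assumes min: "minimiser v A"
    and a: "a 0 = A" "(a has_real_derivative a') (at 0)"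
    and b: "b 0 = coulomb v" "(b has_real_derivative b') (at 0)"
    and c: "c 0 = power_term p v" "(c has_real_derivative c') (at 0)"
    and d: "d 0 = power_term q v" "(d has_real_derivative d') (at 0)"
    and w: "\<forall>\<^sub>F h in at_right 0. state (w h) (a h) \<and> coulomb (w h) = b h \<and>
      power_term p (w h) = c h \<and> power_term q (w h) = d h"
  shows "0 \<le> a' / 2 + b' / 4 + \<nu> / q * d' - c' / p"
proof -
  have neh: "pohozaev v A" using min by (simp add: minimiser_def)
  have st: "state v A" using neh by (simp add: pohozaev_def)
  note v = stateD[OF st]
  have lim: "(f \<longlongrightarrow> f 0) (at_right 0)" if "(f has_real_derivative f') (at 0)" for f f'
    using DERIV_isCont[OF that] by (auto simp: isCont_def intro: filterlim_at_split[THEN iffD1, THEN conjunct2])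
  have fiber_deriv_lim: "((\<lambda>h. fiber_deriv (a h) (b h) (c h) (d h) t) \<longlongrightarrow> state_deriv v A t) (at_right 0)" for t
    unfolding fiber_deriv_def state_deriv_def a(1)[symmetric] b(1)[symmetric] c(1)[symmetric] d(1)[symmetric]
    by (intro tendsto_intros lim[OF a(2)] lim[OF b(2)] lim[OF c(2)] lim[OF d(2)])
  have ps: "0 < t \<Longrightarrow> t < 1 \<Longrightarrow> 0 < state_deriv v A t" "1 < t \<Longrightarrow> state_deriv v A t < 0" for t
    using fiber_deriv_strict[of A "coulomb v" "power_term p v" "power_term q v"] neh v power_term_nonneg
    by (auto simp: pohozaev_def state_deriv_def)
  have "\<exists>h t. 0 < h \<and> h < e \<and> 1 - e \<le> t \<and> t \<le> 1 + e \<and>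
      fiber A (coulomb v) (power_term p v) (power_term q v) t \<le> fiber (a h) (b h) (c h) (d h) t"
    if e: "0 < e" "e < 1" for e
  proof -
    \<comment> \<open>The strict signs of the fibre derivative of \<open>v\<close> on either side of
      1 persist for the perturbed coefficients and trap a critical dilation between
      \<open>1 - e\<close> and \<open>1 + e\<close>.\<close>
    have "\<forall>\<^sub>F h in at_right 0. 0 < fiber_deriv (a h) (b h) (c h) (d h) (1 - e)"
      using ps(1)[of "1 - e"] e by (intro order_tendstoD[OF fiber_deriv_lim]) auto
    moreover have "\<forall>\<^sub>F h in at_right 0. fiber_deriv (a h) (b h) (c h) (d h) (1 + e) < 0"
      using ps(2)[of "1 + e"] e by (intro order_tendstoD[OF fiber_deriv_lim]) auto
    moreover have "\<forall>\<^sub>F h in at_right (0::real). 0 < h \<and> h < e"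
      using eventually_at_right_real[OF e(1)] by (auto elim: eventually_mono)
    ultimately have "\<forall>\<^sub>F h in at_right 0. 0 < fiber_deriv (a h) (b h) (c h) (d h) (1 - e) \<and>
        fiber_deriv (a h) (b h) (c h) (d h) (1 + e) < 0 \<and> 0 < h \<and> h < e \<and> state (w h) (a h) \<and> coulomb (w h) = b h \<and>
      power_term p (w h) = c h \<and> power_term q (w h) = d h" using w by eventually_elim auto
    from eventually_happens'[OF trivial_limit_at_right_real this]
    obtain h where h: "0 < fiber_deriv (a h) (b h) (c h) (d h) (1 - e)"
        "fiber_deriv (a h) (b h) (c h) (d h) (1 + e) < 0" "0 < h" "h < e" "state (w h) (a h)" "coulomb (w h) = b h"
        "power_term p (w h) = c h" "power_term q (w h) = d h" by blast
    obtain t where t: "1 - e \<le> t" "t \<le> 1 + e" "fiber_deriv (a h) (b h) (c h) (d h) t = 0"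
      using fiber_deriv_root_between[of "1 - e" "1 + e"] e h(1,2) by (metis add_increasing2 diff_gt_0_iff_gt less_eq_real_def diff_le_eq)
    have t0: "0 < t" using t e by simp
    have "pohozaev (\<lambda>r. sqrt t * w h (t * r)) (t\<^sup>2 * a h)"
      using state_scale[OF h(5) t0] t(3) h by (simp add: pohozaev_def state_deriv_def)
    then have "state_energy v A 1 \<le> state_energy (w h) (a h) t"
      using min unfolding minimiser_def state_scale(2)[OF h(5) t0, symmetric] by blast
    then have "fiber A (coulomb v) (power_term p v) (power_term q v) t \<le> fiber (a h) (b h) (c h) (d h) t"
      using pohozaev_state_energy_le[OF neh t0] h by (simp add: state_energy_def)
    then show ?thesis using t h by blast
  qed
  \<comment> \<open>The choice \<open>e = 1 / (n + 2)\<close>; the second successor keeps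
    \<open>e\<close> below 1.\<close>
  then have "\<exists>h t. 0 < h \<and> h < 1 / real (Suc (Suc n)) \<and> 1 - 1 / real (Suc (Suc n)) \<le> t \<and> t \<le> 1 + 1 / real (Suc (Suc n)) \<and>
      fiber A (coulomb v) (power_term p v) (power_term q v) t \<le> fiber (a h) (b h) (c h) (d h) t" for n by simp
  then obtain h t where ht: "\<And>n. 0 < h n" "\<And>n. h n < 1 / real (Suc (Suc n))"
      "\<And>n. 1 - 1 / real (Suc (Suc n)) \<le> t n" "\<And>n. t n \<le> 1 + 1 / real (Suc (Suc n))"
      "\<And>n. fiber A (coulomb v) (power_term p v) (power_term q v) (t n) \<le> fiber (a (h n)) (b (h n)) (c (h n)) (d (h n)) (t n)"
    by metis
  have z: "(\<lambda>n. 1 / real (Suc (Suc n))) \<longlonglongrightarrow> 0"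
    using LIMSEQ_Suc[OF LIMSEQ_Suc[OF lim_1_over_n]] by simp
  have h0: "h \<longlonglongrightarrow> 0"
    by (rule tendsto_sandwich[OF _ _ tendsto_const z]) (use ht(1,2) in \<open>auto intro!: always_eventually less_imp_le\<close>)
  have t1: "t \<longlonglongrightarrow> 1"
  proof (rule tendsto_sandwich)
    show "(\<lambda>n. 1 - 1 / real (Suc (Suc n))) \<longlonglongrightarrow> 1" using tendsto_diff[OF tendsto_const z, of 1] by simp
    show "(\<lambda>n. 1 + 1 / real (Suc (Suc n))) \<longlonglongrightarrow> 1" using tendsto_add[OF tendsto_const z, of 1] by simp
  qed (use ht(3,4) in auto)
  have h0': "filterlim h (at 0) sequentially"
    using h0 ht(1) by (auto simp: filterlim_at intro!: always_eventually) (metis less_irrefl)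
  have slope: "(\<lambda>n. (f (h n) - f 0) / h n) \<longlonglongrightarrow> f'" if "(f has_real_derivative f') (at 0)" for f f'
    using filterlim_compose[OF that[unfolded DERIV_def] h0'] by simp
  \<comment> \<open>For fixed \<open>t\<close> the fibre is linear in its four coefficients, so the
    quotient by \<open>h n\<close> splits into separate difference quotients, weighted by powers of
    \<open>t n\<close> that tend to 1.\<close>
  have "0 \<le> (t n)\<^sup>2 / 2 * ((a (h n) - a 0) / h n) + t n / 4 * ((b (h n) - b 0) / h n)
      + \<nu> / q * t n powr sig * ((d (h n) - d 0) / h n) - t n powr tau / p * ((c (h n) - c 0) / h n)" for n
  proof -
    have "0 \<le> (fiber (a (h n)) (b (h n)) (c (h n)) (d (h n)) (t n) - fiber (a 0) (b 0) (c 0) (d 0) (t n)) / h n"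
      using ht(1,5)[of n] unfolding a(1) b(1) c(1) d(1) by simp
    also have "\<dots> = (t n)\<^sup>2 / 2 * ((a (h n) - a 0) / h n) + t n / 4 * ((b (h n) - b 0) / h n)
      + \<nu> / q * t n powr sig * ((d (h n) - d 0) / h n) - t n powr tau / p * ((c (h n) - c 0) / h n)"
      unfolding fiber_def by (simp add: right_diff_distrib diff_divide_distrib add_divide_distrib)
    finally show ?thesis .
  qed
  moreover have "(\<lambda>n. (t n)\<^sup>2 / 2 * ((a (h n) - a 0) / h n) + t n / 4 * ((b (h n) - b 0) / h n)
      + \<nu> / q * t n powr sig * ((d (h n) - d 0) / h n) - t n powr tau / p * ((c (h n) - c 0) / h n))
    \<longlonglongrightarrow> 1\<^sup>2 / 2 * a' + 1 / 4 * b' + \<nu> / q * 1 powr sig * d' - 1 powr tau / p * c'"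
    using p by (intro tendsto_intros t1 slope[OF a(2)] slope[OF b(2)] slope[OF c(2)] slope[OF d(2)]) auto
  ultimately have "0 \<le> 1\<^sup>2 / 2 * a' + 1 / 4 * b' + \<nu> / q * 1 powr sig * d' - 1 powr tau / p * c'"
    by (intro LIMSEQ_le_const) auto
  then show ?thesis by simp
qed

text \<open>If the mass were below \<open>m\<close>, the amplitude could be increased slightly. The
  first variation in this direction is
  \<open>A + coulomb v + \<nu> * power_term q v - power_term p v\<close>, negative by assumption,
  against minimality.\<close>

lemma minimiser_mass:
  assumes min: "minimiser v A"
    and pos: "0 < power_term p v - A - coulomb v - \<nu> * power_term q v"
  shows "mass v = m"
proof (rule ccontr)
  have st: "state v A" using min by (simp add: minimiser_def pohozaev_def)
  note v = stateD[OF st]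
  assume "mass v \<noteq> m"
  then have lt: "mass v < m" using v(3) by simp
  have "((\<lambda>h. (1 + h)\<^sup>2 * mass v) \<longlongrightarrow> (1 + 0)\<^sup>2 * mass v) (at_right 0)" by (intro tendsto_intros)
  then have "\<forall>\<^sub>F h in at_right 0. (1 + h)\<^sup>2 * mass v < m" by (rule order_tendstoD) (use lt in simp)
  moreover have "\<forall>\<^sub>F h in at_right (0::real). 0 < h" by (simp add: eventually_at_filter)
  ultimately have ev: "\<forall>\<^sub>F h in at_right 0. state (\<lambda>r. (1 + h) * v (1 * r)) ((1 + h)\<^sup>2 * 1 * A) \<and>
      coulomb (\<lambda>r. (1 + h) * v (1 * r)) = (1 + h) ^ 4 * coulomb v \<and>
      power_term p (\<lambda>r. (1 + h) * v (1 * r)) = (1 + h) powr p * power_term p v \<and>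
      power_term q (\<lambda>r. (1 + h) * v (1 * r)) = (1 + h) powr q * power_term q v"
  proof eventually_elim
    case (elim h)
    have pt: "power_term e (\<lambda>r. (1 + h) * v (1 * r)) = (1 + h) powr e * power_term e v" for e
      using power_term_scale[of 1 v e "1 + h", OF _ energy_le_zero[OF v(1)]] elim by simp
    have "energy_le (\<lambda>r. (1 + h) * v (1 * r)) ((1 + h)\<^sup>2 * 1 * A)" by (rule energy_le_scale[OF v(1)]) simp
    moreover have "integrable lborel (\<lambda>r. ((1 + h) * v (1 * r))\<^sup>2)" by (rule square_integrable_scale[OF _ v(2)]) simp
    moreover have "mass (\<lambda>r. (1 + h) * v (1 * r)) \<le> m" using mass_scale[of 1 "1 + h" v] elim by simp
    moreover have "0 < power_term p (\<lambda>r. (1 + h) * v (1 * r))" unfolding pt using elim v(4) by simp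
    moreover have "coulomb (\<lambda>r. (1 + h) * v (1 * r)) = (1 + h) ^ 4 * coulomb v"
      using coulomb_scale[of 1 v "1 + h", OF _ energy_le_zero[OF v(1)]] by simp
    ultimately show ?case using pt by (simp add: state_def)
  qed
  have "0 \<le> (2 * A) / 2 + (4 * coulomb v) / 4 + \<nu> / q * (q * power_term q v) - (p * power_term p v) / p"
    by (rule minimiser_variation[OF min _ _ _ _ _ _ _ _ ev]) (auto intro!: derivative_eq_intros)
  then show False using pos p q by simp
qed

text \<open>The value forced by testing the equation with \<open>v\<close> itself when the mass is
  \<open>m\<close>.\<close>

definition multiplier :: "(real \<Rightarrow> real) \<Rightarrow> real \<Rightarrow> real" where
  "multiplier v A = (power_term p v - A - coulomb v - \<nu> * power_term q v) / m"

definition force :: "(real \<Rightarrow> real) \<Rightarrow> real \<Rightarrow> real \<Rightarrow> real" where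
  "force v A r = multiplier v A * v r + pot (\<lambda>r. (v r)\<^sup>2) r * v r
    + \<nu> * (\<bar>v r\<bar> powr (q - 2) * v r * r powr (2 - q)) - \<bar>v r\<bar> powr (p - 2) * v r * r powr (2 - p)"

text \<open>The variation adds \<open>s * h\<close> times a hat and then rescales the amplitude to
  restore mass \<open>m\<close>. The rescaling produces the multiplier term; the two signs of
  \<open>s\<close> turn a one-sided inequality into an equation.\<close>

lemma minimiser_variation_hat:
  assumes min: "minimiser v A" and mass: "mass v = m" and abc: "0 < a" "a < b" "b < c" and s: "s = 1 \<or> s = -1"
  shows "0 \<le> s * ((v b - v a) / (b - a) - (v c - v b) / (c - b) + (\<integral>r. force v A r * hat a b c r \<partial>lborel))"
proof -
  have st: "state v A" using min by (simp add: minimiser_def pohozaev_def)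
  note v = stateD[OF st]
  define \<phi> where "\<phi> = hat a b c"
  define u where "u h r = v r + h * \<phi> r" for h r
  define L where "L = (v b - v a) / (b - a) - (v c - v b) / (c - b)"
  define \<kappa> where "\<kappa> = 1 / (b - a) + 1 / (c - b)"
  define V where "V = (\<integral>r. v r * \<phi> r \<partial>lborel)"
  define Q where "Q = (\<integral>r. v r * \<phi> r * pot (\<lambda>r. (v r)\<^sup>2) r \<partial>lborel)"
  define T where "T e = (\<integral>r. \<bar>v r\<bar> powr (e - 2) * v r * r powr (2 - e) * \<phi> r \<partial>lborel)" for e
  have vc: "continuous_on S v" for S using energy_le_continuous[OF v(1)] continuous_on_subset by blast
  note [continuous_intros] = hat_continuous[OF abc(2,3)]
  have e: "energy_le (u h) (A + 2 * h * L + h\<^sup>2 * \<kappa>)" for h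
    using hat_energy_le[OF v(1) _ abc(2,3), of h] abc(1) unfolding u_def[abs_def] \<phi>_def hat_def L_def \<kappa>_def by simp
  note sq = square_perturb[OF v(1,2) abc, folded \<phi>_def, folded u_def, folded V_def Q_def]
  have i: "integrable lborel (\<lambda>r. (u h r)\<^sup>2)" for h using sq(1)[of h] by (simp add: u_def)
  have um: "mass (u h) = m + 2 * h * V + h\<^sup>2 * mass \<phi>" for h
    using sq(2)[of h] mass by (simp add: u_def[abs_def])
  define M where "M h = m + 2 * (s * h) * V + (s * h)\<^sup>2 * mass \<phi>" for h
  \<comment> \<open>Amplitude restoring mass \<open>m\<close>, with derivative
    \<open>- s * V / m\<close> at 0.\<close>
  define N where "N h = sqrt (m / M h)" for h
  have N0: "N 0 = 1" using m by (simp add: N_def M_def)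
  have Md: "(M has_real_derivative 2 * s * V) (at 0)"
    unfolding M_def by (auto intro!: derivative_eq_intros)
  have Nd: "(N has_real_derivative - s * V / m) (at 0)"
  proof -
    have "((\<lambda>h. m / M h) has_real_derivative - (m * (2 * s * V)) / (M 0 * M 0)) (at 0)"
      using Md m by (auto intro!: derivative_eq_intros simp: M_def)
    then have "((\<lambda>h. sqrt (m / M h)) has_real_derivative
        - (m * (2 * s * V)) / (M 0 * M 0) * (inverse (sqrt (m / M 0)) / 2)) (at 0)"
      by (rule DERIV_chain2[rotated, THEN back_subst[of "\<lambda>d. DERIV _ _ :> d"]])
        (use m in \<open>auto simp: M_def intro!: DERIV_real_sqrt\<close>)
    moreover have "- (m * (2 * s * V)) / (M 0 * M 0) * (inverse (sqrt (m / M 0)) / 2) = - s * V / m"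
      using m by (simp add: M_def field_simps)
    ultimately show ?thesis by (simp add: N_def[abs_def])
  qed
  have Bd: "((\<lambda>h. coulomb (u (s * h))) has_real_derivative s * (4 * Q)) (at 0)"
    unfolding sq(3) by (auto intro!: derivative_eq_intros)
  have Td: "((\<lambda>h. power_term e (u (s * h))) has_real_derivative s * (e * T e)) (at 0)" if "2 < e" "e < 6" for e
  proof -
    have 1: "((\<lambda>h. power_term e (u h)) has_real_derivative e * T e) (at (s * 0))"
      using power_term_perturb[OF v(1,2) that abc] sq(1) unfolding u_def[abs_def] \<phi>_def T_def by simp
    have 2: "((\<lambda>h. s * h) has_real_derivative s) (at 0)" by (auto intro!: derivative_eq_intros)
    have "((\<lambda>h. power_term e (u (s * h))) has_real_derivative e * T e * s) (at 0)"
      by (rule DERIV_chain2[where g="\<lambda>h. s * h" and f="\<lambda>h. power_term e (u h)", OF 1 2])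
    then show ?thesis by (simp add: mult.commute)
  qed
  have u0: "u (s * 0) = v" by (simp add: u_def[abs_def])
  define w where "w h r = N h * u (s * h) (1 * r)" for h r
  have ev0: "\<forall>\<^sub>F h in at_right 0. 0 < f h" if "(f has_real_derivative f') (at 0)" "0 < f 0" for f f'
  proof -
    have "(f \<longlongrightarrow> f 0) (at_right 0)"
      using DERIV_isCont[OF that(1)] unfolding isCont_def filterlim_at_split by blast
    then show ?thesis using that(2) by (rule order_tendstoD(1))
  qed
  have "\<forall>\<^sub>F h in at_right 0. 0 < M h" by (rule ev0[OF Md]) (use m in \<open>simp add: M_def\<close>)
  moreover have "\<forall>\<^sub>F h in at_right 0. 0 < power_term p (u (s * h))"
    by (rule ev0[OF Td]) (use p v(4) u0 in auto)
  ultimately have ev: "\<forall>\<^sub>F h in at_right 0. state (w h) ((N h)\<^sup>2 * 1 * (A + 2 * (s * h) * L + (s * h)\<^sup>2 * \<kappa>)) \<and>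
      coulomb (w h) = (N h) ^ 4 * coulomb (u (s * h)) \<and>
      power_term p (w h) = N h powr p * power_term p (u (s * h)) \<and>
      power_term q (w h) = N h powr q * power_term q (u (s * h))"
  proof eventually_elim
    case (elim h)
    have N: "0 < N h" using elim m by (simp add: N_def)
    have z: "\<And>r. r \<le> 0 \<Longrightarrow> u (s * h) r = 0" by (rule energy_le_zero[OF e])
    have pt: "power_term k (w h) = N h powr k * power_term k (u (s * h))" for k
      using power_term_scale[of 1 "u (s * h)" k "N h", OF _ z] N unfolding w_def[abs_def] by simp
    have "energy_le (w h) ((N h)\<^sup>2 * 1 * (A + 2 * (s * h) * L + (s * h)\<^sup>2 * \<kappa>))"
      unfolding w_def[abs_def] by (rule energy_le_scale[OF e]) simp
    moreover have "integrable lborel (\<lambda>r. (w h r)\<^sup>2)" unfolding w_def by (rule square_integrable_scale[OF _ i]) simp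
    moreover have "mass (w h) = m"
    proof -
      have "mass (w h) = (N h)\<^sup>2 * mass (u (s * h))" unfolding w_def[abs_def] using mass_scale[of 1 "N h" "u (s * h)"] by simp
      also have "mass (u (s * h)) = M h" by (simp add: um M_def)
      finally show ?thesis using elim m by (simp add: N_def)
    qed
    moreover have "0 < power_term p (w h)" unfolding pt using elim N by simp
    moreover have "coulomb (w h) = (N h) ^ 4 * coulomb (u (s * h))"
      unfolding w_def[abs_def] using coulomb_scale[of 1 "u (s * h)" "N h", OF _ z] by simp
    ultimately show ?case using pt by (simp add: state_def)
  qed
  \<comment> \<open>The terms with \<open>V / m\<close> come from the homogeneity degrees 2, 4,
    \<open>q\<close> and \<open>p\<close> of the four terms under the amplitude \<open>N\<close>;
    together they make up \<open>multiplier v A * V\<close>.\<close>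
  have "0 \<le> (2 * s * L - 2 * s * V / m * A) / 2 + (s * (4 * Q) - 4 * s * V / m * coulomb v) / 4
      + \<nu> / q * (s * (q * T q) - q * s * V / m * power_term q v) - (s * (p * T p) - p * s * V / m * power_term p v) / p"
  proof (rule minimiser_variation[OF min _ _ _ _ _ _ _ _ ev])
    show "((\<lambda>h. (N h)\<^sup>2 * 1 * (A + 2 * (s * h) * L + (s * h)\<^sup>2 * \<kappa>)) has_real_derivative (2 * s * L - 2 * s * V / m * A)) (at 0)"
      using Nd by (auto intro!: derivative_eq_intros simp: N0)
    show "((\<lambda>h. N h ^ 4 * coulomb (u (s * h))) has_real_derivative (s * (4 * Q) - 4 * s * V / m * coulomb v)) (at 0)"
      using Nd Bd u0 by (auto intro!: derivative_eq_intros simp: N0)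
    show "((\<lambda>h. N h powr p * power_term p (u (s * h))) has_real_derivative (s * (p * T p) - p * s * V / m * power_term p v)) (at 0)"
      using Nd Td[of p] p u0 by (auto intro!: derivative_eq_intros simp: N0)
    show "((\<lambda>h. N h powr q * power_term q (u (s * h))) has_real_derivative (s * (q * T q) - q * s * V / m * power_term q v)) (at 0)"
      using Nd Td[of q] q u0 by (auto intro!: derivative_eq_intros simp: N0)
  qed (use u0 in \<open>simp_all add: N0\<close>)
  also have "\<dots> = s * (L + (multiplier v A * V + Q + \<nu> * T q - T p))"
    using p q unfolding multiplier_def by (simp add: algebra_simps diff_divide_distrib add_divide_distrib)
  also have "multiplier v A * V + Q + \<nu> * T q - T p = (\<integral>r. force v A r * \<phi> r \<partial>lborel)"
  proof -
    have iv: "integrable lborel (\<lambda>r. v r * \<phi> r)" "integrable lborel (\<lambda>r. v r * \<phi> r * pot (\<lambda>r. (v r)\<^sup>2) r)"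
      using hat_support[OF abc(2,3)] abc unfolding \<phi>_def
      by (auto intro!: integrable_compact_support(1)[of a c] continuous_intros vc
          continuous_on_subset[OF pot_continuous[OF pot_class_square(1)[OF v(1,2)]]])
    have iT: "integrable lborel (\<lambda>r. \<bar>v r\<bar> powr (e - 2) * v r * r powr (2 - e) * \<phi> r)" if "2 < e" for e
      using hat_support[OF abc(2,3)] abc that unfolding \<phi>_def
      by (intro integrable_compact_support(1)[of a c] continuous_intros vc continuous_on_powr') auto
    have "(\<integral>r. force v A r * \<phi> r \<partial>lborel) = (\<integral>r. multiplier v A * (v r * \<phi> r) + v r * \<phi> r * pot (\<lambda>r. (v r)\<^sup>2) r
        + \<nu> * (\<bar>v r\<bar> powr (q - 2) * v r * r powr (2 - q) * \<phi> r) - \<bar>v r\<bar> powr (p - 2) * v r * r powr (2 - p) * \<phi> r \<partial>lborel)"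
      by (intro Bochner_Integration.integral_cong) (auto simp: force_def algebra_simps)
    also have "\<dots> = multiplier v A * V + Q + \<nu> * T q - T p"
      unfolding V_def Q_def T_def using iv iT[of p] iT[of q] p q by simp
    finally show ?thesis by simp
  qed
  finally show ?thesis by (simp add: \<phi>_def L_def)
qed

lemma euler_lagrange_hat:
  assumes "minimiser v A" "mass v = m" "0 < a" "a < b" "b < c"
  shows "(v c - v b) / (c - b) - (v b - v a) / (b - a) = (\<integral>r. force v A r * hat a b c r \<partial>lborel)"
  using minimiser_variation_hat[OF assms, of 1] minimiser_variation_hat[OF assms, of "- 1"] by simp

end

section \<open>Regularity and behaviour near the origin\<close>

lemma derivative_dominated:
  fixes f g :: "real \<Rightarrow> real"
  assumes "a \<le> b"
    and "\<And>x. a \<le> x \<Longrightarrow> x \<le> b \<Longrightarrow> (f has_real_derivative f' x) (at x)"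
    and "\<And>x. a \<le> x \<Longrightarrow> x \<le> b \<Longrightarrow> (g has_real_derivative g' x) (at x)"
    and "\<And>x. a \<le> x \<Longrightarrow> x \<le> b \<Longrightarrow> \<bar>f' x\<bar> \<le> g' x"
  shows "\<bar>f b - f a\<bar> \<le> g b - g a"
proof -
  have "(\<lambda>x. g x - f x) a \<le> (\<lambda>x. g x - f x) b"
  proof (rule DERIV_nonneg_imp_nondecreasing[OF assms(1)])
    fix x assume x: "a \<le> x" "x \<le> b"
    show "\<exists>y. ((\<lambda>x. g x - f x) has_real_derivative y) (at x) \<and> 0 \<le> y"
      using DERIV_diff[OF assms(3)[OF x] assms(2)[OF x]] assms(4)[OF x] by (intro exI conjI) auto
  qed
  moreover have "(\<lambda>x. g x + f x) a \<le> (\<lambda>x. g x + f x) b"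
  proof (rule DERIV_nonneg_imp_nondecreasing[OF assms(1)])
    fix x assume x: "a \<le> x" "x \<le> b"
    show "\<exists>y. ((\<lambda>x. g x + f x) has_real_derivative y) (at x) \<and> 0 \<le> y"
      using DERIV_add[OF assms(3)[OF x] assms(2)[OF x]] assms(4)[OF x] by (intro exI conjI) auto
  qed
  ultimately show ?thesis by auto
qed

lemma antiderivative_pos:
  fixes f :: "real \<Rightarrow> real"
  assumes "continuous_on {0<..} f"
  obtains F where "\<And>r. 0 < r \<Longrightarrow> (F has_real_derivative f r) (at r)"
proof -
  have "isCont f x" if "0 < x" for x
    using assms that by (simp add: continuous_on_eq_continuous_at)
  then obtain F where "\<And>x::real. 0 < ereal x \<Longrightarrow> ereal x < \<infinity> \<Longrightarrow> (F has_vector_derivative f x) (at x)"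
    using einterval_antiderivative[of 0 \<infinity> f] by (auto simp: zero_ereal_def)
  then show thesis using that by (auto simp: has_real_derivative_iff_has_vector_derivative)
qed

text \<open>Two integrations by parts: the second derivative of the hat consists of point masses at
  \<open>a\<close>, \<open>b\<close>, \<open>c\<close>, which leaves a second difference of the
  double antiderivative \<open>W\<close>.\<close>

lemma hat_integral:
  fixes F :: "real \<Rightarrow> real"
  assumes "continuous_on {0<..} F" "\<And>r. 0 < r \<Longrightarrow> (W1 has_real_derivative F r) (at r)"
    and "\<And>r. 0 < r \<Longrightarrow> (W has_real_derivative W1 r) (at r)" "0 < a" "a < b" "b < c"
  shows "(\<integral>r. F r * hat a b c r \<partial>lborel) = (W c - W b) / (c - b) - (W b - W a) / (b - a)"
proof -
  note [continuous_intros] = hat_continuous[OF assms(5,6)]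
  have 1: "((\<lambda>r. F r * hat a b c r) has_integral
      ((W1 b * (b - a) - W b) / (b - a) - (W1 a * (a - a) - W a) / (b - a))) {a..b}"
  proof (rule fundamental_theorem_of_calculus)
    fix x assume x: "x \<in> {a..b}"
    \<comment> \<open>On the rising part the hat is \<open>(r - a) / (b - a)\<close>, and this is an
      explicit antiderivative of the product.\<close>
    have "((\<lambda>r. (W1 r * (r - a) - W r) / (b - a)) has_real_derivative F x * hat a b c x) (at x)"
      using x assms(4-6) by (auto intro!: derivative_eq_intros assms(2,3) simp: hat_def)
    then show "((\<lambda>r. (W1 r * (r - a) - W r) / (b - a)) has_vector_derivative F x * hat a b c x) (at x within {a..b})"
      by (simp add: has_field_derivative_at_within flip: has_real_derivative_iff_has_vector_derivative)
  qed (use assms in simp)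
  have 2: "((\<lambda>r. F r * hat a b c r) has_integral
      ((W1 c * (c - c) + W c) / (c - b) - (W1 b * (c - b) + W b) / (c - b))) {b..c}"
  proof (rule fundamental_theorem_of_calculus)
    fix x assume x: "x \<in> {b..c}"
    have h: "hat a b c x = (c - x) / (c - b)" using x assms(5,6) by (simp add: hat_def field_simps)
    have "((\<lambda>r. (W1 r * (c - r) + W r) / (c - b)) has_real_derivative F x * hat a b c x) (at x)"
      unfolding h using x assms(4-6) by (auto intro!: derivative_eq_intros assms(2,3))
    then show "((\<lambda>r. (W1 r * (c - r) + W r) / (c - b)) has_vector_derivative F x * hat a b c x) (at x within {b..c})"
      by (simp add: has_field_derivative_at_within flip: has_real_derivative_iff_has_vector_derivative)
  qed (use assms in simp)
  have "((\<lambda>r. F r * hat a b c r) has_integral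
      ((W1 b * (b - a) - W b) / (b - a) - (W1 a * (a - a) - W a) / (b - a)) +
      ((W1 c * (c - c) + W c) / (c - b) - (W1 b * (c - b) + W b) / (c - b))) {a..c}"
    using assms by (intro has_integral_combine[OF _ _ 1 2]) auto
  then have "integral {a..c} (\<lambda>r. F r * hat a b c r) =
      ((W1 b * (b - a) - W b) / (b - a) - (W1 a * (a - a) - W a) / (b - a)) +
      ((W1 c * (c - c) + W c) / (c - b) - (W1 b * (c - b) + W b) / (c - b))" by (rule integral_unique)
  also have "\<dots> = (W c - W b) / (c - b) - (W b - W a) / (b - a)"
    using assms by (simp add: diff_divide_distrib add_divide_distrib)
  finally show ?thesis
    using assms hat_support[OF assms(5,6)]
    by (subst integrable_compact_support(2)[of a c, symmetric])
      (auto intro!: continuous_intros continuous_on_subset[OF assms(1)])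
qed

text \<open>A double antiderivative \<open>W\<close> of \<open>F\<close> satisfies the same
  identity, so \<open>v - W\<close> has equal slopes on adjacent intervals and is affine.
  Differentiability of \<open>v\<close> is a conclusion, not an assumption.\<close>

lemma hat_identity_C2:
  fixes v F :: "real \<Rightarrow> real"
  assumes "continuous_on {0<..} F"
    and eq: "\<And>a b c. 0 < a \<Longrightarrow> a < b \<Longrightarrow> b < c \<Longrightarrow>
      (v c - v b) / (c - b) - (v b - v a) / (b - a) = (\<integral>r. F r * hat a b c r \<partial>lborel)"
  obtains v' where "\<And>r. 0 < r \<Longrightarrow> (v has_real_derivative v' r) (at r)"
    "\<And>r. 0 < r \<Longrightarrow> (v' has_real_derivative F r) (at r)"
proof -
  obtain W1 where W1: "\<And>r. 0 < r \<Longrightarrow> (W1 has_real_derivative F r) (at r)"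
    using antiderivative_pos[OF assms(1)] by blast
  have "continuous_on {0<..} W1" using W1 by (meson DERIV_atLeastAtMost_imp_continuous_on DERIV_isCont continuous_at_imp_continuous_on greaterThan_iff)
  then obtain W where W: "\<And>r. 0 < r \<Longrightarrow> (W has_real_derivative W1 r) (at r)"
    using antiderivative_pos by blast
  define Z where "Z r = v r - W r" for r
  have Z: "(Z c - Z b) / (c - b) = (Z b - Z a) / (b - a)" if "0 < a" "a < b" "b < c" for a b c
    using eq[OF that] hat_integral[OF assms(1) W1 W that] by (simp add: Z_def diff_divide_distrib)
  define s where "s = Z 2 - Z 1"
  have aff: "v r = W r + (Z 1 + (r - 1) * s)" if "0 < r" for r
  proof -
    consider "r < 1" | "r = 1" | "1 < r" "r < 2" | "r = 2" | "2 < r" by linarith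
    then have "Z r = Z 1 + (r - 1) * s"
    proof cases
      case 1 then show ?thesis using Z[OF that, of 1 2] by (simp add: s_def field_simps)
    next
      case 3
      then have "(Z 2 - Z r) * (r - 1) = (Z r - Z 1) * (2 - r)"
        using Z[of 1 r 2] by (simp add: divide_eq_eq eq_divide_eq mult.commute)
      then show ?thesis by (simp add: s_def algebra_simps)
    next
      case 5
      then have "Z r - Z 2 = (Z 2 - Z 1) * (r - 2)"
        using Z[of 1 2 r] by (simp add: divide_eq_eq)
      then show ?thesis by (simp add: s_def algebra_simps)
    qed (auto simp: s_def)
    then show ?thesis by (simp add: Z_def)
  qed
  show thesis
  proof
    fix r :: real assume r: "0 < r"
    have ev: "\<forall>\<^sub>F y in nhds r. v y = W y + (Z 1 + (y - 1) * s)"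
      using eventually_nhds_in_open[of "{0<..}" r] r aff by (auto elim!: eventually_mono)
    have "((\<lambda>y. W y + (Z 1 + (y - 1) * s)) has_real_derivative W1 r + s) (at r)"
      using W[OF r] by (auto intro!: derivative_eq_intros)
    then show "(v has_real_derivative (\<lambda>r. W1 r + s) r) (at r)"
      unfolding DERIV_cong_ev[OF refl ev refl] by simp
    show "((\<lambda>r. W1 r + s) has_real_derivative F r) (at r)"
      using W1[OF r] by (auto intro!: derivative_eq_intros)
  qed
qed

text \<open>Returns from the derivative-free encoding to the integral of \<open>v'\<^sup>2\<close>.
  On short intervals the mean value theorem identifies \<open>(v t - v s)\<^sup>2 / (t - s)\<close>
  with the integral up to \<open>e * (t - s)\<close>, and these errors add up to
  \<open>e * (b - a)\<close>.\<close>

lemma energy_le_derivative_square: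
  assumes "energy_le v A" "\<And>r. 0 < r \<Longrightarrow> (v has_real_derivative v' r) (at r)"
    "continuous_on {0<..} v'" "0 < a" "a \<le> b"
  shows "integral {a..b} (\<lambda>r. (v' r)\<^sup>2) \<le> A"
proof -
  obtain G where G: "\<And>s t. s < t \<Longrightarrow> G s + (v t - v s)\<^sup>2 / (t - s) \<le> G t"
      "\<And>t. 0 \<le> G t" "\<And>t. G t \<le> A"
    using assms(1) by (rule energy_leE) blast
  have c: "continuous_on {s..t} (\<lambda>r. (v' r)\<^sup>2)" if "0 < s" for s t
    using that by (intro continuous_intros continuous_on_subset[OF assms(3)]) auto
  have *: "integral {a..b} (\<lambda>r. (v' r)\<^sup>2) \<le> G b - G a + e * (b - a)" if e: "0 < e" for e
  proof -
    \<comment> \<open>Subintervals in the local step of the Bolzano induction may reach to the left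
      of the original interval, so positivity of the left end is part of the predicate.\<close>
    have "0 < a \<longrightarrow> integral {a..b} (\<lambda>r. (v' r)\<^sup>2) \<le> G b - G a + e * (b - a)"
      using assms(5)
    proof (induction rule: Bolzano)
      case (trans s t u)
      show ?case
      proof
        assume s: "0 < s"
        have "integral {s..u} (\<lambda>r. (v' r)\<^sup>2) = integral {s..t} (\<lambda>r. (v' r)\<^sup>2) + integral {t..u} (\<lambda>r. (v' r)\<^sup>2)"
          using trans s by (intro Henstock_Kurzweil_Integration.integral_combine[symmetric] integrable_continuous_interval c) auto
        then show "integral {s..u} (\<lambda>r. (v' r)\<^sup>2) \<le> G u - G s + e * (u - s)"
          using trans s by (simp add: algebra_simps)
      qed
    next
      case (local x)
      then have x: "0 < x" using assms(4) by simp
      have "isCont (\<lambda>r. (v' r)\<^sup>2) x"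
        using assms(3) x by (intro continuous_intros) (simp add: continuous_on_eq_continuous_at)
      then obtain d where d: "0 < d" "\<And>r. \<bar>r - x\<bar> < d \<Longrightarrow> \<bar>(v' r)\<^sup>2 - (v' x)\<^sup>2\<bar> < e / 2"
        unfolding continuous_at_eps_delta using e by (metis dist_real_def half_gt_zero)
      have "0 < s \<Longrightarrow> integral {s..t} (\<lambda>r. (v' r)\<^sup>2) \<le> G t - G s + e * (t - s)"
        if st: "s \<le> x" "x \<le> t" "t - s < d" for s t
      proof (cases "s = t")
        case False
        assume s: "0 < s"
        have lt: "s < t" using False st by simp
        have near: "\<bar>(v' r)\<^sup>2 - (v' x)\<^sup>2\<bar> < e / 2" if "s \<le> r" "r \<le> t" for r
          using d(2)[of r] st that by auto
        have "integral {s..t} (\<lambda>r. (v' r)\<^sup>2) \<le> integral {s..t} (\<lambda>r. (v' x)\<^sup>2 + e / 2)"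
        proof (intro integral_le integrable_continuous_interval c s continuous_on_const)
          show "(v' r)\<^sup>2 \<le> (v' x)\<^sup>2 + e / 2" if "r \<in> {s..t}" for r
          proof -
            have "(v' r)\<^sup>2 - (v' x)\<^sup>2 \<le> \<bar>(v' r)\<^sup>2 - (v' x)\<^sup>2\<bar>" by (rule abs_ge_self)
            also have "\<dots> < e / 2" using near[of r] that by simp
            finally show ?thesis by simp
          qed
        qed
        also have "\<dots> = ((v' x)\<^sup>2 + e / 2) * (t - s)" using lt by simp
        finally have 1: "integral {s..t} (\<lambda>r. (v' r)\<^sup>2) \<le> ((v' x)\<^sup>2 + e / 2) * (t - s)" .
        obtain z where z: "s < z" "z < t" "v t - v s = (t - s) * v' z"
          using MVT2[OF lt, of v v'] assms(2) s by (metis less_le_trans)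
        have "((v' x)\<^sup>2 - e / 2) * (t - s) \<le> (v' z)\<^sup>2 * (t - s)"
        proof (rule mult_right_mono)
          have "(v' x)\<^sup>2 - (v' z)\<^sup>2 \<le> \<bar>(v' z)\<^sup>2 - (v' x)\<^sup>2\<bar>" by linarith
          also have "\<dots> < e / 2" using near[of z] z by simp
          finally show "(v' x)\<^sup>2 - e / 2 \<le> (v' z)\<^sup>2" by simp
        qed (use lt in simp)
        also have "\<dots> = (v t - v s)\<^sup>2 / (t - s)"
          using lt unfolding z(3) by (simp add: power_mult_distrib power2_eq_square)
        also have "\<dots> \<le> G t - G s" using G(1)[OF lt] by simp
        finally have "((v' x)\<^sup>2 - e / 2) * (t - s) \<le> G t - G s" .
        moreover have "((v' x)\<^sup>2 + e / 2) * (t - s) = ((v' x)\<^sup>2 - e / 2) * (t - s) + e * (t - s)"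
          by (simp add: left_diff_distrib distrib_right)
        ultimately show ?thesis using 1 by linarith
      qed simp
      then show ?case using d(1) by blast
    qed
    then show ?thesis using assms(4) by blast
  qed
  have "integral {a..b} (\<lambda>r. (v' r)\<^sup>2) \<le> G b - G a + 0"
  proof (rule field_le_epsilon)
    fix e :: real assume e: "0 < e"
    have "e / (b - a + 1) * (b - a) \<le> e" using e assms(5) by (simp add: field_simps)
    then show "integral {a..b} (\<lambda>r. (v' r)\<^sup>2) \<le> G b - G a + 0 + e"
      using *[of "e / (b - a + 1)"] e assms(5) by (simp add: add_nonneg_pos)
  qed
  then show ?thesis using G(2)[of a] G(3)[of b] by simp
qed

lemma energy_le_derivative_square_integrable:
  assumes "energy_le v A" "\<And>r. 0 < r \<Longrightarrow> (v has_real_derivative v' r) (at r)"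
    "continuous_on {0<..} v'"
  shows "integrable lborel (\<lambda>r. indicator {0<..} r * (v' r)\<^sup>2)"
proof -
  define I where "I n = {1 / real (Suc n)..real (Suc n)}" for n
  have m: "(\<lambda>r. indicator {0<..} r * (v' r)\<^sup>2) \<in> borel_measurable borel"
    using borel_measurable_continuous_on_indicator[of "{0<..}" "\<lambda>r. (v' r)\<^sup>2"] assms(3)
    by (simp add: continuous_on_power)
  have inc: "incseq I"
    unfolding I_def by (intro monoI) (auto simp: frac_le)
  have un: "(\<Union>n. I n) = {0<..}"
  proof (intro set_eqI iffI)
    fix x :: real assume "x \<in> {0<..}"
    then have x: "0 < x" by simp
    obtain n where n: "max x (1 / x) < real n" using reals_Archimedean2 by blast
    then have "1 / real (Suc n) \<le> x" using x by (simp add: field_simps)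
    then show "x \<in> (\<Union>n. I n)" using n by (auto simp: I_def intro!: exI[of _ n])
  qed (auto simp: I_def intro: less_le_trans[rotated])
  have nn: "(\<integral>\<^sup>+r. ennreal (indicator (I n) r * (v' r)\<^sup>2) \<partial>lborel) \<le> ennreal A" for n
  proof -
    have c: "continuous_on (I n) (\<lambda>r. (v' r)\<^sup>2)" unfolding I_def
      by (intro continuous_intros continuous_on_subset[OF assms(3)]) (auto intro: less_le_trans[rotated])
    have s: "set_integrable lborel (I n) (\<lambda>r. (v' r)\<^sup>2)"
      using c unfolding I_def by (rule borel_integrable_atLeastAtMost')
    then have "(\<integral>\<^sup>+r. ennreal (indicator (I n) r * (v' r)\<^sup>2) \<partial>lborel) = ennreal (\<integral>r. indicator (I n) r * (v' r)\<^sup>2 \<partial>lborel)"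
      unfolding set_integrable_def by (intro nn_integral_eq_integral) auto
    also have "(\<integral>r. indicator (I n) r * (v' r)\<^sup>2 \<partial>lborel) = integral (I n) (\<lambda>r. (v' r)\<^sup>2)"
      using set_borel_integral_eq_integral(2)[OF s] by (simp add: set_lebesgue_integral_def)
    also have "\<dots> \<le> A" unfolding I_def
      by (rule energy_le_derivative_square[OF assms]) (auto simp: field_simps)
    finally show ?thesis by (simp add: ennreal_leI)
  qed
  have "(\<lambda>n. \<integral>\<^sup>+r. ennreal (indicator (I n) r * (v' r)\<^sup>2) \<partial>lborel) \<longlonglongrightarrow> (\<integral>\<^sup>+r. ennreal (indicator {0<..} r * (v' r)\<^sup>2) \<partial>lborel)"
  proof (rule nn_integral_LIMSEQ)
    show "(\<lambda>r. ennreal (indicator (I n) r * (v' r)\<^sup>2)) \<in> borel_measurable lborel" for n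
    proof -
      have "(\<lambda>r. indicator (I n) r * (indicator {0<..} r * (v' r)\<^sup>2)) \<in> borel_measurable borel"
        using m unfolding I_def by measurable
      moreover have "(\<lambda>r. indicator (I n) r * (indicator {0<..} r * (v' r)\<^sup>2)) = (\<lambda>r. indicator (I n) r * (v' r)\<^sup>2)"
      proof
        fix r
        have "r \<in> I n \<Longrightarrow> r \<in> {0<..}" using un by blast
        then show "indicator (I n) r * (indicator {0<..} r * (v' r)\<^sup>2) = indicator (I n) r * (v' r)\<^sup>2"
          by (cases "r \<in> I n") auto
      qed
      ultimately show ?thesis by simp
    qed
    show "incseq (\<lambda>n r. ennreal (indicator (I n) r * (v' r)\<^sup>2))"
      using inc by (auto simp: incseq_def le_fun_def indicator_def intro!: ennreal_leI)
    show "(\<lambda>n. ennreal (indicator (I n) r * (v' r)\<^sup>2)) \<longlonglongrightarrow> ennreal (indicator {0<..} r * (v' r)\<^sup>2)" for r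
      using LIMSEQ_indicator_incseq[OF inc, of r] unfolding un
      by (intro tendsto_ennrealI tendsto_mult_right)
  qed
  then have "(\<integral>\<^sup>+r. ennreal (indicator {0<..} r * (v' r)\<^sup>2) \<partial>lborel) \<le> ennreal A"
    using nn by (intro LIMSEQ_le_const2) auto
  then show ?thesis
    using m by (intro integrableI_nonneg) (auto intro: le_less_trans)
qed


section \<open>Positivity of the multiplier for small mass\<close>

context radial_problem
begin

lemma multiplier_numerator_pos:
  assumes neh: "pohozaev v A" and m1: "m \<le> 1" and A1: "1 \<le> A"
    and big: "(8 * pi + \<nu> * (1 / (3 - q / 2) + 16 powr ((q - 2) / 4))) / (p / tau - 1) < sqrt A"
  shows "0 < power_term p v - A - coulomb v - \<nu> * power_term q v"
proof -
  have st: "state v A" using neh by (simp add: pohozaev_def)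
  note v = stateD[OF st]
  define K where "K = 1 / (3 - q / 2) + 16 powr ((q - 2) / 4)"
  have K: "0 \<le> K" using q by (simp add: K_def)
  have c: "0 < p / tau - 1" using tau by (simp add: field_simps)
  have e: "A + coulomb v / 4 + \<nu> * sig / q * power_term q v = tau / p * power_term p v"
    using neh by (simp add: pohozaev_def state_deriv_def fiber_deriv_def)
  have pos: "0 \<le> \<nu> * sig / q * power_term q v" using nu sig q power_term_nonneg by auto
  have "p / tau * A \<le> p / tau * (tau / p * power_term p v)"
    unfolding e[symmetric] using pos v(6) p tau by (intro mult_left_mono) auto
  also have "\<dots> = power_term p v" using p tau by simp
  finally have C: "p / tau * A \<le> power_term p v" .
  have M: "0 \<le> mass v" "mass v \<le> 1" using mass_nonneg v(3) m1 by auto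
  have "coulomb v \<le> 8 * pi * mass v * sqrt (mass v * A)" by (rule coulomb_le[OF v(1,2)])
  also have "\<dots> \<le> 8 * pi * 1 * sqrt (1 * A)"
    using M v(5) by (intro mult_mono real_sqrt_le_mono mult_right_mono) auto
  finally have B: "coulomb v \<le> 8 * pi * sqrt A" by simp
  have "power_term q v \<le> K * m powr ((6 - q) / 4) * A powr (3 * (q - 2) / 4)"
    unfolding K_def using q by (intro power_term_le[OF st]) auto
  \<comment> \<open>Here \<open>q < 8 / 3\<close> enters:
    \<open>3 * (q - 2) / 4 \<le> 1 / 2\<close>, so \<open>1 \<le> A\<close> reduces the
    \<open>q\<close>-term to order \<open>sqrt A\<close>, like the Coulomb term.\<close>
  also have "\<dots> \<le> K * 1 * A powr (1 / 2)"
    using K m m1 q A1 by (intro mult_mono powr_mono powr_le1) auto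
  also have "\<dots> = K * sqrt A" using v(5) by (simp add: powr_half_sqrt)
  finally have "\<nu> * power_term q v \<le> \<nu> * (K * sqrt A)" using nu by (rule mult_left_mono)
  then have "coulomb v + \<nu> * power_term q v \<le> (8 * pi + \<nu> * K) * sqrt A"
    using B by (simp add: algebra_simps)
  also have "\<dots> < (p / tau - 1) * sqrt A * sqrt A"
    using big c v(5) unfolding K_def[symmetric] by (intro mult_strict_right_mono) (simp_all add: pos_divide_less_eq mult.commute)
  also have "\<dots> = p / tau * A - A" using v(5) by (simp add: mult.assoc left_diff_distrib)
  finally show ?thesis using C by linarith
qed

end

text \<open>The gap depends on \<open>m\<close> only through a negative power of it, so below an
  explicit \<open>m\<close> it exceeds any prescribed size of the gradient term.\<close>

lemma small_mass:
  fixes p q \<nu> :: real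
  assumes "10 / 3 < p" "p < 6" "2 < q" "q < 8 / 3" "0 \<le> \<nu>"
  obtains m\<^sub>0 where "0 < m\<^sub>0" "\<And>m v A. 0 < m \<Longrightarrow> m < m\<^sub>0 \<Longrightarrow> radial_problem.pohozaev p q \<nu> m v A \<Longrightarrow>
    0 < power_term p v - A - coulomb v - \<nu> * power_term q v"
proof -
  \<comment> \<open>An instance with auxiliary mass 1 gives access to \<open>tau\<close>, whose
    value does not depend on the mass.\<close>
  interpret one: radial_problem p q \<nu> 1 using assms by unfold_locales auto
  define c where "c = (8 * pi + \<nu> * (1 / (3 - q / 2) + 16 powr ((q - 2) / 4))) / (p / one.tau - 1)"
  \<comment> \<open>From this size on, both \<open>1 \<le> A\<close> and \<open>c < sqrt A\<close>
    hold.\<close>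
  define A1 where "A1 = max 1 ((\<bar>c\<bar> + 1)\<^sup>2)"
  define K where "K = one.tau / p * (1 / (3 - p / 2) + 16 powr ((p - 2) / 4))"
  define \<beta> where "\<beta> = (6 - p) / 4"
  define \<gamma> where "\<gamma> = one.tau / 2 - 1"
  \<comment> \<open>Solves "gap equals \<open>A1\<close>" for the mass.\<close>
  define m0 where "m0 = min 1 ((1 / (K * A1 powr \<gamma>)) powr (1 / \<beta>))"
  have "0 < 1 / (3 - p / 2) + 16 powr ((p - 2) / 4)" using assms by (intro add_pos_pos) auto
  then have K: "0 < K" using assms one.tau by (simp add: K_def)
  have b: "0 < \<beta>" "0 < \<gamma>" using assms one.tau by (auto simp: \<beta>_def \<gamma>_def)
  have A1: "1 \<le> A1" "(\<bar>c\<bar> + 1)\<^sup>2 \<le> A1" by (auto simp: A1_def)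
  have m0: "0 < m0" using K A1 by (simp add: m0_def)
  show thesis
  proof (rule that[OF m0])
    fix m v A assume m: "0 < m" "m < m0" and neh: "radial_problem.pohozaev p q \<nu> m v A"
    interpret r: radial_problem p q \<nu> m using assms m by unfold_locales auto
    have m1: "m \<le> 1" using m by (simp add: m0_def)
    have "m powr \<beta> \<le> ((1 / (K * A1 powr \<gamma>)) powr (1 / \<beta>)) powr \<beta>"
      using m b by (intro powr_mono2) (auto simp: m0_def)
    also have "\<dots> = 1 / (K * A1 powr \<gamma>)" using b K A1 by (simp add: powr_powr)
    finally have "A1 powr \<gamma> \<le> 1 / (K * m powr \<beta>)" using K A1 m by (simp add: field_simps)
    then have "(A1 powr \<gamma>) powr (1 / \<gamma>) \<le> (1 / (K * m powr \<beta>)) powr (1 / \<gamma>)"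
      using b by (intro powr_mono2) auto
    also have "(A1 powr \<gamma>) powr (1 / \<gamma>) = A1" using b A1 by (simp add: powr_powr)
    also have "(1 / (K * m powr \<beta>)) powr (1 / \<gamma>) = r.gap"
      by (simp add: r.gap_def K_def \<beta>_def \<gamma>_def r.tau_def one.tau_def)
    finally have AA: "A1 \<le> A" using r.pohozaev_gap[OF neh] by simp
    have "\<bar>c\<bar> + 1 \<le> sqrt A" using AA A1 by (intro real_le_rsqrt) auto
    then have "c < sqrt A" by linarith
    then show "0 < power_term p v - A - coulomb v - \<nu> * power_term q v"
      using AA A1 m1 unfolding c_def
      by (intro r.multiplier_numerator_pos[OF neh]) (auto simp: r.tau_def one.tau_def)
  qed
qed

section \<open>The radial equation and the decay of its solution at the origin\<close>

definition radial_force :: "real \<Rightarrow> real \<Rightarrow> real \<Rightarrow> real \<Rightarrow> (real \<Rightarrow> real) \<Rightarrow> real \<Rightarrow> real" where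
  "radial_force p q \<nu> \<Lambda> v r = \<Lambda> * v r + pot (\<lambda>r. (v r)\<^sup>2) r * v r
    + \<nu> * (\<bar>v r\<bar> powr (q - 2) * v r * r powr (2 - q)) - \<bar>v r\<bar> powr (p - 2) * v r * r powr (2 - p)"

lemma radial_force_continuous:
  assumes "energy_le v A" "integrable lborel (\<lambda>r. (v r)\<^sup>2)" "2 < p" "2 < q"
  shows "continuous_on {0<..} (radial_force p q \<nu> \<Lambda> v)"
proof -
  have vc: "continuous_on S v" for S using energy_le_continuous[OF assms(1)] continuous_on_subset by blast
  have pt: "continuous_on {0<..} (\<lambda>r. \<bar>v r\<bar> powr (e - 2) * v r * r powr (2 - e))" if "2 < e" for e
    using that by (intro continuous_on_mult continuous_on_powr' continuous_on_rabs vc continuous_intros) auto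
  show ?thesis unfolding radial_force_def
    by (intro continuous_on_add continuous_on_diff continuous_on_mult continuous_on_const vc pt assms
        pot_continuous pot_class_square(1)[OF assms(1,2)])
qed

lemma radial_solution:
  fixes p q \<nu> :: real
  assumes "10 / 3 < p" "p < 6" "2 < q" "q < 8 / 3" "0 \<le> \<nu>"
  obtains m\<^sub>0 where "0 < m\<^sub>0" "\<And>m. 0 < m \<Longrightarrow> m < m\<^sub>0 \<Longrightarrow>
    \<exists>v v' A \<Lambda>. 0 < \<Lambda> \<and> energy_le v A \<and> integrable lborel (\<lambda>r. (v r)\<^sup>2) \<and> mass v = m \<and>
      (\<forall>r>0. (v has_real_derivative v' r) (at r)) \<and>
      (\<forall>r>0. (v' has_real_derivative radial_force p q \<nu> \<Lambda> v r) (at r))"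
proof -
  obtain m0 where m0: "0 < m0" "\<And>m v A. 0 < m \<Longrightarrow> m < m0 \<Longrightarrow> radial_problem.pohozaev p q \<nu> m v A \<Longrightarrow>
    0 < power_term p v - A - coulomb v - \<nu> * power_term q v"
    using small_mass[OF assms] by blast
  show thesis
  proof (rule that[OF m0(1)])
    fix m assume mm: "0 < m" "m < m0"
    interpret radial_problem p q \<nu> m using assms mm by unfold_locales auto
    obtain v A where min: "minimiser v A" using minimiser_exists unfolding minimiser_def by metis
    have neh: "pohozaev v A" using min by (simp add: minimiser_def)
    note v = stateD[OF neh[unfolded pohozaev_def, THEN conjunct1]]
    have pos: "0 < power_term p v - A - coulomb v - \<nu> * power_term q v" by (rule m0(2)[OF mm neh])
    have mass: "mass v = m" by (rule minimiser_mass[OF min pos])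
    have f: "force v A = radial_force p q \<nu> (multiplier v A) v"
      by (rule ext) (simp add: force_def radial_force_def)
    have cont: "continuous_on {0<..} (force v A)"
      unfolding f using p q by (intro radial_force_continuous[OF v(1,2)]) auto
    obtain v' where "\<And>r. 0 < r \<Longrightarrow> (v has_real_derivative v' r) (at r)"
      "\<And>r. 0 < r \<Longrightarrow> (v' has_real_derivative force v A r) (at r)"
    proof (rule hat_identity_C2[OF cont])
      show "(v c - v b) / (c - b) - (v b - v a) / (b - a) = (\<integral>r. force v A r * hat a b c r \<partial>lborel)"
        if "0 < a" "a < b" "b < c" for a b c by (rule euler_lagrange_hat[OF min mass that])
    qed blast
    moreover have "0 < multiplier v A" using pos m by (simp add: multiplier_def)
    ultimately show "\<exists>v v' A \<Lambda>. 0 < \<Lambda> \<and> energy_le v A \<and> integrable lborel (\<lambda>r. (v r)\<^sup>2) \<and> mass v = m \<and>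
      (\<forall>r>0. (v has_real_derivative v' r) (at r)) \<and>
      (\<forall>r>0. (v' has_real_derivative radial_force p q \<nu> \<Lambda> v r) (at r))"
      using v(1,2) mass unfolding f by blast
  qed
qed

text \<open>The most singular term is the \<open>p\<close>-term: with
  \<open>v\<^sup>2 \<le> A * r\<close> it is of order \<open>r powr ((3 - p) / 2)\<close>, which
  explains the second condition on \<theta>. The other terms stay bounded near the origin.\<close>

lemma radial_force_near_0:
  assumes v: "energy_le v A" "integrable lborel (\<lambda>r. (v r)\<^sup>2)" and "10 / 3 < p" "p < 6" "2 < q" "q < 8 / 3"
    and \<theta>: "1 < \<theta>" "(p - 3) / 2 \<le> \<theta>"
  obtains C where "0 \<le> C" "\<And>r. 0 < r \<Longrightarrow> r \<le> 1 \<Longrightarrow> \<bar>radial_force p q \<nu> \<Lambda> v r\<bar> \<le> C * r powr (- \<theta>)"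
proof -
  define P where "P = 4 * pi * (\<integral>s. \<bar>(v s)\<^sup>2 / s\<bar> \<partial>lborel)"
  have P: "\<bar>pot (\<lambda>r. (v r)\<^sup>2) r\<bar> \<le> P" for r
    unfolding P_def by (rule pot_le[OF pot_class_square(1)[OF v]])
  have P0: "0 \<le> P" using P[of 0] by linarith
  define C where "C = \<bar>\<Lambda>\<bar> * sqrt A + P * sqrt A + \<bar>\<nu>\<bar> * A powr ((q - 1) / 2) + A powr ((p - 1) / 2)"
  have A: "0 \<le> A" by (rule energy_le_nonneg[OF v(1)])
  have pw: "\<bar>\<bar>v r\<bar> powr (e - 2) * v r * r powr (2 - e)\<bar> \<le> A powr ((e - 1) / 2) * r powr ((3 - e) / 2)"
    if "0 < r" "2 < e" for e r
  proof -
    have "\<bar>\<bar>v r\<bar> powr (e - 2) * v r * r powr (2 - e)\<bar> = \<bar>v r\<bar> powr (e - 1) * r powr (2 - e)"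
    proof (cases "v r = 0")
      case False
      then have "\<bar>v r\<bar> powr (e - 1) = \<bar>v r\<bar> powr (e - 2) * \<bar>v r\<bar>" using powr_add[of "\<bar>v r\<bar>" "e - 2" 1] by simp
      then show ?thesis by (simp add: abs_mult)
    qed simp
    also have "\<dots> \<le> A powr ((e - 1) / 2) * r powr ((e - 1) / 2) * r powr (2 - e)"
      using that by (intro mult_right_mono energy_le_point_powr[OF v(1)]) auto
    also have "\<dots> = A powr ((e - 1) / 2) * r powr ((e - 1) / 2 + (2 - e))" by (simp add: powr_add)
    also have "(e - 1) / 2 + (2 - e) = (3 - e) / 2" by (simp add: field_simps)
    finally show ?thesis .
  qed
  show thesis
  proof (rule that)
    show "0 \<le> C" unfolding C_def using A P0 by (intro add_nonneg_nonneg mult_nonneg_nonneg) auto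
    fix r :: real assume r: "0 < r" "r \<le> 1"
    have mono: "r powr a \<le> r powr (- \<theta>)" if "- \<theta> \<le> a" for a using that r by (intro powr_mono') auto
    have r1: "1 \<le> r powr (- \<theta>)" using mono[of 0] \<theta> r by simp
    have "\<bar>v r\<bar> \<le> sqrt (A * r)" using energy_le_point[OF v(1), of r] r by (intro real_le_rsqrt) auto
    also have "\<dots> \<le> sqrt (A * 1)" using r A by (intro real_sqrt_le_mono mult_left_mono) auto
    also have "\<dots> = sqrt A * 1" by simp
    also have "\<dots> \<le> sqrt A * r powr (- \<theta>)" using r1 A by (intro mult_left_mono) auto
    finally have v1: "\<bar>v r\<bar> \<le> sqrt A * r powr (- \<theta>)" .
    have 1: "\<bar>\<Lambda> * v r\<bar> \<le> \<bar>\<Lambda>\<bar> * (sqrt A * r powr (- \<theta>))"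
      unfolding abs_mult using v1 by (intro mult_left_mono) auto
    have 2: "\<bar>pot (\<lambda>r. (v r)\<^sup>2) r * v r\<bar> \<le> P * (sqrt A * r powr (- \<theta>))"
      unfolding abs_mult using v1 P P0 by (intro mult_mono) auto
    have 3: "\<bar>\<nu> * (\<bar>v r\<bar> powr (q - 2) * v r * r powr (2 - q))\<bar> \<le> \<bar>\<nu>\<bar> * (A powr ((q - 1) / 2) * r powr (- \<theta>))"
      unfolding abs_mult[of \<nu>] using assms(5,6) \<theta> r
      by (intro mult_left_mono order_trans[OF pw] mono) auto
    have 4: "\<bar>\<bar>v r\<bar> powr (p - 2) * v r * r powr (2 - p)\<bar> \<le> A powr ((p - 1) / 2) * r powr (- \<theta>)"
      using assms(3,4) \<theta> r by (intro order_trans[OF pw] mult_left_mono mono) auto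
    have abs4: "\<bar>a + b + c - d\<bar> \<le> x + y + z + w" if "\<bar>a\<bar> \<le> x" "\<bar>b\<bar> \<le> y" "\<bar>c\<bar> \<le> z" "\<bar>d\<bar> \<le> w"
      for a b c d x y z w :: real using that by linarith
    have "\<bar>radial_force p q \<nu> \<Lambda> v r\<bar> \<le> \<bar>\<Lambda>\<bar> * (sqrt A * r powr (- \<theta>)) + P * (sqrt A * r powr (- \<theta>))
      + \<bar>\<nu>\<bar> * (A powr ((q - 1) / 2) * r powr (- \<theta>)) + A powr ((p - 1) / 2) * r powr (- \<theta>)"
      unfolding radial_force_def by (rule abs4[OF 1 2 3 4])
    also have "\<dots> = C * r powr (- \<theta>)" by (simp add: C_def algebra_simps)
    finally show "\<bar>radial_force p q \<nu> \<Lambda> v r\<bar> \<le> C * r powr (- \<theta>)" .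
  qed
qed

text \<open>Two integrations of the bound on \<open>F\<close>: from 1 inward for \<open>v'\<close>,
  where \<open>\<theta> > 1\<close> makes the power dominate the constants, then from 0 outward for
  \<open>v\<close>, where \<open>v 0 = 0\<close> and \<open>\<theta> < 2\<close> leave no
  constant.\<close>

lemma second_order_near_0:
  fixes v v' F :: "real \<Rightarrow> real"
  assumes "\<And>r. 0 < r \<Longrightarrow> (v has_real_derivative v' r) (at r)"
    and "\<And>r. 0 < r \<Longrightarrow> (v' has_real_derivative F r) (at r)"
    and "0 \<le> C" "\<And>r. 0 < r \<Longrightarrow> r \<le> 1 \<Longrightarrow> \<bar>F r\<bar> \<le> C * r powr (- \<theta>)"
    and "1 < \<theta>" "\<theta> < 3 / 2" "isCont v 0" "v 0 = 0"
  obtains K where "0 \<le> K" "\<And>r. 0 < r \<Longrightarrow> r \<le> 1 \<Longrightarrow> \<bar>v' r\<bar> \<le> K * r powr (1 - \<theta>)"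
    "\<And>r. 0 < r \<Longrightarrow> r \<le> 1 \<Longrightarrow> \<bar>v r\<bar> \<le> K * r powr (2 - \<theta>)"
proof -
  define D where "D = \<bar>v' 1\<bar> + C / (\<theta> - 1)"
  have D: "0 \<le> D" using assms(3,5) by (simp add: D_def)
  have d1: "\<bar>v' r\<bar> \<le> D * r powr (1 - \<theta>)" if r: "0 < r" "r \<le> 1" for r
  proof -
    have "\<bar>v' 1 - v' r\<bar> \<le> (- C / (\<theta> - 1) * 1 powr (1 - \<theta>)) - (- C / (\<theta> - 1) * r powr (1 - \<theta>))"
    proof (rule derivative_dominated[OF r(2)])
      fix x assume x: "r \<le> x" "x \<le> 1"
      show "(v' has_real_derivative F x) (at x)" using assms(2) x r by simp
      show "((\<lambda>x. - C / (\<theta> - 1) * x powr (1 - \<theta>)) has_real_derivative C * x powr (- \<theta>)) (at x)"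
      proof -
        have "((\<lambda>x. - C / (\<theta> - 1) * x powr (1 - \<theta>)) has_real_derivative - C / (\<theta> - 1) * ((1 - \<theta>) * x powr (1 - \<theta> - 1))) (at x)"
          using x r by (intro DERIV_cmult has_real_derivative_powr) auto
        moreover have "- C / (\<theta> - 1) * (1 - \<theta>) = C"
        proof -
          define k where "k = \<theta> - 1"
          have "1 - \<theta> = - k" "k \<noteq> 0" using assms(5) by (auto simp: k_def)
          then show ?thesis unfolding k_def[symmetric] by simp
        qed
        then have "- C / (\<theta> - 1) * ((1 - \<theta>) * x powr (1 - \<theta> - 1)) = C * x powr (- \<theta>)"
          unfolding mult.assoc[symmetric] by (simp only:) simp
        ultimately show ?thesis by (simp only:)
      qed
      show "\<bar>F x\<bar> \<le> C * x powr (- \<theta>)" using assms(4) x r by simp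
    qed
    then have "\<bar>v' r\<bar> \<le> \<bar>v' 1\<bar> + C / (\<theta> - 1) * r powr (1 - \<theta>) - C / (\<theta> - 1)" by simp
    also have "\<dots> \<le> \<bar>v' 1\<bar> * r powr (1 - \<theta>) + C / (\<theta> - 1) * r powr (1 - \<theta>)"
    proof -
      have "1 \<le> r powr (1 - \<theta>)" using powr_mono'[of "1 - \<theta>" 0 r] r assms(5) by simp
      then have "\<bar>v' 1\<bar> * 1 \<le> \<bar>v' 1\<bar> * r powr (1 - \<theta>)" by (intro mult_left_mono) auto
      moreover have "0 \<le> C / (\<theta> - 1)" using assms(3,5) by simp
      ultimately show ?thesis by linarith
    qed
    finally show ?thesis by (simp add: D_def algebra_simps)
  qed
  have d2: "\<bar>v r\<bar> \<le> D / (2 - \<theta>) * r powr (2 - \<theta>)" if r: "0 < r" "r \<le> 1" for r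
  proof -
    have le: "\<bar>v r - v s\<bar> \<le> D / (2 - \<theta>) * r powr (2 - \<theta>) - D / (2 - \<theta>) * s powr (2 - \<theta>)"
      if s: "0 < s" "s \<le> r" for s
    proof (rule derivative_dominated[OF s(2)])
      fix x assume x: "s \<le> x" "x \<le> r"
      show "(v has_real_derivative v' x) (at x)" using assms(1) x s by simp
      show "((\<lambda>x. D / (2 - \<theta>) * x powr (2 - \<theta>)) has_real_derivative D * x powr (1 - \<theta>)) (at x)"
      proof -
        have "((\<lambda>x. D / (2 - \<theta>) * x powr (2 - \<theta>)) has_real_derivative D / (2 - \<theta>) * ((2 - \<theta>) * x powr (2 - \<theta> - 1))) (at x)"
          using x s by (intro DERIV_cmult has_real_derivative_powr) auto
        moreover have "D / (2 - \<theta>) * ((2 - \<theta>) * x powr (2 - \<theta> - 1)) = D * x powr (1 - \<theta>)"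
          using assms(6) by simp
        ultimately show ?thesis by (simp only:)
      qed
      show "\<bar>v' x\<bar> \<le> D * x powr (1 - \<theta>)" using d1 x s r by simp
    qed
    have "\<bar>v r - v s\<bar> \<le> D / (2 - \<theta>) * r powr (2 - \<theta>)" if s: "0 < s" "s \<le> r" for s
    proof -
      have "0 \<le> D / (2 - \<theta>) * s powr (2 - \<theta>)" using D assms(6) by simp
      then show ?thesis using le[OF s] by linarith
    qed
    \<comment> \<open>Derivatives are known only for positive arguments, so the bound down to 0 is
      obtained as a limit, using continuity of \<open>v\<close> at 0.\<close>
    then have "\<forall>\<^sub>F s in at_right 0. \<bar>v r - v s\<bar> \<le> D / (2 - \<theta>) * r powr (2 - \<theta>)"
      using eventually_at_right_real[OF r(1)] by (auto elim!: eventually_mono)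
    moreover have "((\<lambda>s. \<bar>v r - v s\<bar>) \<longlongrightarrow> \<bar>v r - v 0\<bar>) (at_right 0)"
      using assms(7) unfolding isCont_def filterlim_at_split by (intro tendsto_intros) auto
    ultimately have "\<bar>v r - v 0\<bar> \<le> D / (2 - \<theta>) * r powr (2 - \<theta>)"
      by (intro tendsto_upperbound) auto
    then show ?thesis using assms(8) by simp
  qed
  define K where "K = max D (D / (2 - \<theta>))"
  show thesis
  proof
    show "0 \<le> K" using D by (simp add: K_def)
    fix r :: real assume r: "0 < r" "r \<le> 1"
    show "\<bar>v' r\<bar> \<le> K * r powr (1 - \<theta>)"
      by (rule order_trans[OF d1[OF r]]) (simp add: K_def mult_right_mono)
    show "\<bar>v r\<bar> \<le> K * r powr (2 - \<theta>)"
      by (rule order_trans[OF d2[OF r]], rule mult_right_mono) (simp_all add: K_def)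
  qed
qed

section \<open>Radial integration and Newton's theorem\<close>

text \<open>Replaces polar coordinates: the push-forward of the measure under \<open>N\<close> is
  determined by the measures of the sublevel sets, so a volume formula for these suffices.\<close>

lemma nn_integral_by_distribution:
  fixes N :: "'a \<Rightarrow> real" and k F :: "real \<Rightarrow> ennreal"
  assumes [measurable]: "N \<in> borel_measurable M" "k \<in> borel_measurable borel" "F \<in> borel_measurable borel"
    and eq: "\<And>R. emeasure M {x \<in> space M. N x \<le> R} = (\<integral>\<^sup>+s. k s * indicator {..R} s \<partial>lborel)"
    and fin: "\<And>R. emeasure M {x \<in> space M. N x \<le> R} < \<infinity>"
  shows "(\<integral>\<^sup>+x. F (N x) \<partial>M) = (\<integral>\<^sup>+s. k s * F s \<partial>lborel)"
proof -
  have d: "emeasure (distr M borel N) {..R} = emeasure M {x \<in> space M. N x \<le> R}" for R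
    by (subst emeasure_distr) (auto intro!: arg_cong[where f="emeasure M"])
  have "distr M borel N = density lborel k"
  proof (rule measure_eqI_generator_eq[where E="range (\<lambda>a::real. {..a})" and \<Omega>=UNIV and A="\<lambda>i. {..real i}"])
    show "Int_stable (range (\<lambda>a::real. {..a}))" by (auto simp: Int_stable_def)
    show "emeasure (distr M borel N) X = emeasure (density lborel k) X" if "X \<in> range (\<lambda>a. {..a})" for X
      using that by (auto simp: d eq emeasure_density)
    show "sets (distr M borel N) = sigma_sets UNIV (range (\<lambda>a::real. {..a}))"
      "sets (density lborel k) = sigma_sets UNIV (range (\<lambda>a::real. {..a}))"
      by (simp_all add: borel_eq_atMost)
    show "(\<Union>i. {..real i}) = UNIV" by (auto intro: real_arch_simple)
    show "emeasure (distr M borel N) {..real i} \<noteq> \<infinity>" for i using fin[of "real i"] by (simp add: d)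
  qed auto
  then have "(\<integral>\<^sup>+s. F s \<partial>distr M borel N) = (\<integral>\<^sup>+s. F s \<partial>density lborel k)" by simp
  then show ?thesis by (simp add: nn_integral_distr nn_integral_density)
qed

lemma nn_integral_FTC_interval:
  fixes f F :: "real \<Rightarrow> real"
  assumes "a \<le> b" "continuous_on {a..b} F" "\<And>x. a < x \<Longrightarrow> x < b \<Longrightarrow> (F has_real_derivative f x) (at x)"
    and "\<And>x. a \<le> x \<Longrightarrow> x \<le> b \<Longrightarrow> 0 \<le> f x" "f \<in> borel_measurable borel"
  shows "(\<integral>\<^sup>+x. ennreal (f x) * indicator {a..b} x \<partial>lborel) = ennreal (F b - F a)"
proof -
  have "(f has_integral F b - F a) {a..b}"
    using assms(1-3) by (intro fundamental_theorem_of_calculus_interior)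
      (auto simp: has_real_derivative_iff_has_vector_derivative)
  then have "((\<lambda>x. if x \<in> {a..b} then f x else 0) has_integral F b - F a) UNIV"
    by (simp only: has_integral_restrict_UNIV)
  moreover have "(\<lambda>x. if x \<in> {a..b} then f x else 0) = (\<lambda>x. f x * indicator {a..b} x)" by auto
  ultimately have "(\<integral>\<^sup>+x. ennreal (f x * indicator {a..b} x) \<partial>lborel) = ennreal (F b - F a)"
    using assms(4,5) by (intro nn_integral_has_integral_lborel) (auto simp: indicator_def)
  moreover have "ennreal (f x * indicator {a..b} x) = ennreal (f x) * indicator {a..b} x" for x
    by (auto simp: indicator_def)
  ultimately show ?thesis by simp
qed

lemma radial_nn_integral:
  fixes F :: "real \<Rightarrow> ennreal"
  assumes [measurable]: "F \<in> borel_measurable borel"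
  shows "(\<integral>\<^sup>+x. F (norm x) \<partial>(lborel :: (real^3) measure)) = (\<integral>\<^sup>+s. ennreal (4 * pi * s\<^sup>2) * indicator {0..} s * F s \<partial>lborel)"
proof (rule nn_integral_by_distribution)
  have m: "emeasure lborel {x :: real^3. norm x \<le> R} = ennreal (if 0 \<le> R then 4 / 3 * pi * R ^ 3 else 0)" for R
  proof (cases "0 \<le> R")
    case True
    have "{x :: real^3. norm x \<le> R} = cball 0 R" by auto
    then show ?thesis using emeasure_cball[OF True, of "0 :: real^3"] True
      by (simp add: eval_unit_ball_vol)
  next
    case False
    then have "{x :: real^3. norm x \<le> R} = {}" using norm_ge_zero order_trans by blast
    then show ?thesis using False by (simp only:) simp
  qed
  have k: "(\<integral>\<^sup>+s. ennreal (4 * pi * s\<^sup>2) * indicator {0..} s * indicator {..R} s \<partial>lborel) = ennreal (if 0 \<le> R then 4 / 3 * pi * R ^ 3 else 0)" for R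
  proof (cases "0 \<le> R")
    case True
    have "(\<integral>\<^sup>+s. ennreal (4 * pi * s\<^sup>2) * indicator {0..R} s \<partial>lborel) = ennreal (4 / 3 * pi * R ^ 3 - 4 / 3 * pi * 0 ^ 3)"
      by (rule nn_integral_FTC_interval[OF True, where F="\<lambda>s. 4 / 3 * pi * s ^ 3"])
        (auto intro!: continuous_intros derivative_eq_intros)
    moreover have "ennreal (4 * pi * s\<^sup>2) * indicator {0..} s * indicator {..R} s = ennreal (4 * pi * s\<^sup>2) * indicator {0..R} s" for s :: real
      by (auto simp: indicator_def)
    ultimately show ?thesis using True by simp
  next
    case False
    then have "(\<integral>\<^sup>+s. ennreal (4 * pi * s\<^sup>2) * indicator {0..} s * indicator {..R} s \<partial>lborel) = (\<integral>\<^sup>+(s::real). 0 \<partial>lborel)"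
      by (intro nn_integral_cong) (auto simp: indicator_def)
    then show ?thesis using False by simp
  qed
  show "emeasure lborel {x \<in> space (lborel :: (real^3) measure). norm x \<le> R} = (\<integral>\<^sup>+s. ennreal (4 * pi * s\<^sup>2) * indicator {0..} s * indicator {..R} s \<partial>lborel)" for R
    unfolding k by (simp add: m)
  show "emeasure lborel {x \<in> space (lborel :: (real^3) measure). norm x \<le> R} < \<infinity>" for R
    by (simp add: m)
qed measurable

text \<open>Integration over the plane at height \<open>z\<close>, with distance to the origin of
  three-space as the variable. The sublevel sets are discs of area
  \<open>pi * (R\<^sup>2 - z\<^sup>2)\<close>, so the density \<open>2 * pi * s\<close> contains
  \<open>z\<close> only through its range.\<close>

lemma planar_nn_integral:
  fixes F :: "real \<Rightarrow> ennreal"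
  assumes [measurable]: "F \<in> borel_measurable borel"
  shows "(\<integral>\<^sup>+w. F (sqrt (z\<^sup>2 + (cmod w)\<^sup>2)) \<partial>lborel) = (\<integral>\<^sup>+s. ennreal (2 * pi * s) * indicator {\<bar>z\<bar>..} s * F s \<partial>lborel)"
proof (rule nn_integral_by_distribution)
  have m: "emeasure lborel {w. sqrt (z\<^sup>2 + (cmod w)\<^sup>2) \<le> R} = ennreal (if \<bar>z\<bar> \<le> R then pi * (R\<^sup>2 - z\<^sup>2) else 0)" for R
  proof (cases "\<bar>z\<bar> \<le> R")
    case True
    then have zR: "z\<^sup>2 \<le> R\<^sup>2" by (metis abs_le_square_iff abs_ge_zero abs_of_nonneg order_trans)
    have "{w. sqrt (z\<^sup>2 + (cmod w)\<^sup>2) \<le> R} = cball 0 (sqrt (R\<^sup>2 - z\<^sup>2))"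
    proof (intro set_eqI)
      fix w
      have "sqrt (z\<^sup>2 + (cmod w)\<^sup>2) \<le> R \<longleftrightarrow> z\<^sup>2 + (cmod w)\<^sup>2 \<le> R\<^sup>2"
        using True by (simp add: real_sqrt_le_iff' order_trans[OF abs_ge_zero])
      also have "\<dots> \<longleftrightarrow> (cmod w)\<^sup>2 \<le> R\<^sup>2 - z\<^sup>2" by auto
      also have "\<dots> \<longleftrightarrow> cmod w \<le> sqrt (R\<^sup>2 - z\<^sup>2)"
        using real_le_rsqrt[of "cmod w" "R\<^sup>2 - z\<^sup>2"] zR
        by (metis norm_ge_zero power_mono real_sqrt_pow2 diff_ge_0_iff_ge)
      finally show "w \<in> {w. sqrt (z\<^sup>2 + (cmod w)\<^sup>2) \<le> R} \<longleftrightarrow> w \<in> cball 0 (sqrt (R\<^sup>2 - z\<^sup>2))" by simp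
    qed
    then show ?thesis using emeasure_cball[of "sqrt (R\<^sup>2 - z\<^sup>2)" "0 :: complex"] True zR
      by (simp add: eval_unit_ball_vol)
  next
    case False
    have "\<bar>z\<bar> \<le> sqrt (z\<^sup>2 + (cmod w)\<^sup>2)" for w by (rule real_le_rsqrt) simp
    then have "{w. sqrt (z\<^sup>2 + (cmod w)\<^sup>2) \<le> R} = {}" using False order_trans by blast
    then show ?thesis using False by (simp only:) simp
  qed
  have k: "(\<integral>\<^sup>+s. ennreal (2 * pi * s) * indicator {\<bar>z\<bar>..} s * indicator {..R} s \<partial>lborel) = ennreal (if \<bar>z\<bar> \<le> R then pi * (R\<^sup>2 - z\<^sup>2) else 0)" for R
  proof (cases "\<bar>z\<bar> \<le> R")
    case True
    have "(\<integral>\<^sup>+s. ennreal (2 * pi * s) * indicator {\<bar>z\<bar>..R} s \<partial>lborel) = ennreal (pi * R\<^sup>2 - pi * \<bar>z\<bar>\<^sup>2)"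
      by (rule nn_integral_FTC_interval[OF True, where F="\<lambda>s. pi * s\<^sup>2"])
        (auto intro!: continuous_intros derivative_eq_intros)
    moreover have "ennreal (2 * pi * s) * indicator {\<bar>z\<bar>..} s * indicator {..R} s = ennreal (2 * pi * s) * indicator {\<bar>z\<bar>..R} s" for s :: real
      by (auto simp: indicator_def)
    ultimately show ?thesis using True by (simp add: right_diff_distrib)
  next
    case False
    then have "(\<integral>\<^sup>+s. ennreal (2 * pi * s) * indicator {\<bar>z\<bar>..} s * indicator {..R} s \<partial>lborel) = (\<integral>\<^sup>+(s::real). 0 \<partial>lborel)"
      by (intro nn_integral_cong) (auto simp: indicator_def)
    then show ?thesis using False by simp
  qed
  show "emeasure lborel {w \<in> space lborel. sqrt (z\<^sup>2 + (cmod w)\<^sup>2) \<le> R} = (\<integral>\<^sup>+s. ennreal (2 * pi * s) * indicator {\<bar>z\<bar>..} s * indicator {..R} s \<partial>lborel)" for R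
    unfolding k by (simp add: m)
  show "emeasure lborel {w \<in> space lborel. sqrt (z\<^sup>2 + (cmod w)\<^sup>2) \<le> R} < \<infinity>" for R
    by (simp add: m)
qed measurable

text \<open>Three-space is sliced orthogonally to the axis through the pole
  \<open>(\<rho>, 0)\<close>. At height \<open>z\<close> and radius \<open>s\<close> the squared
  distance to the pole is \<open>s\<^sup>2 + \<rho>\<^sup>2 - 2 * z * \<rho>\<close>, so after
  exchanging the integrals an elementary one over \<open>z\<close> in \<open>[-s, s]\<close>
  remains.\<close>

lemma newton_axis:
  fixes F :: "real \<Rightarrow> ennreal"
  assumes [measurable]: "F \<in> borel_measurable borel" and \<rho>: "0 < \<rho>"
  shows "(\<integral>\<^sup>+y. ennreal (1 / norm ((\<rho>, 0 :: complex) - y)) * F (norm y) \<partial>lborel)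
    = (\<integral>\<^sup>+s. ennreal (4 * pi * s\<^sup>2 / max \<rho> s) * indicator {0..} s * F s \<partial>lborel)"
proof -
  define H where "H z s = ennreal (1 / sqrt (s\<^sup>2 + \<rho>\<^sup>2 - 2 * z * \<rho>)) * F s" for z s
  have "(\<integral>\<^sup>+y. ennreal (1 / norm ((\<rho>, 0 :: complex) - y)) * F (norm y) \<partial>lborel)
      = (\<integral>\<^sup>+y. ennreal (1 / norm ((\<rho>, 0 :: complex) - y)) * F (norm y) \<partial>(lborel \<Otimes>\<^sub>M lborel))"
    by (simp add: lborel_prod)
  also have "\<dots> = (\<integral>\<^sup>+z. \<integral>\<^sup>+w. ennreal (1 / norm ((\<rho>, 0 :: complex) - (z, w))) * F (norm (z, w)) \<partial>lborel \<partial>lborel)"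
    by (rule lborel.nn_integral_fst[symmetric]) (simp add: lborel_prod)
  also have "\<dots> = (\<integral>\<^sup>+z. \<integral>\<^sup>+w. H z (sqrt (z\<^sup>2 + (cmod w)\<^sup>2)) \<partial>lborel \<partial>lborel)"
  proof (intro nn_integral_cong)
    fix z :: real and w :: complex
    have n: "norm (z, w) = sqrt (z\<^sup>2 + (cmod w)\<^sup>2)" by (simp add: norm_Pair)
    have "norm ((\<rho>, 0 :: complex) - (z, w)) = sqrt ((sqrt (z\<^sup>2 + (cmod w)\<^sup>2))\<^sup>2 + \<rho>\<^sup>2 - 2 * z * \<rho>)"
      by (simp add: norm_Pair power2_diff algebra_simps)
    then show "ennreal (1 / norm ((\<rho>, 0 :: complex) - (z, w))) * F (norm (z, w)) = H z (sqrt (z\<^sup>2 + (cmod w)\<^sup>2))"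
      unfolding H_def n by simp
  qed
  also have "\<dots> = (\<integral>\<^sup>+z. \<integral>\<^sup>+s. ennreal (2 * pi * s) * indicator {\<bar>z\<bar>..} s * H z s \<partial>lborel \<partial>lborel)"
    unfolding H_def by (intro nn_integral_cong planar_nn_integral) measurable
  also have "\<dots> = (\<integral>\<^sup>+s. \<integral>\<^sup>+z. ennreal (2 * pi * s) * indicator {\<bar>z\<bar>..} s * H z s \<partial>lborel \<partial>lborel)"
  proof (rule lborel_pair.Fubini'[of "\<lambda>z s. ennreal (2 * pi * s) * indicator {\<bar>z\<bar>..} s * H z s", symmetric])
    have "(\<lambda>(z, s). ennreal (2 * pi * s) * (if \<bar>z\<bar> \<le> s then 1 else 0) * H z s) \<in> borel_measurable (lborel \<Otimes>\<^sub>M lborel)"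
      unfolding H_def by measurable
    moreover have "(\<lambda>(z, s). ennreal (2 * pi * s) * indicator {\<bar>z\<bar>..} s * H z s)
        = (\<lambda>(z, s). ennreal (2 * pi * s) * (if \<bar>z\<bar> \<le> s then 1 else 0) * H z s)"
      by (auto simp: indicator_def fun_eq_iff)
    ultimately show "(\<lambda>(z, s). ennreal (2 * pi * s) * indicator {\<bar>z\<bar>..} s * H z s) \<in> borel_measurable (lborel \<Otimes>\<^sub>M lborel)"
      by simp
  qed
  also have "\<dots> = (\<integral>\<^sup>+s. ennreal (4 * pi * s\<^sup>2 / max \<rho> s) * indicator {0..} s * F s \<partial>lborel)"
  proof (intro nn_integral_cong)
    fix s :: real
    show "(\<integral>\<^sup>+z. ennreal (2 * pi * s) * indicator {\<bar>z\<bar>..} s * H z s \<partial>lborel)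
      = ennreal (4 * pi * s\<^sup>2 / max \<rho> s) * indicator {0..} s * F s"
    proof (cases "0 \<le> s")
      case False
      then have "(\<integral>\<^sup>+z. ennreal (2 * pi * s) * indicator {\<bar>z\<bar>..} s * H z s \<partial>lborel) = (\<integral>\<^sup>+(z::real). 0 \<partial>lborel)"
        by (intro nn_integral_cong) (auto simp: indicator_def)
      then show ?thesis using False by simp
    next
      case True
      have ge: "0 \<le> s\<^sup>2 + \<rho>\<^sup>2 - 2 * z * \<rho>" if "z \<le> s" for z
      proof -
        have "z * \<rho> \<le> s * \<rho>" using that \<rho> by (intro mult_right_mono) auto
        then show ?thesis using zero_le_power2[of "s - \<rho>"] by (simp add: power2_diff)
      qed
      have gt: "0 < s\<^sup>2 + \<rho>\<^sup>2 - 2 * z * \<rho>" if "z < s" for z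
      proof -
        have "z * \<rho> < s * \<rho>" using that \<rho> by (intro mult_strict_right_mono) auto
        then show ?thesis using zero_le_power2[of "s - \<rho>"] by (simp add: power2_diff)
      qed
      \<comment> \<open>At \<open>s = \<rho>\<close> the integrand is singular at the end point
        \<open>z = s\<close>; the antiderivative is still continuous there, and the derivative is
        needed only in the interior.\<close>
      have I: "(\<integral>\<^sup>+z. ennreal (1 / sqrt (s\<^sup>2 + \<rho>\<^sup>2 - 2 * z * \<rho>)) * indicator {-s..s} z \<partial>lborel)
          = ennreal ((- sqrt (s\<^sup>2 + \<rho>\<^sup>2 - 2 * s * \<rho>) / \<rho>) - (- sqrt (s\<^sup>2 + \<rho>\<^sup>2 - 2 * (- s) * \<rho>) / \<rho>))"
      proof (rule nn_integral_FTC_interval[where F="\<lambda>z. - sqrt (s\<^sup>2 + \<rho>\<^sup>2 - 2 * z * \<rho>) / \<rho>"])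
        show "continuous_on {-s..s} (\<lambda>z. - sqrt (s\<^sup>2 + \<rho>\<^sup>2 - 2 * z * \<rho>) / \<rho>)"
          using \<rho> by (intro continuous_intros) auto
        fix z assume "- s < z" "z < s"
        then show "((\<lambda>z. - sqrt (s\<^sup>2 + \<rho>\<^sup>2 - 2 * z * \<rho>) / \<rho>) has_real_derivative 1 / sqrt (s\<^sup>2 + \<rho>\<^sup>2 - 2 * z * \<rho>)) (at z)"
          using gt[of z] \<rho> by (auto intro!: derivative_eq_intros simp: field_simps)
      qed (use True ge in auto)
      \<comment> \<open>The roots are \<open>s + \<rho>\<close> and
        \<open>\<bar>s - \<rho>\<bar>\<close>, whose difference is twice the smaller of
        \<open>s\<close> and \<open>\<rho>\<close>; this is where the maximum in the kernel
        arises.\<close>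
      have J: "(- sqrt (s\<^sup>2 + \<rho>\<^sup>2 - 2 * s * \<rho>) / \<rho>) - (- sqrt (s\<^sup>2 + \<rho>\<^sup>2 - 2 * (- s) * \<rho>) / \<rho>) = 2 * s / max \<rho> s"
      proof -
        have "s\<^sup>2 + \<rho>\<^sup>2 - 2 * s * \<rho> = (s - \<rho>)\<^sup>2" "s\<^sup>2 + \<rho>\<^sup>2 - 2 * (- s) * \<rho> = (s + \<rho>)\<^sup>2"
          by (simp_all add: power2_diff power2_sum)
        then show ?thesis using True \<rho> by (simp add: max_def abs_if field_simps)
      qed
      have "(\<integral>\<^sup>+z. ennreal (2 * pi * s) * indicator {\<bar>z\<bar>..} s * H z s \<partial>lborel)
          = (\<integral>\<^sup>+z. (ennreal (2 * pi * s) * F s) * (ennreal (1 / sqrt (s\<^sup>2 + \<rho>\<^sup>2 - 2 * z * \<rho>)) * indicator {-s..s} z) \<partial>lborel)"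
        by (intro nn_integral_cong) (auto simp: H_def indicator_def mult_ac)
      also have "\<dots> = (ennreal (2 * pi * s) * F s) * (\<integral>\<^sup>+z. ennreal (1 / sqrt (s\<^sup>2 + \<rho>\<^sup>2 - 2 * z * \<rho>)) * indicator {-s..s} z \<partial>lborel)"
        by (rule nn_integral_cmult) measurable
      also have "\<dots> = (ennreal (2 * pi * s) * F s) * ennreal (2 * s / max \<rho> s)" unfolding I J ..
      also have "\<dots> = ennreal (2 * pi * s) * ennreal (2 * s / max \<rho> s) * F s" by (simp add: mult_ac)
      also have "ennreal (2 * pi * s) * ennreal (2 * s / max \<rho> s) = ennreal (4 * pi * s\<^sup>2 / max \<rho> s)"
        using True \<rho> by (subst ennreal_mult[symmetric]) (auto simp: power2_eq_square)
      finally show ?thesis using True by simp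
    qed
  qed
  finally show ?thesis .
qed

section \<open>Rotation invariance and Newton's theorem at a general point\<close>

lemma lborel_distr_orthogonal:
  fixes f :: "real^'n::{finite,wellorder} \<Rightarrow> real^'n::_"
  assumes "orthogonal_transformation f"
  shows "distr lborel borel f = lborel"
proof -
  have lin: "linear f" using assms by (rule orthogonal_transformation_linear)
  have [measurable]: "f \<in> borel_measurable borel"
    using linear_continuous_on[OF linear_linear[THEN iffD2, OF lin], of UNIV] by (rule borel_measurable_continuous_onI)
  obtain g where g: "orthogonal_transformation g" "\<And>x. g (f x) = x" "\<And>x. f (g x) = x"
    using orthogonal_transformation_inj[OF assms] orthogonal_transformation_surj[OF assms]
      orthogonal_transformation_inv[OF assms] by (metis inv_f_f surj_f_inv_f)
  show ?thesis
  proof (rule lborel_eqI[symmetric])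
    fix l u :: "real^'n::_"
    assume lu: "\<And>b. b \<in> Basis \<Longrightarrow> l \<bullet> b \<le> u \<bullet> b"
    have vim: "f -` box l u = g ` box l u" using g(2,3) by (auto simp: image_iff) metis
    have bnd: "bounded (f -` box l u)" unfolding vim
      using bounded_linear_image[OF bounded_box linear_linear[THEN iffD2, OF orthogonal_transformation_linear[OF g(1)]]] .
    have S: "f -` box l u \<in> sets borel"
      using measurable_sets[of f borel borel "box l u"] by simp
    have "emeasure (distr lborel borel f) (box l u) = emeasure lborel (f -` box l u)"
      by (subst emeasure_distr) auto
    also have "\<dots> = ennreal (measure lborel (f -` box l u))"
      using emeasure_bounded_finite[OF bnd] by (simp add: emeasure_eq_ennreal_measure top.not_eq_extremum)
    also have "measure lborel (f -` box l u) = measure lebesgue (g ` box l u)"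
      unfolding vim[symmetric] using S by simp
    also have "\<dots> = measure lebesgue (box l u)"
      by (rule measure_orthogonal_image[OF g(1)]) simp
    also have "\<dots> = (\<Prod>b\<in>Basis. (u - l) \<bullet> b)"
      using lu by (simp add: measure_lborel_box_eq inner_diff_left)
    finally show "emeasure (distr lborel borel f) (box l u) = ennreal (\<Prod>b\<in>Basis. (u - l) \<bullet> b)" .
  qed simp
qed

text \<open>A measure-preserving isometry onto the vector type from a product of a line and a plane,
  the form in which Fubini produces the slices of \<open>newton_axis\<close>.\<close>

definition triple_to_vec :: "real \<times> complex \<Rightarrow> real^3" where
  "triple_to_vec y = vector [fst y, Re (snd y), Im (snd y)]"

lemma triple_to_vec_measurable [measurable]: "triple_to_vec \<in> borel_measurable borel"
proof -
  have eq: "triple_to_vec = (\<lambda>y. fst y *\<^sub>R axis 1 1 + Re (snd y) *\<^sub>R axis 2 1 + Im (snd y) *\<^sub>R axis 3 1)"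
    by (auto simp: triple_to_vec_def fun_eq_iff vec_eq_iff forall_3 axis_def)
  show ?thesis
    unfolding eq by (intro borel_measurable_continuous_onI continuous_intros)
qed

lemma norm_triple_to_vec: "norm (triple_to_vec y) = norm y"
  by (cases y) (simp add: triple_to_vec_def norm_vec_def L2_set_def sum_3 norm_Pair cmod_def add.assoc)

lemma triple_to_vec_diff: "triple_to_vec x - triple_to_vec y = triple_to_vec (x - y)"
  by (simp add: triple_to_vec_def vec_eq_iff forall_3)

lemma lborel_distr_triple_to_vec: "distr lborel borel triple_to_vec = lborel"
proof (rule lborel_eqI[symmetric])
  fix l u :: "real^3"
  assume lu: "\<And>b. b \<in> Basis \<Longrightarrow> l \<bullet> b \<le> u \<bullet> b"
  have le: "l $ i \<le> u $ i" for i
  proof -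
    have "axis i 1 \<in> (Basis :: (real^3) set)" by (auto simp: Basis_vec_def)
    from lu[OF this] show ?thesis by (simp add: inner_axis)
  qed
  have vim: "triple_to_vec -` box l u = box (l $ 1) (u $ 1) \<times> box (Complex (l $ 2) (l $ 3)) (Complex (u $ 2) (u $ 3))"
    by (auto simp: triple_to_vec_def mem_box_cart forall_3 in_box_complex_iff mem_box)
  have "emeasure (distr lborel borel triple_to_vec) (box l u) = emeasure lborel (triple_to_vec -` box l u)"
    by (subst emeasure_distr) auto
  also have "\<dots> = emeasure (lborel \<Otimes>\<^sub>M lborel) (box (l $ 1) (u $ 1) \<times> box (Complex (l $ 2) (l $ 3)) (Complex (u $ 2) (u $ 3)))"
    unfolding vim by (simp only: lborel_prod)
  also have "\<dots> = emeasure lborel (box (l $ 1) (u $ 1)) * emeasure lborel (box (Complex (l $ 2) (l $ 3)) (Complex (u $ 2) (u $ 3)))"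
    by (rule lborel.emeasure_pair_measure_Times) auto
  also have "\<dots> = ennreal ((u $ 1 - l $ 1) * ((u $ 2 - l $ 2) * (u $ 3 - l $ 3)))"
    using le by (simp add: emeasure_lborel_box_eq Basis_complex_def ennreal_mult)
  also have "(u $ 1 - l $ 1) * ((u $ 2 - l $ 2) * (u $ 3 - l $ 3)) = (\<Prod>b\<in>Basis. (u - l) \<bullet> b)"
  proof -
    have "(\<Prod>b\<in>Basis. (u - l) \<bullet> b) = (\<Prod>i\<in>UNIV. (u - l) \<bullet> axis i 1)"
    proof (rule prod.reindex_cong[of "\<lambda>i. axis i 1"])
      show "inj (\<lambda>i::3. axis i (1::real))" by (auto simp: inj_on_def axis_eq_axis)
      show "(Basis :: (real^3) set) = range (\<lambda>i. axis i 1)" by (auto simp: Basis_vec_def)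
    qed simp
    also have "\<dots> = (u $ 1 - l $ 1) * ((u $ 2 - l $ 2) * (u $ 3 - l $ 3))"
    proof -
      have "(u - l) \<bullet> axis i 1 = u $ i - l $ i" for i by (simp add: inner_axis)
      then show ?thesis unfolding UNIV_3 by (simp add: mult.assoc)
    qed
    finally show ?thesis by simp
  qed
  finally show "emeasure (distr lborel borel triple_to_vec) (box l u) = ennreal (\<Prod>b\<in>Basis. (u - l) \<bullet> b)" .
qed simp

text \<open>A rotation takes a point on the first axis to \<open>x\<close>; it preserves Lebesgue
  measure, norms and distances, so the axial case applies.\<close>

lemma newton:
  fixes F :: "real \<Rightarrow> ennreal" and x :: "real^3"
  assumes [measurable]: "F \<in> borel_measurable borel" and x: "x \<noteq> 0"
  shows "(\<integral>\<^sup>+y. ennreal (1 / norm (x - y)) * F (norm y) \<partial>lborel)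
    = (\<integral>\<^sup>+s. ennreal (4 * pi * s\<^sup>2 / max (norm x) s) * indicator {0..} s * F s \<partial>lborel)"
proof -
  define e where "e = triple_to_vec (norm x, 0)"
  have "norm e = norm x" by (simp add: e_def norm_triple_to_vec norm_Pair)
  then obtain f where f: "orthogonal_transformation f" "f e = x"
    using orthogonal_transformation_exists[of e x] by blast
  have [measurable]: "f \<in> borel_measurable borel"
    using linear_continuous_on[OF linear_linear[THEN iffD2, OF orthogonal_transformation_linear[OF f(1)]], of UNIV]
    by (rule borel_measurable_continuous_onI)
  have fd: "norm (f a - f b) = norm (a - b)" "norm (f a) = norm a" for a b
    using f(1) by (metis linear_diff orthogonal_transformation)+
  have "(\<integral>\<^sup>+y. ennreal (1 / norm (x - y)) * F (norm y) \<partial>lborel)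
      = (\<integral>\<^sup>+y. ennreal (1 / norm (x - y)) * F (norm y) \<partial>distr lborel borel f)"
    by (simp only: lborel_distr_orthogonal[OF f(1)])
  also have "\<dots> = (\<integral>\<^sup>+y. ennreal (1 / norm (f e - f y)) * F (norm (f y)) \<partial>lborel)"
    unfolding f(2) by (rule nn_integral_distr) measurable
  also have "\<dots> = (\<integral>\<^sup>+y. ennreal (1 / norm (e - y)) * F (norm y) \<partial>lborel)" unfolding fd ..
  also have "\<dots> = (\<integral>\<^sup>+y. ennreal (1 / norm (e - y)) * F (norm y) \<partial>distr lborel borel triple_to_vec)"
    by (simp only: lborel_distr_triple_to_vec)
  also have "\<dots> = (\<integral>\<^sup>+y. ennreal (1 / norm (e - triple_to_vec y)) * F (norm (triple_to_vec y)) \<partial>lborel)"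
    by (rule nn_integral_distr) measurable
  also have "\<dots> = (\<integral>\<^sup>+y. ennreal (1 / norm ((norm x, 0 :: complex) - y)) * F (norm y) \<partial>lborel)"
    unfolding e_def triple_to_vec_diff norm_triple_to_vec ..
  also have "\<dots> = (\<integral>\<^sup>+s. ennreal (4 * pi * s\<^sup>2 / max (norm x) s) * indicator {0..} s * F s \<partial>lborel)"
    using x by (intro newton_axis) auto
  finally show ?thesis .
qed

section \<open>Integration by parts off the origin\<close>

text \<open>
  Translation invariance replaces Fubini in coordinates: \<open>\<integral> (H(x + e) - H(x)) dx = 0\<close> is the integral
  over \<open>\<tau> \<in> [0,1]\<close> of \<open>\<integral> \<partial>\<^sub>e H(x + \<tau> e) dx\<close>, which does not depend on \<open>\<tau>\<close>.
\<close>

lemma integration_by_parts_punctured: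
  fixes h hi \<phi> \<phi>i :: "real^3 \<Rightarrow> complex" and e :: "real^3"
  assumes dh: "\<And>x. x \<noteq> 0 \<Longrightarrow> ((\<lambda>t. h (x + t *\<^sub>R e)) has_vector_derivative hi x) (at 0)"
    and ch: "continuous_on (- {0}) hi"
    and d\<phi>: "\<And>x. ((\<lambda>t. \<phi> (x + t *\<^sub>R e)) has_vector_derivative \<phi>i x) (at 0)"
    and c\<phi>: "continuous_on UNIV \<phi>i"
    and int: "integrable lborel (\<lambda>x. h x * \<phi> x)" "integrable lborel (\<lambda>x. h x * \<phi>i x)"
      "integrable lborel (\<lambda>x. hi x * \<phi> x)"
  shows "(LINT x|lborel. h x * \<phi>i x) = - (LINT x|lborel. hi x * \<phi> x)"
proof -
  define H where "H x = h x * \<phi> x" for x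
  define K where "K x = h x * \<phi>i x + hi x * \<phi> x" for x
  have shift: "((\<lambda>s. f (x + s *\<^sub>R e)) has_vector_derivative d) (at \<tau>)"
    if "((\<lambda>t. f (x + \<tau> *\<^sub>R e + t *\<^sub>R e)) has_vector_derivative d) (at 0)" for f :: "real^3 \<Rightarrow> complex" and x \<tau> d
  proof -
    have "((\<lambda>s. s - \<tau>) has_vector_derivative 1) (at \<tau>)"
      by (auto intro!: derivative_eq_intros)
    from vector_diff_chain_at[OF this, of "\<lambda>t. f (x + \<tau> *\<^sub>R e + t *\<^sub>R e)" d] that
    show ?thesis by (simp add: o_def algebra_simps)
  qed
  have iK: "integrable lborel K" unfolding K_def using int by simp
  have [measurable]: "K \<in> borel_measurable borel" using borel_measurable_integrable[OF iK] by simp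
  have iH: "integrable lborel H" unfolding H_def by (rule int)
  have tr: "integrable lborel (\<lambda>x. f (x + c))" "(\<integral>x. f (x + c) \<partial>lborel) = (\<integral>x. f x \<partial>lborel)"
    if "integrable lborel f" for f :: "real^3 \<Rightarrow> complex" and c
  proof -
    have [measurable]: "f \<in> borel_measurable borel" using borel_measurable_integrable[OF that] by simp
    have "integrable (distr lborel borel ((+) c)) f" using that by (simp add: lborel_distr_plus)
    then show "integrable lborel (\<lambda>x. f (x + c))"
      by (subst (asm) integrable_distr_eq) (auto simp: add.commute)
    have "(\<integral>x. f x \<partial>lborel) = (\<integral>x. f x \<partial>distr lborel borel ((+) c))" by (simp add: lborel_distr_plus)
    also have "\<dots> = (\<integral>x. f (c + x) \<partial>lborel)" by (rule integral_distr) auto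
    finally show "(\<integral>x. f (x + c) \<partial>lborel) = (\<integral>x. f x \<partial>lborel)" by (simp add: add.commute)
  qed
  define g where "g \<tau> x = indicator {0..1} \<tau> *\<^sub>R K (x + \<tau> *\<^sub>R e)" for \<tau> :: real and x
  have gm: "(\<lambda>(\<tau>, x). g \<tau> x) \<in> borel_measurable (lborel \<Otimes>\<^sub>M lborel)"
    unfolding g_def by measurable
  have gi: "integrable (lborel \<Otimes>\<^sub>M lborel) (\<lambda>(\<tau>, x). g \<tau> x)"
  proof (rule lborel_pair.Fubini_integrable[OF gm])
    have "(\<integral>x. norm (case (\<tau>, x) of (\<tau>, x) \<Rightarrow> g \<tau> x) \<partial>lborel) = indicator {0..1} \<tau> * (\<integral>x. norm (K x) \<partial>lborel)" for \<tau>
    proof -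
      have "(\<integral>x. norm (K (x + \<tau> *\<^sub>R e)) \<partial>lborel) = (\<integral>x. norm (K x) \<partial>lborel)"
      proof -
        have "(\<integral>x. norm (K x) \<partial>lborel) = (\<integral>x. norm (K x) \<partial>distr lborel borel ((+) (\<tau> *\<^sub>R e)))"
          by (simp add: lborel_distr_plus)
        also have "\<dots> = (\<integral>x. norm (K (\<tau> *\<^sub>R e + x)) \<partial>lborel)" by (rule integral_distr) auto
        finally show ?thesis by (simp add: add.commute)
      qed
      then show ?thesis by (simp add: g_def)
    qed
    then show "integrable lborel (\<lambda>\<tau>. \<integral>x. norm (case (\<tau>, x) of (\<tau>, x) \<Rightarrow> g \<tau> x) \<partial>lborel)"
      by (auto intro!: integrable_mult_left simp: integrable_indicator_iff)
    show "AE \<tau> in lborel. integrable lborel (\<lambda>x. case (\<tau>, x) of (\<tau>, x) \<Rightarrow> g \<tau> x)"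
      using tr(1)[OF iK] by (auto simp: g_def)
  qed
  \<comment> \<open>The line through \<open>x\<close> in direction \<open>e\<close> misses the
    origin unless \<open>x\<close> lies in \<open>span {e}\<close>, a null set. Almost every line
    thus stays where \<open>H\<close> is continuously differentiable.\<close>
  have line: "(\<integral>\<tau>. g \<tau> x \<partial>lborel) = H (x + e) - H x" if x: "x \<notin> span {e}" for x
  proof -
    have nz: "x + \<tau> *\<^sub>R e \<noteq> 0" for \<tau>
    proof
      assume "x + \<tau> *\<^sub>R e = 0"
      then have "x = (- \<tau>) *\<^sub>R e" by (simp add: eq_neg_iff_add_eq_0)
      then show False using x by (metis span_base span_mul singletonI)
    qed
    have dH: "((\<lambda>s. H (x + s *\<^sub>R e)) has_vector_derivative K (x + \<tau> *\<^sub>R e)) (at \<tau>)" for \<tau>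
      using has_vector_derivative_mult[OF shift[OF dh[OF nz]] shift[OF d\<phi>], of x \<tau>]
      unfolding H_def K_def by simp
    have cl: "continuous_on {0..1} (\<lambda>\<tau>. x + \<tau> *\<^sub>R e)" by (intro continuous_intros)
    have dc: "continuous_on {0..1} (\<lambda>s. f (x + s *\<^sub>R e))"
      if "\<And>\<tau>. ((\<lambda>s. f (x + s *\<^sub>R e)) has_vector_derivative f' \<tau>) (at \<tau>)" for f :: "real^3 \<Rightarrow> complex" and f'
      using has_vector_derivative_continuous[OF that] by (simp add: continuous_at_imp_continuous_on)
    have cK: "continuous_on {0..1} (\<lambda>\<tau>. K (x + \<tau> *\<^sub>R e))"
      unfolding K_def using nz
      by (intro continuous_on_add continuous_on_mult dc[OF shift[OF dh[OF nz]]] dc[OF shift[OF d\<phi>]]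
          continuous_on_compose2[OF ch cl] continuous_on_compose2[OF c\<phi> cl]) auto
    have "((\<lambda>\<tau>. K (x + \<tau> *\<^sub>R e)) has_integral H (x + 1 *\<^sub>R e) - H (x + 0 *\<^sub>R e)) {0..1}"
      by (rule fundamental_theorem_of_calculus[where f="\<lambda>s. H (x + s *\<^sub>R e)"])
        (auto intro: has_vector_derivative_at_within[OF dH])
    then have "integral {0..1} (\<lambda>\<tau>. K (x + \<tau> *\<^sub>R e)) = H (x + e) - H x" by (simp add: integral_unique)
    then show ?thesis
      using set_borel_integral_eq_integral(2)[OF borel_integrable_atLeastAtMost'[OF cK]]
      by (simp add: g_def set_lebesgue_integral_def)
  qed
  have ae: "AE x in lborel. x \<notin> span {e}"
  proof -
    have "dim (span {e}) \<le> card {e}" unfolding dim_span by (rule dim_le_card') simp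
    then have "negligible (span {e})" by (intro negligible_lowdim) simp
    then have "span {e} \<in> null_sets lborel"
      unfolding negligible_iff_null_sets by (subst (asm) null_sets_completion_iff) (auto intro: borel_closed closed_subspace subspace_span)
    then show ?thesis by (rule AE_not_in)
  qed
  have "(\<integral>x. K x \<partial>lborel) = (\<integral>\<tau>. indicator {0..1} \<tau> *\<^sub>R (\<integral>x. K x \<partial>lborel) \<partial>(lborel :: real measure))"
    by simp
  also have "\<dots> = (\<integral>\<tau>. \<integral>x. g \<tau> x \<partial>lborel \<partial>lborel)"
    unfolding g_def by (simp add: tr(2)[OF iK])
  also have "\<dots> = (\<integral>x. \<integral>\<tau>. g \<tau> x \<partial>lborel \<partial>lborel)"
    by (rule lborel_pair.Fubini_integral[OF gi, symmetric])
  also have "\<dots> = (\<integral>x. H (x + e) - H x \<partial>lborel)"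
  proof (rule integral_cong_AE)
    show "(\<lambda>x. \<integral>\<tau>. g \<tau> x \<partial>lborel) \<in> borel_measurable lborel" unfolding g_def by measurable
    show "(\<lambda>x. H (x + e) - H x) \<in> borel_measurable lborel" using tr(1)[OF iH, of e] iH by auto
    show "AE x in lborel. (\<integral>\<tau>. g \<tau> x \<partial>lborel) = H (x + e) - H x" using ae by eventually_elim (rule line)
  qed
  also have "\<dots> = 0" using tr[OF iH, of e] iH by simp
  finally have "(\<integral>x. h x * \<phi>i x \<partial>lborel) + (\<integral>x. hi x * \<phi> x \<partial>lborel) = 0"
    unfolding K_def using int by simp
  then show ?thesis by (simp add: eq_neg_iff_add_eq_0)
qed

lemma test_functionsE:
  assumes "\<phi> \<in> test_functions"
  obtains R B where "0 < R" "\<And>x. norm (\<phi> x) \<le> B" "\<And>i x. norm (partial_deriv i \<phi> x) \<le> B"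
    "\<And>x. R < norm x \<Longrightarrow> \<phi> x = 0" "\<And>i x. R < norm x \<Longrightarrow> partial_deriv i \<phi> x = 0"
    "\<And>i x. ((\<lambda>t. \<phi> (x + t *\<^sub>R axis i 1)) has_vector_derivative partial_deriv i \<phi> x) (at 0)"
    "continuous_on UNIV \<phi>" "\<And>i. continuous_on UNIV (partial_deriv i \<phi>)"
proof -
  have "Ck (Suc 0) \<phi>" and comp: "compact (closure {x. \<phi> x \<noteq> 0})"
    using assms by (auto simp: test_functions_def)
  then have df: "\<And>x. \<phi> differentiable (at x)" and cp: "\<And>i. continuous_on UNIV (partial_deriv i \<phi>)"
    by (auto simp: partial_deriv_def[abs_def])
  have c: "continuous_on UNIV \<phi>"
    using df by (simp add: continuous_on_eq_continuous_at differentiable_imp_continuous_within)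
  have dv: "((\<lambda>t. \<phi> (x + t *\<^sub>R axis i 1)) has_vector_derivative partial_deriv i \<phi> x) (at 0)" for i x
  proof -
    let ?D = "frechet_derivative \<phi> (at x)"
    have 1: "(\<phi> has_derivative ?D) (at (x + 0 *\<^sub>R axis i 1))" using df[of x] by (simp add: frechet_derivative_works)
    have 2: "((\<lambda>t::real. x + t *\<^sub>R axis i 1) has_derivative (\<lambda>t. t *\<^sub>R axis i 1)) (at 0)"
      by (auto intro!: derivative_eq_intros)
    have "((\<lambda>t. \<phi> (x + t *\<^sub>R axis i 1)) has_derivative (\<lambda>t. ?D (t *\<^sub>R axis i 1))) (at 0)"
      using has_derivative_compose[OF 2, of \<phi> ?D] 1 by simp
    moreover have "?D (t *\<^sub>R axis i 1) = t *\<^sub>R ?D (axis i 1)" for t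
      using has_derivative_linear[OF 1] by (rule linear_scale)
    ultimately show ?thesis by (simp add: has_vector_derivative_def partial_deriv_def)
  qed
  obtain R where R: "0 < R" "\<And>x. x \<in> closure {x. \<phi> x \<noteq> 0} \<Longrightarrow> norm x \<le> R"
    using compact_imp_bounded[OF comp] by (auto simp: bounded_pos)
  have z: "\<phi> x = 0" if "R < norm x" for x
  proof (rule ccontr)
    assume "\<phi> x \<noteq> 0"
    then have "x \<in> closure {x. \<phi> x \<noteq> 0}" using closure_subset by fastforce
    then show False using R(2) that by (metis not_less)
  qed
  have pz: "partial_deriv i \<phi> x = 0" if "R < norm x" for i x
  proof -

    have "((\<lambda>t. \<phi> (x + t *\<^sub>R axis i 1)) has_vector_derivative 0) (at 0)"
      by (rule has_vector_derivative_transform_within_open[of "\<lambda>_. 0" _ _ "{t. R < norm (x + t *\<^sub>R axis i 1)}"])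
        (use that z in \<open>auto intro!: open_Collect_less continuous_intros\<close>)
    then show ?thesis using dv vector_derivative_unique_at by blast
  qed
  have bd: "\<exists>B. \<forall>x. norm (f x) \<le> B"
    if "continuous_on UNIV f" "\<And>x. R < norm x \<Longrightarrow> f x = 0" for f :: "real^3 \<Rightarrow> complex"
  proof -
    have "compact (f ` cball 0 R)"
      by (intro compact_continuous_image continuous_on_subset[OF that(1)]) auto
    then have "bounded (f ` cball 0 R)" by (rule compact_imp_bounded)
    then obtain B where "0 < B" "\<forall>y\<in>f ` cball 0 R. norm y \<le> B" unfolding bounded_pos by blast
    then have B: "norm (f x) \<le> B" if "norm x \<le> R" for x using that by simp
    have "norm (f x) \<le> B" for x using B[of x] that(2)[of x] \<open>0 < B\<close> by (cases "norm x \<le> R") auto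
    then show ?thesis by blast
  qed
  obtain B0 where B0: "\<And>x. norm (\<phi> x) \<le> B0" using bd[OF c z] by blast
  have "\<forall>i. \<exists>B. \<forall>x. norm (partial_deriv i \<phi> x) \<le> B" using bd[OF cp pz] by blast
  then obtain B1 where B1: "\<And>i x. norm (partial_deriv i \<phi> x) \<le> B1 i" by metis
  define B where "B = max B0 (Max (range B1))"
  show thesis
  proof (rule that[OF R(1) _ _ z pz dv c cp])
    show "norm (\<phi> x) \<le> B" for x using B0[of x] by (simp add: B_def)
    show "norm (partial_deriv i \<phi> x) \<le> B" for i x
      using order_trans[OF B1[of i x] Max_ge[of "range B1" "B1 i"]] by (simp add: B_def)
  qed
qed

section \<open>Integrability criteria for radially bounded functions\<close>

lemma AE_nonzero: "AE x in (lborel :: (real^3) measure). x \<noteq> 0"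
  by (rule AE_lborel_singleton)

lemma radial_integrable:
  fixes f :: "real^3 \<Rightarrow> 'b::{banach, second_countable_topology}"
  assumes [measurable]: "f \<in> borel_measurable borel"
    and le: "\<And>x. x \<noteq> 0 \<Longrightarrow> norm (f x) \<le> K (norm x)"
    and int: "integrable lborel (\<lambda>r. indicator {0<..} r * (r\<^sup>2 * K r))" and K0: "\<And>r. 0 < r \<Longrightarrow> 0 \<le> K r"
  shows "integrable lborel f"
proof (rule integrableI_bounded)
  \<comment> \<open>Measurability is known only for the weighted profile on the positive axis.
    Dividing by \<open>r\<^sup>2\<close> yields a measurable function agreeing with \<open>K\<close>
    there.\<close>
  define L where "L r = (indicator {0<..} r * (r\<^sup>2 * K r)) / r\<^sup>2" for r
  have [measurable]: "L \<in> borel_measurable borel"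
    unfolding L_def using borel_measurable_integrable[OF int] by measurable
  have L: "L r = K r" if "0 < r" for r using that by (simp add: L_def)
  have "(\<integral>\<^sup>+x. ennreal (norm (f x)) \<partial>lborel) \<le> (\<integral>\<^sup>+(x :: real^3). ennreal (L (norm x)) \<partial>lborel)"
  proof (rule nn_integral_mono_AE)
    show "AE x in lborel. ennreal (norm (f x)) \<le> ennreal (L (norm x))"
      using AE_nonzero by eventually_elim (use le L in \<open>auto intro!: ennreal_leI\<close>)
  qed
  also have "\<dots> = (\<integral>\<^sup>+s. ennreal (4 * pi * s\<^sup>2) * indicator {0..} s * ennreal (L s) \<partial>lborel)"
    by (rule radial_nn_integral) measurable
  also have "\<dots> = (\<integral>\<^sup>+s. ennreal (4 * pi * (indicator {0<..} s * (s\<^sup>2 * K s))) \<partial>lborel)"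
  proof (intro nn_integral_cong)
    fix s :: real
    show "ennreal (4 * pi * s\<^sup>2) * indicator {0..} s * ennreal (L s) = ennreal (4 * pi * (indicator {0<..} s * (s\<^sup>2 * K s)))"
      using L[of s] K0[of s] by (cases "0 < s"; cases "s = 0") (auto simp: ennreal_mult'[symmetric] mult.assoc)
  qed
  also have "\<dots> < \<infinity>"
  proof -
    have "integrable lborel (\<lambda>s. 4 * pi * (indicator {0<..} s * (s\<^sup>2 * K s)))" using int by (rule integrable_mult_right)
    then have "(\<integral>\<^sup>+s. ennreal (norm (4 * pi * (indicator {0<..} s * (s\<^sup>2 * K s)))) \<partial>lborel) < \<infinity>"
      unfolding integrable_iff_bounded by (rule conjunct2)
    moreover have "norm (4 * pi * (indicator {0<..} s * (s\<^sup>2 * K s))) = 4 * pi * (indicator {0<..} s * (s\<^sup>2 * K s))" for s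
      using K0[of s] by (auto simp: indicator_def)
    ultimately show ?thesis by simp
  qed
  finally show "(\<integral>\<^sup>+x. ennreal (norm (f x)) \<partial>lborel) < \<infinity>" .
qed simp

lemma radial_integrable_cutoff:
  fixes f \<phi> :: "real^3 \<Rightarrow> complex"
  assumes [measurable]: "f \<in> borel_measurable borel" "\<phi> \<in> borel_measurable borel"
    and le: "\<And>x. x \<noteq> 0 \<Longrightarrow> norm (f x) \<le> K (norm x)"
    and int: "integrable lborel (\<lambda>r. indicator {0<..R} r * (r\<^sup>2 * K r))" and K0: "\<And>r. 0 < r \<Longrightarrow> 0 \<le> K r"
    and \<phi>: "\<And>x. norm (\<phi> x) \<le> B" "\<And>x. R < norm x \<Longrightarrow> \<phi> x = 0"
  shows "integrable lborel (\<lambda>x. f x * \<phi> x)"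
proof (rule radial_integrable[where K="\<lambda>r. indicator {..R} r * (B * K r)"])
  have B: "0 \<le> B" using order_trans[OF norm_ge_zero \<phi>(1)] .
  show "norm (f x * \<phi> x) \<le> indicator {..R} (norm x) * (B * K (norm x))" if "x \<noteq> 0" for x
    using mult_mono[OF le[OF that] \<phi>(1)[of x]] K0[of "norm x"] that \<phi>(2)[of x]
    by (cases "norm x \<le> R") (auto simp: norm_mult mult.commute)
  have "(\<lambda>r. indicator {0<..} r * (r\<^sup>2 * (indicator {..R} r * (B * K r)))) = (\<lambda>r. B * (indicator {0<..R} r * (r\<^sup>2 * K r)))"
    by (auto simp: indicator_def)
  then show "integrable lborel (\<lambda>r. indicator {0<..} r * (r\<^sup>2 * (indicator {..R} r * (B * K r))))"
    using int by simp
  show "0 \<le> indicator {..R} r * (B * K r)" if "0 < r" for r using K0[OF that] B by auto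
qed measurable

lemma norm_line_derivative:
  fixes x :: "real^'n"
  assumes "x \<noteq> 0"
  shows "((\<lambda>t. norm (x + t *\<^sub>R axis i 1)) has_real_derivative x $ i / norm x) (at 0)"
proof -
  have "((\<lambda>t::real. x + t *\<^sub>R axis i 1) has_derivative (\<lambda>t. t *\<^sub>R axis i 1)) (at 0)"
    by (auto intro!: derivative_eq_intros)
  from has_derivative_compose[OF this, of norm "\<lambda>y. y \<bullet> sgn x"] has_derivative_norm[OF assms]
  have "((\<lambda>t. norm (x + t *\<^sub>R axis i 1)) has_derivative (\<lambda>t. (t *\<^sub>R axis i 1) \<bullet> sgn x)) (at 0)" by simp
  moreover have "(\<lambda>t. (t *\<^sub>R axis i 1) \<bullet> sgn x) = (*) (x $ i / norm x)"
    by (auto simp: sgn_div_norm inner_axis' divide_inverse)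
  ultimately show ?thesis by (simp add: has_field_derivative_def)
qed

section \<open>The solution in three dimensions\<close>

lemma indicator_pos_mult: "(r \<le> 0 \<Longrightarrow> x = 0) \<Longrightarrow> indicator {0<..} r * x = x" for r x :: real
  by (cases "0 < r") auto

text \<open>Setting \<open>v1\<close> to 0 on the nonpositive axis makes it a measurable function on
  the whole line, so integrals over the half-line can be written over the line.\<close>

locale radial_ode =
  fixes p q \<nu> \<Lambda> A :: real and v v1 :: "real \<Rightarrow> real"
  assumes p: "10 / 3 < p" "p < 6" and q: "2 < q" "q < 8 / 3"
    and en: "energy_le v A" and sq: "integrable lborel (\<lambda>r. (v r)\<^sup>2)"
    and dv: "\<And>r. 0 < r \<Longrightarrow> (v has_real_derivative v1 r) (at r)"
    and dv1: "\<And>r. 0 < r \<Longrightarrow> (v1 has_real_derivative radial_force p q \<nu> \<Lambda> v r) (at r)"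
    and v1_nonpos: "\<And>r. r \<le> 0 \<Longrightarrow> v1 r = 0"
begin

abbreviation F :: "real \<Rightarrow> real" where "F \<equiv> radial_force p q \<nu> \<Lambda> v"

definition w :: "real \<Rightarrow> real" where "w r = v r / r"
definition w1 :: "real \<Rightarrow> real" where "w1 r = v1 r / r - v r / r\<^sup>2"

lemma v_nonpos: "r \<le> 0 \<Longrightarrow> v r = 0" using energy_le_zero[OF en] .

lemma v_cont: "continuous_on S v"
  using energy_le_continuous[OF en] continuous_on_subset by blast

lemma v_meas [measurable]: "v \<in> borel_measurable borel" using energy_le_measurable[OF en] .

lemma v1_cont: "continuous_on {0<..} v1"
  using dv1 by (intro continuous_at_imp_continuous_on) (auto intro: DERIV_isCont)

lemma v1_meas [measurable]: "v1 \<in> borel_measurable borel"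
proof -
  have "(\<lambda>r. indicator {0<..} r *\<^sub>R v1 r) \<in> borel_measurable borel"
    by (rule borel_measurable_continuous_on_indicator[OF _ v1_cont]) simp
  moreover have "(\<lambda>r. indicator {0<..} r *\<^sub>R v1 r) = v1" using v1_nonpos by (simp add: indicator_pos_mult)
  ultimately show ?thesis by simp
qed

lemma w_meas [measurable]: "w \<in> borel_measurable borel" unfolding w_def by measurable

lemma w1_meas [measurable]: "w1 \<in> borel_measurable borel" unfolding w1_def by measurable

lemma F_cont: "continuous_on {0<..} F"
  using p q by (intro radial_force_continuous[OF en sq]) auto

lemma F_zero: "r \<le> 0 \<Longrightarrow> F r = 0" by (simp add: radial_force_def v_nonpos)

lemma F_meas [measurable]: "F \<in> borel_measurable borel"
proof -
  have "(\<lambda>r. indicator {0<..} r *\<^sub>R F r) \<in> borel_measurable borel"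
    by (rule borel_measurable_continuous_on_indicator[OF _ F_cont]) simp
  moreover have "(\<lambda>r. indicator {0<..} r *\<^sub>R F r) = F" using F_zero by (simp add: indicator_pos_mult)
  ultimately show ?thesis by simp
qed

text \<open>
  The bound \<open>|F| \<le> C r\<^sup>-\<^sup>\<theta>\<close> near \<open>0\<close> gives \<open>v / r = O(r\<^sup>1\<^sup>-\<^sup>\<theta>)\<close>, which is square integrable because \<open>\<theta> < 3/2\<close>.
\<close>

definition \<theta> :: real where "\<theta> = max (5 / 4) ((p - 3) / 2)"

lemma \<theta>: "1 < \<theta>" "\<theta> < 3 / 2" "(p - 3) / 2 \<le> \<theta>"
  using p by (auto simp: \<theta>_def max_def)

lemma near_0:
  obtains C K where "0 \<le> C" "\<And>r. 0 < r \<Longrightarrow> r \<le> 1 \<Longrightarrow> \<bar>F r\<bar> \<le> C * r powr (- \<theta>)"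
    "0 \<le> K" "\<And>r. 0 < r \<Longrightarrow> r \<le> 1 \<Longrightarrow> \<bar>v r\<bar> \<le> K * r powr (2 - \<theta>)"
proof -
  obtain C where C: "0 \<le> C" "\<And>r. 0 < r \<Longrightarrow> r \<le> 1 \<Longrightarrow> \<bar>F r\<bar> \<le> C * r powr (- \<theta>)"
    using radial_force_near_0[OF en sq p q \<theta>(1,3)] by blast
  have ic: "isCont v 0" using v_cont[of UNIV] by (simp add: continuous_on_eq_continuous_at)
  show thesis
  proof (rule second_order_near_0[of v v1 F C \<theta>])
    fix K assume K: "0 \<le> K" "\<And>r. 0 < r \<Longrightarrow> r \<le> 1 \<Longrightarrow> \<bar>v r\<bar> \<le> K * r powr (2 - \<theta>)"
    show thesis by (rule that[of C K]) (use C K in simp_all)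
  qed (use dv dv1 C \<theta> ic v_nonpos in auto)
qed

lemma integrable_on_unit_then_compact:
  fixes f :: "real \<Rightarrow> real"
  assumes "f \<in> borel_measurable borel" "continuous_on {0<..} f"
    and "\<And>r. 0 < r \<Longrightarrow> r \<le> 1 \<Longrightarrow> \<bar>f r\<bar> \<le> C * r powr a" "-1 < a"
  shows "integrable lborel (\<lambda>r. indicator {0<..R} r * f r)"
proof -
  have 1: "integrable lborel (\<lambda>r. indicator {0<..1} r * f r)"
  proof (rule Bochner_Integration.integrable_bound)
    show "integrable lborel (\<lambda>r. C * (indicator {0..1} r * r powr a))"
      using integrable.intros[OF has_bochner_integral_powr_from_0[of a 1]] assms(4) by (intro integrable_mult_right) auto
    have "norm (indicator {0<..1} r * f r) \<le> norm (C * (indicator {0..1} r * r powr a))" for r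
    proof (cases "r \<in> {0<..1}")
      case True
      then have "\<bar>f r\<bar> \<le> \<bar>C * r powr a\<bar>" using assms(3)[of r] by (simp add: order_trans[OF _ abs_ge_self])
      then show ?thesis using True by simp
    qed simp
    then show "AE r in lborel. norm (indicator {0<..1} r * f r) \<le> norm (C * (indicator {0..1} r * r powr a))" by simp
  qed (use assms(1) in measurable)
  have 2: "integrable lborel (\<lambda>r. indicator {1..max 1 R} r *\<^sub>R f r)"
    using borel_integrable_atLeastAtMost'[OF continuous_on_subset[OF assms(2)], of 1 "max 1 R"]
    unfolding set_integrable_def by fastforce
  show ?thesis
  proof (rule Bochner_Integration.integrable_bound)
    show "integrable lborel (\<lambda>r. \<bar>indicator {0<..1} r * f r\<bar> + \<bar>indicator {1..max 1 R} r *\<^sub>R f r\<bar>)"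
      using 1 2 by (intro Bochner_Integration.integrable_add integrable_abs)
    show "AE r in lborel. norm (indicator {0<..R} r * f r) \<le> norm (\<bar>indicator {0<..1} r * f r\<bar> + \<bar>indicator {1..max 1 R} r *\<^sub>R f r\<bar>)"
      by (intro AE_I2) (auto simp: indicator_def)
  qed (use assms(1) in measurable)
qed

lemma v1_sq: "integrable lborel (\<lambda>r. (v1 r)\<^sup>2)"
proof -
  have "(\<lambda>r. indicator {0<..} r * (v1 r)\<^sup>2) = (\<lambda>r. (v1 r)\<^sup>2)" using v1_nonpos by (simp add: indicator_pos_mult)
  then show ?thesis using energy_le_derivative_square_integrable[OF en dv v1_cont] by simp
qed

text \<open>Plays the part of Hardy's inequality. The decay at the origin gives
  \<open>w\<^sup>2\<close> of order \<open>r powr (2 - 2 * \<theta>)\<close>, integrable since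
  \<open>\<theta> < 3 / 2\<close>; beyond 1 it is below \<open>v\<^sup>2\<close>.\<close>

lemma w_sq: "integrable lborel (\<lambda>r. (w r)\<^sup>2)"
proof -
  obtain C K where K: "0 \<le> K" "\<And>r. 0 < r \<Longrightarrow> r \<le> 1 \<Longrightarrow> \<bar>v r\<bar> \<le> K * r powr (2 - \<theta>)" using near_0 by metis
  have near: "integrable lborel (\<lambda>r. indicator {0<..1} r * (w r)\<^sup>2)"
  proof (rule integrable_on_unit_then_compact[where C="K\<^sup>2" and a="2 - 2 * \<theta>"])
    show "continuous_on {0<..} (\<lambda>r. (w r)\<^sup>2)" unfolding w_def by (intro continuous_intros v_cont) auto
    fix r :: real assume r: "0 < r" "r \<le> 1"
    have "\<bar>w r\<bar> \<le> K * r powr (2 - \<theta>) / r" using K(2)[OF r] r by (simp add: w_def divide_right_mono)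
    also have "\<dots> = K * r powr (1 - \<theta>)" using r powr_diff[of r "2 - \<theta>" 1] by simp
    finally have "\<bar>w r\<bar>\<^sup>2 \<le> (K * r powr (1 - \<theta>))\<^sup>2" by (intro power_mono) auto
    also have "\<dots> = K\<^sup>2 * (r powr (1 - \<theta>) * r powr (1 - \<theta>))" by (simp add: power_mult_distrib power2_eq_square)
    also have "r powr (1 - \<theta>) * r powr (1 - \<theta>) = r powr (2 - 2 * \<theta>)" by (simp add: powr_add[symmetric])
    finally show "\<bar>(w r)\<^sup>2\<bar> \<le> K\<^sup>2 * r powr (2 - 2 * \<theta>)" by simp
  qed (use \<theta> in auto)
  show ?thesis
  proof (rule Bochner_Integration.integrable_bound)
    show "integrable lborel (\<lambda>r. indicator {0<..1} r * (w r)\<^sup>2 + (v r)\<^sup>2)"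
      by (intro Bochner_Integration.integrable_add near sq)
    have "(w r)\<^sup>2 \<le> indicator {0<..1} r * (w r)\<^sup>2 + (v r)\<^sup>2" for r
    proof (cases "r \<le> 1")
      case True
      then show ?thesis using v_nonpos[of r] by (cases "0 < r") (auto simp: w_def)
    next
      case False
      then have "\<bar>v r\<bar> / r \<le> \<bar>v r\<bar> / 1" by (intro divide_left_mono) auto
      then have "\<bar>w r\<bar>\<^sup>2 \<le> \<bar>v r\<bar>\<^sup>2" using False by (intro power_mono) (auto simp: w_def)
      then show ?thesis using False by simp
    qed
    then show "AE r in lborel. norm ((w r)\<^sup>2) \<le> norm (indicator {0<..1} r * (w r)\<^sup>2 + (v r)\<^sup>2)"
      by (intro AE_I2) (auto intro: order_trans[OF _ abs_ge_self])
  qed measurable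
qed

lemma rw1: "0 < r \<Longrightarrow> r * w1 r = v1 r - w r"
  by (simp add: w1_def w_def field_simps power2_eq_square)

text \<open>This is square integrability of the gradient in three-space: \<open>r * w1 r\<close> is
  the difference of \<open>v1\<close> and \<open>w\<close>, both square integrable on the
  line.\<close>

lemma rw1_sq: "integrable lborel (\<lambda>r. indicator {0<..} r * (r * w1 r)\<^sup>2)"
proof (rule Bochner_Integration.integrable_bound)
  show "integrable lborel (\<lambda>r. 2 * (v1 r)\<^sup>2 + 2 * (w r)\<^sup>2)"
    by (intro Bochner_Integration.integrable_add integrable_mult_right v1_sq w_sq)
  have "indicator {0<..} r * (r * w1 r)\<^sup>2 \<le> 2 * (v1 r)\<^sup>2 + 2 * (w r)\<^sup>2" for r
  proof (cases "0 < r")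
    case True
    have "(v1 r - w r)\<^sup>2 \<le> 2 * (v1 r)\<^sup>2 + 2 * (w r)\<^sup>2"
      using zero_le_power2[of "v1 r + w r"] by (simp add: power2_sum power2_diff)
    then show ?thesis using True rw1 by simp
  qed simp
  then show "AE r in lborel. norm (indicator {0<..} r * (r * w1 r)\<^sup>2) \<le> norm (2 * (v1 r)\<^sup>2 + 2 * (w r)\<^sup>2)"
    by (intro AE_I2) (auto intro: order_trans[OF _ abs_ge_self])
qed measurable

lemma rw1_loc: "integrable lborel (\<lambda>r. indicator {0<..R} r * (r * \<bar>w1 r\<bar>))"
proof (rule Bochner_Integration.integrable_bound)
  show "integrable lborel (\<lambda>r. indicator {0..R} r + indicator {0<..} r * (r * w1 r)\<^sup>2)"
    by (intro Bochner_Integration.integrable_add rw1_sq) (auto simp: integrable_indicator_iff emeasure_lborel_Icc_eq)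
  have le: "\<bar>x\<bar> \<le> 1 + x\<^sup>2" for x :: real
    using zero_le_power2[of "\<bar>x\<bar> - 1"] zero_le_power2[of x] by (simp add: power2_diff)
  have "norm (indicator {0<..R} r * (r * \<bar>w1 r\<bar>)) \<le> norm (indicator {0..R} r + indicator {0<..} r * (r * w1 r)\<^sup>2)" for r
    using le[of "r * w1 r"] by (cases "r \<in> {0<..R}") (simp_all add: abs_mult)
  then show "AE r in lborel. norm (indicator {0<..R} r * (r * \<bar>w1 r\<bar>)) \<le> norm (indicator {0..R} r + indicator {0<..} r * (r * w1 r)\<^sup>2)"
    by simp
qed measurable

lemma rF_loc: "integrable lborel (\<lambda>r. indicator {0<..R} r * (r * \<bar>F r\<bar>))"
proof -
  obtain C where C: "0 \<le> C" "\<And>r. 0 < r \<Longrightarrow> r \<le> 1 \<Longrightarrow> \<bar>F r\<bar> \<le> C * r powr (- \<theta>)" using near_0 by metis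
  show ?thesis
  proof (rule integrable_on_unit_then_compact[where C=C and a="1 - \<theta>"])
    show "continuous_on {0<..} (\<lambda>r. r * \<bar>F r\<bar>)" by (intro continuous_intros F_cont)
    fix r :: real assume r: "0 < r" "r \<le> 1"
    have "r * \<bar>F r\<bar> \<le> r * (C * r powr (- \<theta>))" using C(2)[OF r] r by (intro mult_left_mono) auto
    also have "\<dots> = C * r powr (1 - \<theta>)" using r powr_add[of r 1 "- \<theta>"] by simp
    finally show "\<bar>r * \<bar>F r\<bar>\<bar> \<le> C * r powr (1 - \<theta>)" using r by simp
  qed (use \<theta> in auto)
qed

lemma rv_loc: "integrable lborel (\<lambda>r. indicator {0<..R} r * (r * \<bar>v r\<bar>))"
proof (rule integrable_on_unit_then_compact[where C="sqrt A" and a=0])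
  fix r :: real assume r: "0 < r" "r \<le> 1"
  have "\<bar>v r\<bar> \<le> sqrt (A * r)" using energy_le_point[OF en, of r] r by (intro real_le_rsqrt) auto
  also have "\<dots> \<le> sqrt (A * 1)" using r energy_le_nonneg[OF en] by (intro real_sqrt_le_mono mult_left_mono) auto
  finally have "r * \<bar>v r\<bar> \<le> 1 * sqrt A" using r by (intro mult_mono) auto
  then show "\<bar>r * \<bar>v r\<bar>\<bar> \<le> sqrt A * r powr 0" using r by simp
qed (auto intro!: continuous_intros v_cont)

lemma power_loc:
  assumes "2 < e" "e < 6"
  shows "integrable lborel (\<lambda>r. indicator {0<..R} r * (r\<^sup>2 * (\<bar>w r\<bar> powr (e - 2) * \<bar>w r\<bar>)))"
proof (rule integrable_on_unit_then_compact[where C="A powr ((e - 1) / 2)" and a="(5 - e) / 2"])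
  show "continuous_on {0<..} (\<lambda>r. r\<^sup>2 * (\<bar>w r\<bar> powr (e - 2) * \<bar>w r\<bar>))"
    unfolding w_def using assms by (intro continuous_intros v_cont continuous_on_powr') auto
  fix r :: real assume r: "0 < r" "r \<le> 1"
  have "\<bar>w r\<bar> powr (e - 2) * \<bar>w r\<bar> = \<bar>w r\<bar> powr (e - 1)"
    using powr_add[of "\<bar>w r\<bar>" "e - 2" 1] by (cases "w r = 0") auto
  also have "\<dots> = \<bar>v r\<bar> powr (e - 1) / r powr (e - 1)" using r by (simp add: w_def powr_divide)
  also have "\<dots> \<le> A powr ((e - 1) / 2) * r powr ((e - 1) / 2) / r powr (e - 1)"
    using r assms by (intro divide_right_mono energy_le_point_powr[OF en]) auto
  also have "\<dots> = A powr ((e - 1) / 2) * r powr ((e - 1) / 2 - (e - 1))"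
    by (simp only: powr_diff times_divide_eq_right)
  finally have "r powr 2 * (\<bar>w r\<bar> powr (e - 2) * \<bar>w r\<bar>) \<le> r powr 2 * (A powr ((e - 1) / 2) * r powr ((e - 1) / 2 - (e - 1)))"
    by (intro mult_left_mono) auto
  also have "\<dots> = A powr ((e - 1) / 2) * r powr (2 + ((e - 1) / 2 - (e - 1)))" by (simp only: powr_add mult.left_commute)
  also have "2 + ((e - 1) / 2 - (e - 1)) = (5 - e) / 2" by (simp add: field_simps)
  finally show "\<bar>r\<^sup>2 * (\<bar>w r\<bar> powr (e - 2) * \<bar>w r\<bar>)\<bar> \<le> A powr ((e - 1) / 2) * r powr ((5 - e) / 2)"
    using r by (simp add: abs_mult)
qed (use assms in auto)

section \<open>The function on three-space: derivatives, mass and potential\<close>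

definition u :: "real^3 \<Rightarrow> complex" where "u x = of_real (w (norm x))"

definition g :: "real^3 \<Rightarrow> complex^3" where
  "g x = (\<chi> i. of_real (w1 (norm x) / norm x * x $ i))"

text \<open>The pure second derivative of \<open>u\<close> in direction \<open>i\<close> away from
  the origin, that is, the derivative of \<open>w1 (norm x) / norm x * x $ i\<close>, with
  \<open>v''\<close> replaced by \<open>F\<close>.\<close>

definition dg :: "3 \<Rightarrow> real^3 \<Rightarrow> complex" where
  "dg i x = of_real ((F (norm x) - 3 * w1 (norm x)) / norm x ^ 3 * (x $ i)\<^sup>2 + w1 (norm x) / norm x)"

lemma dw: "0 < r \<Longrightarrow> (w has_real_derivative w1 r) (at r)"
  unfolding w_def[abs_def] w1_def using dv[of r]
  by (auto intro!: derivative_eq_intros simp: field_simps power2_eq_square)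

lemma dw1: "0 < r \<Longrightarrow> ((\<lambda>r. w1 r / r) has_real_derivative (F r - 3 * w1 r) / r\<^sup>2) (at r)"
proof -
  assume r: "0 < r"
  have "(w1 has_real_derivative (F r / r - v1 r / r\<^sup>2) - (v1 r / r\<^sup>2 - 2 * v r / r ^ 3)) (at r)"
    unfolding w1_def[abs_def] using dv[OF r] dv1[OF r] r
    by (auto intro!: derivative_eq_intros simp: field_simps power2_eq_square power3_eq_cube)
  then have "((\<lambda>r. w1 r / r) has_real_derivative
      (((F r / r - v1 r / r\<^sup>2) - (v1 r / r\<^sup>2 - 2 * v r / r ^ 3)) * r - w1 r) / r\<^sup>2) (at r)"
    using r by (auto intro!: derivative_eq_intros simp: power2_eq_square)
  moreover have "((F r / r - v1 r / r\<^sup>2) - (v1 r / r\<^sup>2 - 2 * v r / r ^ 3)) * r - w1 r = F r - 3 * w1 r"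
    using r by (simp add: w1_def field_simps power2_eq_square power3_eq_cube)
  ultimately show ?thesis by (simp only:)
qed

lemma u_meas [measurable]: "u \<in> borel_measurable borel" unfolding u_def by measurable

lemma g_nth_meas [measurable]: "(\<lambda>x. g x $ i) \<in> borel_measurable borel"
proof -
  have [measurable]: "(\<lambda>x::real^3. x $ i) \<in> borel_measurable borel"
    by (intro borel_measurable_continuous_onI continuous_intros)
  show ?thesis unfolding g_def by (simp) 
qed

lemma g_meas: "g \<in> borel_measurable borel"
proof -
  have [measurable]: "(\<lambda>x::real^3. (\<chi> i. complex_of_real (x $ i))) \<in> borel_measurable borel"
    by (intro borel_measurable_continuous_onI continuous_on_vec_lambda continuous_intros)
  have "g = (\<lambda>x. (w1 (norm x) / norm x) *\<^sub>R (\<chi> i. complex_of_real (x $ i)))"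
    by (auto simp: g_def fun_eq_iff vec_eq_iff scaleR_conv_of_real[where 'a=complex])
  then show ?thesis by simp
qed

lemma dg_meas [measurable]: "dg i \<in> borel_measurable borel"
proof -
  have [measurable]: "(\<lambda>x::real^3. x $ i) \<in> borel_measurable borel"
    by (intro borel_measurable_continuous_onI continuous_intros)
  show ?thesis unfolding dg_def by measurable
qed

lemma norm_g: "norm (g x) = \<bar>w1 (norm x)\<bar>"
proof (cases "x = 0")
  case False
  have "norm (g x) = norm ((w1 (norm x) / norm x) *\<^sub>R (\<chi> i. complex_of_real (x $ i)))"
    by (rule arg_cong[where f=norm]) (auto simp: g_def vec_eq_iff scaleR_conv_of_real[where 'a=complex])
  also have "\<dots> = \<bar>w1 (norm x) / norm x\<bar> * norm x"
  proof -
    have "norm (\<chi> i. complex_of_real (x $ i)) = norm x" by (simp add: norm_vec_def)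
    then show ?thesis by (simp only: norm_scaleR)
  qed
  finally show ?thesis using False by simp
qed (simp add: g_def w1_def v1_nonpos v_nonpos norm_vec_def L2_set_def)

lemma u_L2: "u \<in> L2"
  unfolding L2_def
proof (intro CollectI conjI)
  show "integrable lborel (\<lambda>x. (norm (u x))\<^sup>2)"
  proof (rule radial_integrable[where K="\<lambda>r. (w r)\<^sup>2"])
    have "(\<lambda>r. indicator {0<..} r * (r\<^sup>2 * (w r)\<^sup>2)) = (\<lambda>r. (v r)\<^sup>2)"
      using v_nonpos by (auto simp: indicator_def w_def power_divide not_less fun_eq_iff)
    then show "integrable lborel (\<lambda>r. indicator {0<..} r * (r\<^sup>2 * (w r)\<^sup>2))" using sq by simp
  qed (auto simp: u_def)
qed simp

lemma g_L2: "g \<in> L2"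
  unfolding L2_def
proof (intro CollectI conjI)
  have [measurable]: "g \<in> borel_measurable borel" by (rule g_meas)
  then show "g \<in> borel_measurable lborel" by simp
  show "integrable lborel (\<lambda>x. (norm (g x))\<^sup>2)"
  proof (rule radial_integrable[where K="\<lambda>r. (w1 r)\<^sup>2"])
    show "integrable lborel (\<lambda>r. indicator {0<..} r * (r\<^sup>2 * (w1 r)\<^sup>2))"
      using rw1_sq by (simp add: power_mult_distrib)
  qed (auto simp: norm_g)
qed

lemma u_mass: "(LINT x|lborel. (norm (u x))\<^sup>2) = 4 * pi * mass v"
proof -
  have "ennreal (LINT x|lborel. (norm (u x))\<^sup>2) = (\<integral>\<^sup>+x. ennreal ((w (norm x))\<^sup>2) \<partial>(lborel :: (real^3) measure))"
    using u_L2 by (subst nn_integral_eq_integral[symmetric]) (auto simp: L2_def u_def)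
  also have "\<dots> = (\<integral>\<^sup>+s. ennreal (4 * pi * s\<^sup>2) * indicator {0..} s * ennreal ((w s)\<^sup>2) \<partial>lborel)"
    by (rule radial_nn_integral) measurable
  also have "\<dots> = (\<integral>\<^sup>+s. ennreal (4 * pi * (v s)\<^sup>2) \<partial>lborel)"
  proof (intro nn_integral_cong)
    fix s :: real
    show "ennreal (4 * pi * s\<^sup>2) * indicator {0..} s * ennreal ((w s)\<^sup>2) = ennreal (4 * pi * (v s)\<^sup>2)"
      using v_nonpos[of s]
      by (cases "0 < s") (auto simp: ennreal_mult'[symmetric] w_def power_divide indicator_def not_less)
  qed
  also have "\<dots> = ennreal (4 * pi * mass v)"
    unfolding mass_def using sq by (subst nn_integral_eq_integral) auto
  finally show ?thesis using mass_nonneg[of v] by simp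
qed

text \<open>Newton's theorem together with \<open>s\<^sup>2 * (w s)\<^sup>2 = (v s)\<^sup>2\<close>.
  Finiteness of the radial potential supplies integrability of the convolution integrand.\<close>

lemma coulomb_u:
  assumes x: "x \<noteq> 0"
  shows "integrable lborel (\<lambda>y. 1 / norm (x - y) * (norm (u y))\<^sup>2)"
    and "coulomb_potential u x = pot (\<lambda>r. (v r)\<^sup>2) (norm x)"
proof -
  note pc = pot_class_square(1)[OF en sq]
  have "(\<integral>\<^sup>+y. ennreal (1 / norm (x - y) * (norm (u y))\<^sup>2) \<partial>lborel)
      = (\<integral>\<^sup>+y. ennreal (1 / norm (x - y)) * ennreal ((w (norm y))\<^sup>2) \<partial>lborel)"
    by (intro nn_integral_cong) (simp add: u_def ennreal_mult'[symmetric])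
  also have "\<dots> = (\<integral>\<^sup>+s. ennreal (4 * pi * s\<^sup>2 / max (norm x) s) * indicator {0..} s * ennreal ((w s)\<^sup>2) \<partial>lborel)"
    by (rule newton[OF _ x]) measurable
  also have "\<dots> = (\<integral>\<^sup>+s. ennreal (4 * pi / max (norm x) s * (v s)\<^sup>2) \<partial>lborel)"
  proof (intro nn_integral_cong)
    fix s :: real
    show "ennreal (4 * pi * s\<^sup>2 / max (norm x) s) * indicator {0..} s * ennreal ((w s)\<^sup>2) = ennreal (4 * pi / max (norm x) s * (v s)\<^sup>2)"
    proof (cases "0 < s")
      case True
      then have "4 * pi * s\<^sup>2 / max (norm x) s * (w s)\<^sup>2 = 4 * pi / max (norm x) s * (v s)\<^sup>2"
        by (simp add: w_def power_divide)
      then show ?thesis using True by (simp add: ennreal_mult'[symmetric])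
    next
      case False
      then show ?thesis using v_nonpos[of s] by (auto simp: indicator_def not_less w_def)
    qed
  qed
  also have "\<dots> = ennreal (pot (\<lambda>r. (v r)\<^sup>2) (norm x))"
  proof -
    have "0 \<le> 4 * pi / max (norm x) s * (v s)\<^sup>2" for s using x by (simp add: le_max_iff_disj)
    then show ?thesis unfolding pot_def using pot_integrand_integrable[OF pc]
      by (intro nn_integral_eq_integral) auto
  qed
  finally have nn: "(\<integral>\<^sup>+y. ennreal (1 / norm (x - y) * (norm (u y))\<^sup>2) \<partial>lborel) = ennreal (pot (\<lambda>r. (v r)\<^sup>2) (norm x))" .
  have pos: "0 \<le> pot (\<lambda>r. (v r)\<^sup>2) (norm x)"
    unfolding pot_def using x by (intro Bochner_Integration.integral_nonneg) (simp add: le_max_iff_disj)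
  have "has_bochner_integral lborel (\<lambda>y. 1 / norm (x - y) * (norm (u y))\<^sup>2) (pot (\<lambda>r. (v r)\<^sup>2) (norm x))"
    by (rule has_bochner_integral_nn_integral[OF _ _ pos nn]) auto
  then show "integrable lborel (\<lambda>y. 1 / norm (x - y) * (norm (u y))\<^sup>2)"
    "coulomb_potential u x = pot (\<lambda>r. (v r)\<^sup>2) (norm x)"
    by (auto simp: coulomb_potential_def conv_def has_bochner_integral_iff)
qed

lemma line_chain:
  assumes "x \<noteq> 0" "(f has_real_derivative f') (at (norm x))"
  shows "((\<lambda>t. f (norm (x + t *\<^sub>R axis i 1))) has_real_derivative f' * (x $ i / norm x)) (at 0)"
  using DERIV_chain2[of f f' "\<lambda>t. norm (x + t *\<^sub>R axis i 1)" 0 "x $ i / norm x" UNIV] assms norm_line_derivative[OF assms(1), of i]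
  by simp

lemma of_real_line:
  assumes "(f has_real_derivative f') (at 0)"
  shows "((\<lambda>t. complex_of_real (f t)) has_vector_derivative complex_of_real f') (at 0)"
  using assms has_vector_derivative_of_real has_real_derivative_iff_has_vector_derivative by blast

lemma du:
  assumes "x \<noteq> 0"
  shows "((\<lambda>t. u (x + t *\<^sub>R axis i 1)) has_vector_derivative g x $ i) (at 0)"
  using of_real_line[OF line_chain[OF assms dw, of i]] assms by (simp add: u_def g_def)

lemma dg:
  assumes "x \<noteq> 0"
  shows "((\<lambda>t. g (x + t *\<^sub>R axis i 1) $ i) has_vector_derivative dg i x) (at 0)"
proof -
  have "((\<lambda>t. w1 (norm (x + t *\<^sub>R axis i 1)) / norm (x + t *\<^sub>R axis i 1)) has_real_derivative
      (F (norm x) - 3 * w1 (norm x)) / (norm x)\<^sup>2 * (x $ i / norm x)) (at 0)"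
    using line_chain[OF assms dw1, of i] assms by simp
  moreover have "((\<lambda>t. (x + t *\<^sub>R axis i 1) $ i) has_real_derivative 1) (at 0)"
    by (auto intro!: derivative_eq_intros)
  ultimately have "((\<lambda>t. w1 (norm (x + t *\<^sub>R axis i 1)) / norm (x + t *\<^sub>R axis i 1) * (x + t *\<^sub>R axis i 1) $ i) has_real_derivative
     ((F (norm x) - 3 * w1 (norm x)) / (norm x)\<^sup>2 * (x $ i / norm x)) * ((x + 0 *\<^sub>R axis i 1) $ i) + 1 * (w1 (norm (x + 0 *\<^sub>R axis i 1)) / norm (x + 0 *\<^sub>R axis i 1))) (at 0)"
    by (rule DERIV_mult)
  moreover have "((F (norm x) - 3 * w1 (norm x)) / (norm x)\<^sup>2 * (x $ i / norm x)) * ((x + 0 *\<^sub>R axis i 1) $ i) + 1 * (w1 (norm (x + 0 *\<^sub>R axis i 1)) / norm (x + 0 *\<^sub>R axis i 1))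
      = (F (norm x) - 3 * w1 (norm x)) / norm x ^ 3 * (x $ i)\<^sup>2 + w1 (norm x) / norm x"
    by (simp add: power2_eq_square power3_eq_cube)
  ultimately have D: "((\<lambda>t. w1 (norm (x + t *\<^sub>R axis i 1)) / norm (x + t *\<^sub>R axis i 1) * (x + t *\<^sub>R axis i 1) $ i) has_real_derivative
     (F (norm x) - 3 * w1 (norm x)) / norm x ^ 3 * (x $ i)\<^sup>2 + w1 (norm x) / norm x) (at 0)"
    by (simp only:)
  show ?thesis
    using of_real_line[OF D] unfolding g_def dg_def vec_lambda_beta .
qed

lemma w1_cont: "continuous_on {0<..} w1"
  unfolding w1_def by (intro continuous_intros v_cont v1_cont) auto

lemma g_cont: "continuous_on (- {0}) (\<lambda>x. g x $ i)"
  unfolding g_def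
  by (auto intro!: continuous_intros continuous_on_compose2[OF w1_cont])

lemma dg_cont: "continuous_on (- {0}) (dg i)"
  unfolding dg_def
  by (auto intro!: continuous_intros continuous_on_compose2[OF w1_cont] continuous_on_compose2[OF F_cont])

lemma g_nth_le: "norm (g x $ i) \<le> \<bar>w1 (norm x)\<bar>"
  using Finite_Cartesian_Product.norm_nth_le[of "g x" i] norm_g by simp

lemma dg_le:
  assumes "x \<noteq> 0"
  shows "norm (dg i x) \<le> (\<bar>F (norm x)\<bar> + 4 * \<bar>w1 (norm x)\<bar>) / norm x"
proof -
  have "(x $ i)\<^sup>2 \<le> (norm x)\<^sup>2" using component_le_norm_cart[of x i] by (metis abs_le_square_iff abs_norm_cancel)
  then have "\<bar>F (norm x) - 3 * w1 (norm x)\<bar> / norm x ^ 3 * (x $ i)\<^sup>2 \<le> \<bar>F (norm x) - 3 * w1 (norm x)\<bar> / norm x ^ 3 * (norm x)\<^sup>2"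
    by (intro mult_left_mono) auto
  also have "\<dots> = \<bar>F (norm x) - 3 * w1 (norm x)\<bar> / norm x" using assms by (simp add: power2_eq_square power3_eq_cube)
  also have "\<dots> \<le> (\<bar>F (norm x)\<bar> + 3 * \<bar>w1 (norm x)\<bar>) / norm x"
    by (intro divide_right_mono) auto
  finally have 1: "\<bar>F (norm x) - 3 * w1 (norm x)\<bar> / norm x ^ 3 * (x $ i)\<^sup>2 \<le> (\<bar>F (norm x)\<bar> + 3 * \<bar>w1 (norm x)\<bar>) / norm x" .
  have "norm (dg i x) = \<bar>(F (norm x) - 3 * w1 (norm x)) / norm x ^ 3 * (x $ i)\<^sup>2 + w1 (norm x) / norm x\<bar>"
    unfolding dg_def by (rule norm_of_real)
  also have "\<dots> \<le> \<bar>(F (norm x) - 3 * w1 (norm x)) / norm x ^ 3 * (x $ i)\<^sup>2\<bar> + \<bar>w1 (norm x) / norm x\<bar>"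
    by (rule abs_triangle_ineq)
  also have "\<dots> \<le> (\<bar>F (norm x)\<bar> + 3 * \<bar>w1 (norm x)\<bar>) / norm x + \<bar>w1 (norm x)\<bar> / norm x"
    using 1 by (simp add: abs_mult)
  also have "\<dots> = (\<bar>F (norm x)\<bar> + 4 * \<bar>w1 (norm x)\<bar>) / norm x" by (simp add: add_divide_distrib[symmetric])
  finally show ?thesis .
qed

text \<open>The radial Laplacian: for \<open>w = v / r\<close> one has
  \<open>w'' + 2 * w' / r = v'' / r\<close>, and \<open>v'' = F\<close>.\<close>

lemma sum_dg:
  assumes "x \<noteq> 0"
  shows "(\<Sum>i\<in>UNIV. dg i x) = of_real (F (norm x) / norm x)"
proof -
  have n: "(\<Sum>i\<in>UNIV. (x $ i)\<^sup>2) = (norm x)\<^sup>2"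
    by (simp add: norm_vec_def L2_set_def sum_nonneg)
  have "(\<Sum>i\<in>UNIV. dg i x) = of_real (\<Sum>i\<in>UNIV. (F (norm x) - 3 * w1 (norm x)) / norm x ^ 3 * (x $ i)\<^sup>2 + w1 (norm x) / norm x)"
    unfolding dg_def by simp
  also have "(\<Sum>i\<in>UNIV. (F (norm x) - 3 * w1 (norm x)) / norm x ^ 3 * (x $ i)\<^sup>2 + w1 (norm x) / norm x)
      = (F (norm x) - 3 * w1 (norm x)) / norm x ^ 3 * (norm x)\<^sup>2 + 3 * (w1 (norm x) / norm x)"
    unfolding n[symmetric] by (simp add: sum.distrib sum_distrib_left)
  also have "\<dots> = F (norm x) / norm x"
    using assms by (simp add: field_simps power2_eq_square power3_eq_cube)
  finally show ?thesis .
qed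

text \<open>Undoes the substitution \<open>v = r * w\<close>: the explicit powers of
  \<open>r\<close> in the radial force are absorbed, and the nonlinearity of the original equation
  reappears.\<close>

lemma F_over_r:
  assumes "0 < r"
  shows "F r / r = \<Lambda> * w r + pot (\<lambda>r. (v r)\<^sup>2) r * w r + \<nu> * (\<bar>w r\<bar> powr (q - 2) * w r) - \<bar>w r\<bar> powr (p - 2) * w r"
proof -
  have e: "\<bar>v r\<bar> powr (e - 2) * v r * r powr (2 - e) / r = \<bar>w r\<bar> powr (e - 2) * w r" for e
  proof -
    have "\<bar>w r\<bar> powr (e - 2) = \<bar>v r\<bar> powr (e - 2) / r powr (e - 2)" using assms by (simp add: w_def powr_divide)
    also have "\<dots> = \<bar>v r\<bar> powr (e - 2) * r powr (2 - e)" using powr_minus_divide[of r "e - 2"] by simp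
    finally show ?thesis by (simp add: w_def)
  qed
  have "F r / r = \<Lambda> * (v r / r) + pot (\<lambda>r. (v r)\<^sup>2) r * (v r / r) + \<nu> * (\<bar>v r\<bar> powr (q - 2) * v r * r powr (2 - q) / r)
      - \<bar>v r\<bar> powr (p - 2) * v r * r powr (2 - p) / r"
    by (simp add: radial_force_def add_divide_distrib diff_divide_distrib)
  then show ?thesis unfolding e w_def .
qed

text \<open>Against a bounded, compactly supported factor only local integrability matters. The
  worst case is \<open>dg\<close>, of size \<open>(\<bar>F\<bar> + 4 * \<bar>w1\<bar>) / r\<close>;
  the weight \<open>r\<^sup>2\<close> leaves \<open>r * \<bar>F\<bar>\<close>, of order
  \<open>r powr (1 - \<theta>)\<close> near 0.\<close>

lemma integrable_cutoff:
  fixes \<phi> :: "real^3 \<Rightarrow> complex"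
  assumes \<phi>: "continuous_on UNIV \<phi>" "\<And>x. norm (\<phi> x) \<le> B" "\<And>x. R < norm x \<Longrightarrow> \<phi> x = 0"
  shows "integrable lborel (\<lambda>x. u x * \<phi> x)" "integrable lborel (\<lambda>x. g x $ i * \<phi> x)"
    "integrable lborel (\<lambda>x. dg i x * \<phi> x)"
    "integrable lborel (\<lambda>x. of_real (pot (\<lambda>r. (v r)\<^sup>2) (norm x)) * u x * \<phi> x)"
    "2 < e \<Longrightarrow> e < 6 \<Longrightarrow> integrable lborel (\<lambda>x. of_real (norm (u x) powr (e - 2)) * u x * \<phi> x)"
proof -
  have [measurable]: "\<phi> \<in> borel_measurable borel" using \<phi>(1) by (rule borel_measurable_continuous_onI)
  have [measurable]: "pot (\<lambda>r. (v r)\<^sup>2) \<in> borel_measurable borel" by (rule pot_measurable) measurable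
  have wr: "r\<^sup>2 * \<bar>w r\<bar> = r * \<bar>v r\<bar>" if "0 < r" for r using that by (simp add: w_def power2_eq_square)
  have iw: "integrable lborel (\<lambda>r. indicator {0<..R} r * (r\<^sup>2 * \<bar>w r\<bar>))"
  proof -
    have "(\<lambda>r. indicator {0<..R} r * (r\<^sup>2 * \<bar>w r\<bar>)) = (\<lambda>r. indicator {0<..R} r * (r * \<bar>v r\<bar>))"
      using wr by (auto simp: indicator_def fun_eq_iff)
    then show ?thesis using rv_loc by simp
  qed
  show "integrable lborel (\<lambda>x. u x * \<phi> x)"
    by (rule radial_integrable_cutoff[where K="\<lambda>r. \<bar>w r\<bar>", OF _ _ _ iw _ \<phi>(2,3)]) (auto simp: u_def)
  have ig: "integrable lborel (\<lambda>r. indicator {0<..R} r * (r\<^sup>2 * \<bar>w1 r\<bar>))"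
  proof (rule Bochner_Integration.integrable_bound)
    show "integrable lborel (\<lambda>r. \<bar>R\<bar> * (indicator {0<..R} r * (r * \<bar>w1 r\<bar>)))"
      by (intro integrable_mult_right rw1_loc)
    have "norm (indicator {0<..R} r * (r\<^sup>2 * \<bar>w1 r\<bar>)) \<le> norm (\<bar>R\<bar> * (indicator {0<..R} r * (r * \<bar>w1 r\<bar>)))" for r
    proof (cases "r \<in> {0<..R}")
      case True
      then have "r * (r * \<bar>w1 r\<bar>) \<le> R * (r * \<bar>w1 r\<bar>)" by (intro mult_right_mono) auto
      then show ?thesis using True by (simp add: power2_eq_square abs_mult mult.assoc)
    qed simp
    then show "AE r in lborel. norm (indicator {0<..R} r * (r\<^sup>2 * \<bar>w1 r\<bar>)) \<le> norm (\<bar>R\<bar> * (indicator {0<..R} r * (r * \<bar>w1 r\<bar>)))"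
      by simp
  qed measurable
  show "integrable lborel (\<lambda>x. g x $ i * \<phi> x)"
    by (rule radial_integrable_cutoff[where K="\<lambda>r. \<bar>w1 r\<bar>", OF _ _ _ ig _ \<phi>(2,3)]) (auto simp: g_nth_le)
  have id: "integrable lborel (\<lambda>r. indicator {0<..R} r * (r\<^sup>2 * ((\<bar>F r\<bar> + 4 * \<bar>w1 r\<bar>) / r)))"
  proof -
    have "integrable lborel (\<lambda>r. indicator {0<..R} r * (r * \<bar>F r\<bar>) + 4 * (indicator {0<..R} r * (r * \<bar>w1 r\<bar>)))"
      by (intro Bochner_Integration.integrable_add integrable_mult_right rF_loc rw1_loc)
    moreover have "(\<lambda>r. indicator {0<..R} r * (r\<^sup>2 * ((\<bar>F r\<bar> + 4 * \<bar>w1 r\<bar>) / r)))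
        = (\<lambda>r. indicator {0<..R} r * (r * \<bar>F r\<bar>) + 4 * (indicator {0<..R} r * (r * \<bar>w1 r\<bar>)))"
    proof
      fix r :: real
      have e: "r\<^sup>2 * (x / r) = r * x" if "0 < r" for x using that by (simp add: power2_eq_square)
      show "indicator {0<..R} r * (r\<^sup>2 * ((\<bar>F r\<bar> + 4 * \<bar>w1 r\<bar>) / r))
          = indicator {0<..R} r * (r * \<bar>F r\<bar>) + 4 * (indicator {0<..R} r * (r * \<bar>w1 r\<bar>))"
      proof (cases "r \<in> {0<..R}")
        case True
        then have "r\<^sup>2 * ((\<bar>F r\<bar> + 4 * \<bar>w1 r\<bar>) / r) = r * \<bar>F r\<bar> + 4 * (r * \<bar>w1 r\<bar>)"
          by (subst e) (simp_all add: distrib_left)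
        with True show ?thesis by (simp only: indicator_simps mult_1)
      qed simp
    qed
    ultimately show ?thesis by simp
  qed
  show "integrable lborel (\<lambda>x. dg i x * \<phi> x)"
    by (rule radial_integrable_cutoff[where K="\<lambda>r. (\<bar>F r\<bar> + 4 * \<bar>w1 r\<bar>) / r", OF _ _ _ id _ \<phi>(2,3)]) (auto intro: dg_le)
  define P where "P = 4 * pi * (\<integral>s. \<bar>(v s)\<^sup>2 / s\<bar> \<partial>lborel)"
  have P: "\<bar>pot (\<lambda>r. (v r)\<^sup>2) r\<bar> \<le> P" for r
    unfolding P_def by (rule pot_le[OF pot_class_square(1)[OF en sq]])
  have P0: "0 \<le> P" using P[of 0] by linarith
  have ip: "integrable lborel (\<lambda>r. indicator {0<..R} r * (r\<^sup>2 * (P * \<bar>w r\<bar>)))"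
    using integrable_mult_right[OF iw, of P] by (simp add: mult_ac)
  show "integrable lborel (\<lambda>x. of_real (pot (\<lambda>r. (v r)\<^sup>2) (norm x)) * u x * \<phi> x)"
    by (rule radial_integrable_cutoff[where K="\<lambda>r. P * \<bar>w r\<bar>", OF _ _ _ ip _ \<phi>(2,3)])
      (auto simp: u_def norm_mult P P0 intro!: mult_right_mono)
  show "integrable lborel (\<lambda>x. of_real (norm (u x) powr (e - 2)) * u x * \<phi> x)" if "2 < e" "e < 6"
    by (rule radial_integrable_cutoff[where K="\<lambda>r. \<bar>w r\<bar> powr (e - 2) * \<bar>w r\<bar>", OF _ _ _ power_loc[OF that] _ \<phi>(2,3)])
      (auto simp: u_def norm_mult)
qed

lemma u_weak_gradient: "weak_gradient u g"
  unfolding weak_gradient_def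
proof (intro conjI ballI allI u_L2 g_L2)
  fix \<phi> :: "real^3 \<Rightarrow> complex" and i assume "\<phi> \<in> test_functions"
  then obtain R B where t: "0 < R" "\<And>x. norm (\<phi> x) \<le> B" "\<And>i x. norm (partial_deriv i \<phi> x) \<le> B"
    "\<And>x. R < norm x \<Longrightarrow> \<phi> x = 0" "\<And>i x. R < norm x \<Longrightarrow> partial_deriv i \<phi> x = 0"
    "\<And>i x. ((\<lambda>t. \<phi> (x + t *\<^sub>R axis i 1)) has_vector_derivative partial_deriv i \<phi> x) (at 0)"
    "continuous_on UNIV \<phi>" "\<And>i. continuous_on UNIV (partial_deriv i \<phi>)"
    by (rule test_functionsE) blast
  show "(LINT x|lborel. u x * partial_deriv i \<phi> x) = - (LINT x|lborel. g x $ i * \<phi> x)"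
    by (rule integration_by_parts_punctured[where e="axis i 1", OF du g_cont t(6,8)
        integrable_cutoff(1)[OF t(7,2,4)] integrable_cutoff(1)[OF t(8,3,5)] integrable_cutoff(2)[OF t(7,2,4)]])
qed

lemma u_weak_solution: "weak_solution p q (- \<nu>) \<Lambda> u"
  unfolding weak_solution_def
proof (intro conjI exI[of _ g] ballI u_weak_gradient)
  show "AE x in lborel. integrable lborel (\<lambda>y. 1 / norm (x - y) * (norm (u y))\<^sup>2)"
    using AE_nonzero by eventually_elim (rule coulomb_u(1))
  fix \<phi> :: "real^3 \<Rightarrow> complex" assume "\<phi> \<in> test_functions"
  then obtain R B where t: "0 < R" "\<And>x. norm (\<phi> x) \<le> B" "\<And>i x. norm (partial_deriv i \<phi> x) \<le> B"
    "\<And>x. R < norm x \<Longrightarrow> \<phi> x = 0" "\<And>i x. R < norm x \<Longrightarrow> partial_deriv i \<phi> x = 0"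
    "\<And>i x. ((\<lambda>t. \<phi> (x + t *\<^sub>R axis i 1)) has_vector_derivative partial_deriv i \<phi> x) (at 0)"
    "continuous_on UNIV \<phi>" "\<And>i. continuous_on UNIV (partial_deriv i \<phi>)"
    by (rule test_functionsE) blast
  define \<psi> where "\<psi> x = cnj (\<phi> x)" for x
  define \<psi>i where "\<psi>i i x = cnj (partial_deriv i \<phi> x)" for i x
  have c: "continuous_on UNIV \<psi>" "\<And>i. continuous_on UNIV (\<psi>i i)"
    unfolding \<psi>_def \<psi>i_def by (intro continuous_intros t)+
  have b: "\<And>x. norm (\<psi> x) \<le> B" "\<And>x. R < norm x \<Longrightarrow> \<psi> x = 0"
    "\<And>i x. norm (\<psi>i i x) \<le> B" "\<And>i x. R < norm x \<Longrightarrow> \<psi>i i x = 0"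
    using t by (auto simp: \<psi>_def \<psi>i_def)
  have d: "((\<lambda>t. \<psi> (x + t *\<^sub>R axis i 1)) has_vector_derivative \<psi>i i x) (at 0)" for i x
    unfolding \<psi>_def \<psi>i_def by (rule has_vector_derivative_cnj[OF t(6)])
  note I = integrable_cutoff[OF c(1) b(1,2)]
  note I' = integrable_cutoff[OF c(2) b(3,4)]
  \<comment> \<open>A second integration by parts, now on the gradient components. The origin leaves
    no boundary term because the second derivatives are locally integrable.\<close>
  have parts: "(LINT x|lborel. g x $ i * \<psi>i i x) = - (LINT x|lborel. dg i x * \<psi> x)" for i
    by (rule integration_by_parts_punctured[where e="axis i 1", OF dg dg_cont d c(2) I(2) I'(2) I(3)])
  define V where "V = (\<lambda>x. of_real (pot (\<lambda>r. (v r)\<^sup>2) (norm x)) * u x * \<psi> x)"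
  define T where "T e = (\<lambda>x. of_real (norm (u x) powr (e - 2)) * u x * \<psi> x)" for e
  have iT: "integrable lborel (T p)" "integrable lborel (T q)" unfolding T_def using p q by (auto intro!: I(5))
  have iV: "integrable lborel V" unfolding V_def by (rule I(4))
  define lhs where "lhs = (\<lambda>x. (\<Sum>i\<in>UNIV. g x $ i * cnj (partial_deriv i \<phi> x))
                       + of_real \<Lambda> * u x * cnj (\<phi> x)
                       + of_real (coulomb_potential u x) * u x * cnj (\<phi> x))"
  define rhs where "rhs = (\<lambda>x. of_real (norm (u x) powr (p - 2)) * u x * cnj (\<phi> x)
                       + of_real (- \<nu>) * of_real (norm (u x) powr (q - 2)) * u x * cnj (\<phi> x))"
  have rhs: "rhs = (\<lambda>x. T p x + of_real (- \<nu>) * T q x)" by (simp add: rhs_def T_def \<psi>_def mult.assoc)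
  have irhs: "integrable lborel rhs" unfolding rhs by (intro Bochner_Integration.integrable_add integrable_mult_right iT)
  \<comment> \<open>The radial potential replaces the convolution. Newton's theorem was shown for
    \<open>x \<noteq> 0\<close>, so the two left sides are compared only almost everywhere.\<close>
  define lhs' where "lhs' = (\<lambda>x. (\<Sum>i\<in>UNIV. g x $ i * \<psi>i i x) + of_real \<Lambda> * (u x * \<psi> x) + V x)"
  have ilhs': "integrable lborel lhs'"
    unfolding lhs'_def
    by (intro Bochner_Integration.integrable_add Bochner_Integration.integrable_sum integrable_mult_right I'(2) I(1) iV)
  have aelhs: "AE x in lborel. lhs' x = lhs x"
    using AE_nonzero
  proof eventually_elim
    case (elim x)
    then show ?case
      by (simp add: lhs_def lhs'_def V_def \<psi>_def \<psi>i_def coulomb_u(2) mult.assoc)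
  qed
  have [measurable]: "pot (\<lambda>r. (v r)\<^sup>2) \<in> borel_measurable borel" by (rule pot_measurable) measurable
  have cp: "coulomb_potential u \<in> borel_measurable borel"
    unfolding coulomb_potential_def conv_def by measurable
  have lm: "lhs \<in> borel_measurable lborel"
  proof -
    have [measurable]: "\<psi> \<in> borel_measurable borel" "\<And>i. \<psi>i i \<in> borel_measurable borel"
      using c by (auto intro: borel_measurable_continuous_onI)
    note [measurable] = cp
    have "lhs = (\<lambda>x. (\<Sum>i\<in>UNIV. g x $ i * \<psi>i i x) + of_real \<Lambda> * u x * \<psi> x + of_real (coulomb_potential u x) * u x * \<psi> x)"
      by (simp add: lhs_def \<psi>_def \<psi>i_def)
    then show ?thesis by simp
  qed
  have ilhs: "integrable lborel lhs"
    using integrable_cong_AE[OF borel_measurable_integrable[OF ilhs'] lm aelhs] ilhs' by blast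
  have "integral\<^sup>L lborel lhs = integral\<^sup>L lborel lhs'"
    using aelhs lm ilhs' by (intro integral_cong_AE) auto
  also have "\<dots> = (\<Sum>i\<in>UNIV. LINT x|lborel. g x $ i * \<psi>i i x) + of_real \<Lambda> * (LINT x|lborel. u x * \<psi> x) + integral\<^sup>L lborel V"
    unfolding lhs'_def using I'(2) I(1) iV by simp
  also have "\<dots> = - (\<Sum>i\<in>UNIV. LINT x|lborel. dg i x * \<psi> x) + of_real \<Lambda> * (LINT x|lborel. u x * \<psi> x) + integral\<^sup>L lborel V"
    unfolding parts by (simp add: sum_negf)
  also have "\<dots> = (LINT x|lborel. - (\<Sum>i\<in>UNIV. dg i x * \<psi> x) + of_real \<Lambda> * (u x * \<psi> x) + V x)"
    using I(3) I(1) iV by simp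
  also have "\<dots> = integral\<^sup>L lborel rhs"
  proof (rule integral_cong_AE)
    show "(\<lambda>x. - (\<Sum>i\<in>UNIV. dg i x * \<psi> x) + of_real \<Lambda> * (u x * \<psi> x) + V x) \<in> borel_measurable lborel"
      using I(3) I(1) iV by (intro borel_measurable_integrable) simp
    show "rhs \<in> borel_measurable lborel" using irhs by (rule borel_measurable_integrable)
    show "AE x in lborel. - (\<Sum>i\<in>UNIV. dg i x * \<psi> x) + of_real \<Lambda> * (u x * \<psi> x) + V x = rhs x"
      using AE_nonzero
    proof eventually_elim
      case (elim x)
      have "(\<Sum>i\<in>UNIV. dg i x * \<psi> x) = of_real (F (norm x) / norm x) * \<psi> x"
        unfolding sum_distrib_right[symmetric] sum_dg[OF elim] ..
      also have "F (norm x) / norm x = \<Lambda> * w (norm x) + pot (\<lambda>r. (v r)\<^sup>2) (norm x) * w (norm x)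
          + \<nu> * (\<bar>w (norm x)\<bar> powr (q - 2) * w (norm x)) - \<bar>w (norm x)\<bar> powr (p - 2) * w (norm x)"
        using elim by (intro F_over_r) simp
      finally show ?case
        by (simp add: rhs T_def V_def u_def algebra_simps)
    qed
  qed
  finally have eq: "integral\<^sup>L lborel lhs = integral\<^sup>L lborel rhs" .
  show "let lhs = (\<lambda>x. (\<Sum>i\<in>UNIV. g x $ i * cnj (partial_deriv i \<phi> x))
                       + of_real \<Lambda> * u x * cnj (\<phi> x)
                       + of_real (coulomb_potential u x) * u x * cnj (\<phi> x));
              rhs = (\<lambda>x. of_real (norm (u x) powr (p - 2)) * u x * cnj (\<phi> x)
                       + of_real (- \<nu>) * of_real (norm (u x) powr (q - 2)) * u x * cnj (\<phi> x))
          in integrable lborel lhs \<and> integrable lborel rhs \<and>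
             integral\<^sup>L lborel lhs = integral\<^sup>L lborel rhs"
    unfolding Let_def lhs_def[symmetric] rhs_def[symmetric] using ilhs irhs eq by blast
qed

lemma u_H1_rad: "u \<in> H1_rad"
proof -
  have "u \<in> H1" using u_L2 u_weak_gradient by (auto simp: H1_def)
  moreover have "AE x in lborel. u x = (\<lambda>r. complex_of_real (w r)) (norm x)" by (simp add: u_def)
  ultimately show ?thesis
    unfolding H1_rad_def by (intro CollectI conjI exI[of _ "\<lambda>r. complex_of_real (w r)"])
qed

end

theorem theorem1p5:
  fixes \<mu> p q :: real
  assumes "\<mu> \<le> 0" and "q \<in> {2<..<8/3}" and "p \<in> {10/3<..<6}"
  shows "\<exists>a\<^sub>0>0. \<forall>a\<in>{0<..<a\<^sub>0}.
           \<exists>\<Lambda> u. \<Lambda> \<in> {0::real<..} \<and> u \<in> H1_rad \<and> normalized_solution p q \<mu> a \<Lambda> u"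
proof -
  have pq: "10 / 3 < p" "p < 6" "2 < q" "q < 8 / 3" "0 \<le> - \<mu>" using assms by auto
  obtain m\<^sub>0 where m0: "0 < m\<^sub>0" "\<And>m. 0 < m \<Longrightarrow> m < m\<^sub>0 \<Longrightarrow>
    \<exists>v v' A \<Lambda>. 0 < \<Lambda> \<and> energy_le v A \<and> integrable lborel (\<lambda>r. (v r)\<^sup>2) \<and> mass v = m \<and>
      (\<forall>r>0. (v has_real_derivative v' r) (at r)) \<and>
      (\<forall>r>0. (v' has_real_derivative radial_force p q (- \<mu>) \<Lambda> v r) (at r))"
    using radial_solution[OF pq] by blast
  show ?thesis
  \<comment> \<open>The squared norm of \<open>u\<close> is \<open>4 * pi * mass v\<close>, so
    \<open>a\<^sup>2 = 4 * pi * m\<close> and the mass threshold becomes a threshold for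
    \<open>a\<close>.\<close>
  proof (rule exI[of _ "sqrt (4 * pi * m\<^sub>0)"], intro conjI ballI)
    show "0 < sqrt (4 * pi * m\<^sub>0)" using m0(1) by simp
    fix a assume "a \<in> {0<..<sqrt (4 * pi * m\<^sub>0)}"
    then have a: "0 < a" "a < sqrt (4 * pi * m\<^sub>0)" by auto
    have "a\<^sup>2 < (sqrt (4 * pi * m\<^sub>0))\<^sup>2" using a by (intro power_strict_mono) auto
    then have "a\<^sup>2 / (4 * pi) < m\<^sub>0" using m0(1) by (simp add: pos_divide_less_eq mult.commute)
    then obtain v v' A \<Lambda> where v: "0 < \<Lambda>" "energy_le v A" "integrable lborel (\<lambda>r. (v r)\<^sup>2)" "mass v = a\<^sup>2 / (4 * pi)"
      "\<And>r. 0 < r \<Longrightarrow> (v has_real_derivative v' r) (at r)"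
      "\<And>r. 0 < r \<Longrightarrow> (v' has_real_derivative radial_force p q (- \<mu>) \<Lambda> v r) (at r)"
      using m0(2)[of "a\<^sup>2 / (4 * pi)"] a by auto
    \<comment> \<open>The derivative is unspecified at nonpositive points and is set to 0 there; on
      the positive axis nothing changes.\<close>
    define v1 where "v1 r = (if 0 < r then v' r else 0)" for r
    have v1: "(v1 has_real_derivative radial_force p q (- \<mu>) \<Lambda> v r) (at r)" if "0 < r" for r
    proof -
      have ev: "\<forall>\<^sub>F y in nhds r. v1 y = v' y"
        using eventually_nhds_in_open[of "{0<..}" r] that by (auto elim!: eventually_mono simp: v1_def)
      show ?thesis unfolding DERIV_cong_ev[OF refl ev refl] by (rule v(6)[OF that])
    qed
    interpret radial_ode p q "- \<mu>" \<Lambda> A v v1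
      using pq v(2,3,5) v1 by unfold_locales (simp_all add: v1_def)
    have "normalized_solution p q \<mu> a \<Lambda> u"
      unfolding normalized_solution_def using u_weak_solution u_mass v(4) by simp
    then show "\<exists>\<Lambda> u. \<Lambda> \<in> {0::real<..} \<and> u \<in> H1_rad \<and> normalized_solution p q \<mu> a \<Lambda> u"
      using v(1) u_H1_rad by auto
  qed
qed

end
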